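(* Let $r_1,\ldots,r_m\in(0,\infty)$, $s_1,\ldots,s_m\in(0,\infty]$ with $r_j<s_j$ and $p_j\in[r_j,s_j]$ for $j\in\{1,\ldots,m\}$, with $\frac1p:=\sum_{j=1}^m\frac1{p_j}$. Let \[ T:\bigcup_{w_1\in A_{p_1,(r_1,s_1)}}L^{p_1}_{w_1}(\mathbf{R}^d)\times\cdots\times\bigcup_{w_m\in A_{p_m,(r_m,s_m)}}L^{p_m}_{w_m}(\mathbf{R}^d)\to L^0(\mathbf{R}^d) \] be a map for which there is an increasing function $\phi:[0,\infty)^m\to[0,\infty)$ such that for all $w_j\in A_{p_j,(r_j,s_j)}$ and $f_j\in L^{p_j}_{w_j}(\mathbf{R}^d)$, $j\in\{1,\ldots,m\}$, with $w=\prod_{j=1}^mw_j$, \[ \|T(f_1,\ldots,f_m)\|_{L^p_w(\mathbf{R}^d)}\leq\phi([w_1]_{p_1,(r_1,s_1)},\ldots,[w_m]_{p_m,(r_m,s_m)})\prod_{j=1}^m\|f_j\|_{L^{p_j}_{w_j}(\mathbf{R}^d)}. \] Let $X_1,\ldots,X_m$ be quasi-Banach function spaces over $\mathbf{R}^d$ such that $X_j$ is $r_j$-convex and $s_j$-concave and for all $j\in\{1,\ldots,m\}$: (a) if $p_j\neq r_j$, then $M:(X_j)_{r_j,s_j}\to(X_j)_{r_j,s_j}$ is bounded; (b) if $p_j\neq s_j$, then $M:[(X_j)_{r_j,s_j}]'\to[(X_j)_{r_j,s_j}]'$ is bounded. Let $X=\prod_{j=1}^mX_j$. Then $T(f_1,\ldots,f_m)$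 is well-defined for all $f_j\in X_j$ and $T:X_1\times\cdots\times X_m\to X$ is bounded with \[ \|T\|_{X_1\times\cdots\times X_m\to X}\leq2^{\frac1r-\frac1s}\phi(C_1,\ldots,C_m), \] where $\frac1r=\sum_{j=1}^m\frac1{r_j}$, $\frac1s=\sum_{j=1}^m\frac1{s_j}$, and \[ C_j=2^{\frac1{r_j}-\frac1{s_j}}\|M\|_{(X_j)_{r_j,s_j}\to(X_j)_{r_j,s_j}}^{\frac1{r_j}-\frac1{p_j}}\|M\|_{[(X_j)_{r_j,s_j}]'\to[(X_j)_{r_j,s_j}]'}^{\frac1{p_j}-\frac1{s_j}} . \]
   Context: Conventions: $\frac1\infty=0$, $\frac10=\infty$; a factor raised to the power $0$ is read as $1$. A weight is a measurable function with $0<w<\infty$ a.e. $L^0(\Omega)$ is the space of a.e. finite measurable functions. $\|f\|_{L^p_w}=\|fw\|_{L^p}$. $Q$ runs over cubes with sides parallel to the axes. $Mf(x)=\sup_Q\big(\frac1{|Q|}\int_Q|f|\big)\mathbf{1}_Q(x)$. Increasing for $\phi$ on $[0,\infty)^m$ means increasing in each variable. A quasi-Banach function space over a $\sigma$-finite measure space $\Omega$ is a vector space $X\subseteq L^0(\Omega)$ with a quasi-norm such that: (ideal) $f\in X$, $g\in L^0$, $|g|\le|f|$ imply $g\in X$, $\|g\|_X\le\|f\|_X$; (Fatou) $0\le f_n\uparrow f$, $f_n\in X$, $\sup_n\|f_n\|_X<\infty$ imply $f\in X$, $\|f\|_X=\sup_n\|f_n\|_X$; (saturation) every measurable $E$ of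 positive measure contains a measurable $F$ of positive measure with $\mathbf{1}_F\in X$. The Köthe dual is $X'=\{g\in L^0: fg\in L^1\ \forall f\in X\}$, $\|g\|_{X'}=\sup_{\|f\|_X=1}\|fg\|_{L^1}$. For $p\in(0,\infty)$, $X^p=\{f:|f|^{1/p}\in X\}$, $\|f\|_{X^p}=\||f|^{1/p}\|_X^p$. $X$ is $p$-convex if $\|(|f|^p+|g|^p)^{1/p}\|_X\le(\|f\|_X^p+\|g\|_X^p)^{1/p}$ and $q$-concave if $(\|f\|_X^q+\|g\|_X^q)^{1/q}\le\|(|f|^q+|g|^q)^{1/q}\|_X$ for all $f,g\in X$ (usual modification for $\infty$). For $r<s$, $X_{r,s}=\big[[(X^r)']^{(s/r)'}\big]'$ with $(s/r)'=\frac1{1-r/s}$. $\prod_{j=1}^mX_j$ is the set of $f\in L^0$ for which there are $0\le f_j\in X_j$ with $|f|\le\prod_jf_j$, with $\|f\|=\inf\prod_j\|f_j\|_{X_j}$ over all such $f_j$. $w\in A_{p,(r,s)}$ iff $[w]_{p,(r,s)}=\sup_Q|Q|^{-(\frac1r-\frac1s)}\|w\mathbf{1}_Q\|_{L^{\frac1{\frac1p-\frac1s}}(\mathbf{R}^d)}\|w^{-1}\mathbf{1}_Q\|_{L^{\frac1{\frac1r-\frac1p}}(\mathbf{R}^d)}<\infty$. *)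

theory Defs
  imports "HOL-Analysis.Analysis" "HOL-Probability.Essential_Supremum"
begin

text \<open>
  The scalar field is a type variable of sort \<open>{real_normed_field, euclidean_space}\<close>, so that
  all statements cover both real- and complex-valued functions. Elements of $L^0$ are represented by
  measurable functions; two representatives of the same element are equal almost everywhere.
  Exponents that may be infinite have type \<open>ennreal\<close>, where $1/\infty = 0$ and
  $1/0 = \infty$ hold by definition of division.
\<close>

definition L0 :: "'a measure \<Rightarrow> ('a \<Rightarrow> 'k::{real_normed_field, euclidean_space}) set" where
  "L0 M = borel_measurable M"

definition rcp :: "ennreal \<Rightarrow> real" where
  "rcp p = enn2real (1 / p)"

text \<open>
  A factor raised to the power $0$ is $1$, whatever the factor; it may be the norm of an unbounded
  operator, for which \<open>maximal_norm\<close> below is unspecified. Moreover \<open>0 powr 0 = 0\<close>.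
\<close>

definition pow0 :: "real \<Rightarrow> real \<Rightarrow> real" where
  "pow0 x a = (if a = 0 then 1 else x powr a)"

definition Lp_norm :: "'a measure \<Rightarrow> ennreal \<Rightarrow> ('a \<Rightarrow> 'b::real_normed_vector) \<Rightarrow> ennreal" where
  "Lp_norm M p f =
     (if p = \<infinity> then esssup M (\<lambda>x. ennreal (norm (f x)))
      else let I = (\<integral>\<^sup>+ x. ennreal (norm (f x) powr enn2real p) \<partial>M)
           in if I = \<infinity> then \<infinity> else ennreal (enn2real I powr (1 / enn2real p)))"


record ('a, 'k) fspace =
  fs_carrier :: "('a \<Rightarrow> 'k) set"
  fs_norm :: "('a \<Rightarrow> 'k) \<Rightarrow> real"

definition quasi_normed :: "'a measure \<Rightarrow> ('a, 'k::{real_normed_field, euclidean_space}) fspace \<Rightarrow> bool" where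
  "quasi_normed M X \<longleftrightarrow>
     fs_carrier X \<subseteq> L0 M \<and>
     (\<lambda>x. 0) \<in> fs_carrier X \<and>
     (\<forall>f\<in>fs_carrier X. \<forall>g\<in>fs_carrier X. (\<lambda>x. f x + g x) \<in> fs_carrier X) \<and>
     (\<forall>c. \<forall>f\<in>fs_carrier X. (\<lambda>x. c * f x) \<in> fs_carrier X) \<and>
     (\<forall>f\<in>fs_carrier X. 0 \<le> fs_norm X f) \<and>
     (\<forall>f\<in>fs_carrier X. fs_norm X f = 0 \<longleftrightarrow> (AE x in M. f x = 0)) \<and>
     (\<forall>c. \<forall>f\<in>fs_carrier X. fs_norm X (\<lambda>x. c * f x) = norm c * fs_norm X f) \<and>
     (\<exists>K. \<forall>f\<in>fs_carrier X. \<forall>g\<in>fs_carrier X.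
        fs_norm X (\<lambda>x. f x + g x) \<le> K * (fs_norm X f + fs_norm X g))"

definition ideal_property :: "'a measure \<Rightarrow> ('a, 'k::{real_normed_field, euclidean_space}) fspace \<Rightarrow> bool" where
  "ideal_property M X \<longleftrightarrow>
     (\<forall>f\<in>fs_carrier X. \<forall>g\<in>L0 M. (AE x in M. norm (g x) \<le> norm (f x)) \<longrightarrow>
        g \<in> fs_carrier X \<and> fs_norm X g \<le> fs_norm X f)"

text \<open>
  The limit is taken in $L^0$. Limits that are infinite on a set of positive measure need no separate
  mention: if $f_n \uparrow \infty$ on such a set with bounded quasi-norms, then applying the property to
  $\min(f_n, k \mathbf{1}_F)$ for all $k$ contradicts definiteness for a suitable $F$.
\<close>

definition fatou_property :: "'a measure \<Rightarrow> ('a, 'k::{real_normed_field, euclidean_space}) fspace \<Rightarrow> bool" where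
  "fatou_property M X \<longleftrightarrow>
     (\<forall>(g :: nat \<Rightarrow> 'a \<Rightarrow> real) h.
        (\<forall>n. (\<lambda>x. of_real (g n x)) \<in> fs_carrier X) \<and>
        h \<in> borel_measurable M \<and>
        (AE x in M. (\<forall>n. 0 \<le> g n x) \<and> incseq (\<lambda>n. g n x) \<and> (\<lambda>n. g n x) \<longlonglongrightarrow> h x) \<and>
        bdd_above (range (\<lambda>n. fs_norm X (\<lambda>x. of_real (g n x)))) \<longrightarrow>
        (\<lambda>x. of_real (h x)) \<in> fs_carrier X \<and>
        fs_norm X (\<lambda>x. of_real (h x)) = (SUP n. fs_norm X (\<lambda>x. of_real (g n x))))"

definition saturation_property :: "'a measure \<Rightarrow> ('a, 'k::{real_normed_field, euclidean_space}) fspace \<Rightarrow> bool" where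
  "saturation_property M X \<longleftrightarrow>
     (\<forall>E\<in>sets M. 0 < emeasure M E \<longrightarrow>
        (\<exists>F\<in>sets M. F \<subseteq> E \<and> 0 < emeasure M F \<and> indicator F \<in> fs_carrier X))"

definition quasi_BFS :: "'a measure \<Rightarrow> ('a, 'k::{real_normed_field, euclidean_space}) fspace \<Rightarrow> bool" where
  "quasi_BFS M X \<longleftrightarrow>
     quasi_normed M X \<and> ideal_property M X \<and> fatou_property M X \<and> saturation_property M X"

definition kothe_dual :: "'a measure \<Rightarrow> ('a, 'k::{real_normed_field, euclidean_space}) fspace \<Rightarrow> ('a, 'k) fspace" where
  "kothe_dual M X =
     \<lparr>fs_carrier = {g \<in> L0 M. \<forall>f\<in>fs_carrier X. integrable M (\<lambda>x. f x * g x)},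
      fs_norm = (\<lambda>g. SUP f\<in>{f \<in> fs_carrier X. fs_norm X f = 1}. (LINT x|M. norm (f x * g x)))\<rparr>"

definition fs_power :: "'a measure \<Rightarrow> ('a, 'k::{real_normed_field, euclidean_space}) fspace \<Rightarrow> real \<Rightarrow> ('a, 'k) fspace" where
  "fs_power M X p =
     \<lparr>fs_carrier = {f \<in> L0 M. (\<lambda>x. of_real (norm (f x) powr (1 / p))) \<in> fs_carrier X},
      fs_norm = (\<lambda>f. fs_norm X (\<lambda>x. of_real (norm (f x) powr (1 / p))) powr p)\<rparr>"

text \<open>$(a^p + b^p)^{1/p}$, to be read as $\max(a,b)$ for $p = \infty$.\<close>

definition lsum :: "ennreal \<Rightarrow> real \<Rightarrow> real \<Rightarrow> real" where
  "lsum p a b =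
     (if p = \<infinity> then max a b
      else (a powr enn2real p + b powr enn2real p) powr (1 / enn2real p))"

definition p_convex :: "ennreal \<Rightarrow> ('a, 'k::{real_normed_field, euclidean_space}) fspace \<Rightarrow> bool" where
  "p_convex p X \<longleftrightarrow>
     (\<forall>f\<in>fs_carrier X. \<forall>g\<in>fs_carrier X.
        fs_norm X (\<lambda>x. of_real (lsum p (norm (f x)) (norm (g x)))) \<le> lsum p (fs_norm X f) (fs_norm X g))"

definition q_concave :: "ennreal \<Rightarrow> ('a, 'k::{real_normed_field, euclidean_space}) fspace \<Rightarrow> bool" where
  "q_concave q X \<longleftrightarrow>
     (\<forall>f\<in>fs_carrier X. \<forall>g\<in>fs_carrier X.
        lsum q (fs_norm X f) (fs_norm X g) \<le> fs_norm X (\<lambda>x. of_real (lsum q (norm (f x)) (norm (g x)))))"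

definition fs_rs :: "'a measure \<Rightarrow> ('a, 'k::{real_normed_field, euclidean_space}) fspace \<Rightarrow> real \<Rightarrow> ennreal \<Rightarrow> ('a, 'k) fspace" where
  "fs_rs M X r s =
     kothe_dual M (fs_power M (kothe_dual M (fs_power M X r)) (1 / (1 - r * rcp s)))"

definition fs_prod :: "'a measure \<Rightarrow> ('m::finite \<Rightarrow> ('a, 'k::{real_normed_field, euclidean_space}) fspace) \<Rightarrow> ('a, 'k) fspace" where
  "fs_prod M X =
     (let factors = (\<lambda>f. {g :: 'm \<Rightarrow> 'a \<Rightarrow> real.
            (\<forall>j. (AE x in M. 0 \<le> g j x) \<and> (\<lambda>x. of_real (g j x)) \<in> fs_carrier (X j)) \<and>
            (AE x in M. norm (f x) \<le> (\<Prod>j\<in>UNIV. g j x))})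
      in \<lparr>fs_carrier = {f \<in> L0 M. factors f \<noteq> {}},
          fs_norm = (\<lambda>f. INF g\<in>factors f. \<Prod>j\<in>UNIV. fs_norm (X j) (\<lambda>x. of_real (g j x)))\<rparr>)"


definition cubes :: "(real ^ 'd) set set" where
  "cubes = {cbox a (a + (\<chi> i. l)) | a l. 0 < l}"

definition maximal :: "(real ^ 'd \<Rightarrow> 'k::{real_normed_field, euclidean_space}) \<Rightarrow> real ^ 'd \<Rightarrow> ennreal" where
  "maximal f x =
     (SUP Q\<in>cubes. (\<integral>\<^sup>+ y\<in>Q. ennreal (norm (f y)) \<partial>lebesgue) / emeasure lebesgue Q * indicator Q x)"

definition weight :: "(real ^ 'd \<Rightarrow> real) \<Rightarrow> bool" where
  "weight w \<longleftrightarrow> w \<in> borel_measurable lebesgue \<and> (AE x in lebesgue. 0 < w x)"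

definition A_const :: "ennreal \<Rightarrow> real \<Rightarrow> ennreal \<Rightarrow> (real ^ 'd \<Rightarrow> real) \<Rightarrow> ennreal" where
  "A_const p r s w =
     (SUP Q\<in>cubes.
        ennreal (measure lebesgue Q powr (- (1 / r - rcp s))) *
        Lp_norm lebesgue (1 / (1 / p - 1 / s)) (\<lambda>x. w x * indicator Q x) *
        Lp_norm lebesgue (1 / (1 / ennreal r - 1 / p)) (\<lambda>x. inverse (w x) * indicator Q x))"

definition A_class :: "ennreal \<Rightarrow> real \<Rightarrow> ennreal \<Rightarrow> (real ^ 'd \<Rightarrow> real) set" where
  "A_class p r s = {w. weight w \<and> A_const p r s w < \<infinity>}"

definition Lpw_norm :: "ennreal \<Rightarrow> (real ^ 'd \<Rightarrow> real) \<Rightarrow> (real ^ 'd \<Rightarrow> 'k::{real_normed_field, euclidean_space}) \<Rightarrow> ennreal" where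
  "Lpw_norm p w f = Lp_norm lebesgue p (\<lambda>x. f x * of_real (w x))"

definition Lpw :: "ennreal \<Rightarrow> (real ^ 'd \<Rightarrow> real) \<Rightarrow> (real ^ 'd \<Rightarrow> 'k::{real_normed_field, euclidean_space}) set" where
  "Lpw p w = {f \<in> L0 lebesgue. Lpw_norm p w f < \<infinity>}"


text \<open>
  A map from \<open>D 1 \<times> \<dots> \<times> D m\<close> into $L^0$, given on representatives: it has to respect
  equality almost everywhere.
\<close>

definition L0_map :: "'a measure \<Rightarrow> ('m \<Rightarrow> ('a \<Rightarrow> 'k::{real_normed_field, euclidean_space}) set)
    \<Rightarrow> (('m \<Rightarrow> 'a \<Rightarrow> 'k) \<Rightarrow> 'a \<Rightarrow> 'k) \<Rightarrow> bool" where
  "L0_map M D T \<longleftrightarrow>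
     (\<forall>f. (\<forall>j. f j \<in> D j) \<longrightarrow> T f \<in> L0 M) \<and>
     (\<forall>f g. (\<forall>j. f j \<in> D j \<and> g j \<in> D j \<and> (AE x in M. f j x = g j x)) \<longrightarrow>
        (AE x in M. T f x = T g x))"

definition bounded_by :: "('m::finite \<Rightarrow> ('a, 'k) fspace) \<Rightarrow> ('a, 'k) fspace
    \<Rightarrow> (('m \<Rightarrow> 'a \<Rightarrow> 'k) \<Rightarrow> 'a \<Rightarrow> 'k) \<Rightarrow> real \<Rightarrow> bool" where
  "bounded_by X Y T C \<longleftrightarrow>
     0 \<le> C \<and>
     (\<forall>f. (\<forall>j. f j \<in> fs_carrier (X j)) \<longrightarrow>
        T f \<in> fs_carrier Y \<and> fs_norm Y (T f) \<le> C * (\<Prod>j\<in>UNIV. fs_norm (X j) (f j)))"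

definition op_bounded :: "('m::finite \<Rightarrow> ('a, 'k) fspace) \<Rightarrow> ('a, 'k) fspace
    \<Rightarrow> (('m \<Rightarrow> 'a \<Rightarrow> 'k) \<Rightarrow> 'a \<Rightarrow> 'k) \<Rightarrow> bool" where
  "op_bounded X Y T \<longleftrightarrow> (\<exists>C. bounded_by X Y T C)"

text \<open>The best constant (no linearity is assumed); only meaningful for bounded maps, as is \<open>maximal_norm\<close> below.\<close>

definition op_norm :: "('m::finite \<Rightarrow> ('a, 'k) fspace) \<Rightarrow> ('a, 'k) fspace
    \<Rightarrow> (('m \<Rightarrow> 'a \<Rightarrow> 'k) \<Rightarrow> 'a \<Rightarrow> 'k) \<Rightarrow> real" where
  "op_norm X Y T = Inf {C. bounded_by X Y T C}"

text \<open>
  Elements of \<open>Y\<close> are finite almost everywhere, so $Mf \in Y$ entails that $Mf$ is.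
\<close>

definition maximal_bounded_by :: "(real ^ 'd, 'k::{real_normed_field, euclidean_space}) fspace \<Rightarrow> real \<Rightarrow> bool" where
  "maximal_bounded_by Y C \<longleftrightarrow>
     0 \<le> C \<and>
     (\<forall>f\<in>fs_carrier Y.
        (AE x in lebesgue. maximal f x < \<infinity>) \<and>
        (\<lambda>x. of_real (enn2real (maximal f x))) \<in> fs_carrier Y \<and>
        fs_norm Y (\<lambda>x. of_real (enn2real (maximal f x))) \<le> C * fs_norm Y f)"

definition maximal_bounded :: "(real ^ 'd, 'k::{real_normed_field, euclidean_space}) fspace \<Rightarrow> bool" where
  "maximal_bounded Y \<longleftrightarrow> (\<exists>C. maximal_bounded_by Y C)"

definition maximal_norm :: "(real ^ 'd, 'k::{real_normed_field, euclidean_space}) fspace \<Rightarrow> real" where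
  "maximal_norm Y = Inf {C. maximal_bounded_by Y C}"

definition increasing_fun :: "(('m \<Rightarrow> real) \<Rightarrow> real) \<Rightarrow> bool" where
  "increasing_fun \<phi> \<longleftrightarrow>
     (\<forall>t. (\<forall>i. 0 \<le> t i) \<longrightarrow> 0 \<le> \<phi> t) \<and>
     (\<forall>t j u. (\<forall>i. 0 \<le> t i) \<and> t j \<le> u \<longrightarrow> \<phi> t \<le> \<phi> (t(j := u)))"

end

theory Submission
  imports Defs
begin

text \<open>
  For one space \<open>X\<close> put $Y = X_{r,s}$. The positive unit balls of $X^r$, of its dual, and of \<open>Y\<close> are
  convex, solid and closed under limits almost everywhere, hence equal to their bipolars, and one has the isometric
  factorization $X = Y^{1/r-1/s} \cdot L^s$. Writing $|f| \le k^{1/r-1/s} h$ accordingly and replacing \<open>k\<close> and an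
  arbitrary \<open>v\<close> in the unit ball of $Y'$ by $A_1$-majorants \<open>K\<close> and \<open>V\<close> (Rubio de Francia), the weight
  $w = K^{-(1/r-1/p)} V^{1/p-1/s}$ lies in the class, and \<open>f\<close> lies in $L^p_w$ whatever \<open>v\<close> is.
  Hence $H = |T f| \prod_j K_j^{-(1/r_j-1/p_j)}$ satisfies a bound on $\|H \prod_j v_j^{1/p_j-1/s_j}\|_{L^p}$
  for all $v_j$ in the unit balls of $Y_j'$. A minimax argument (one half of Lozanovskii's duality for Calderon products)
  turns this into a factorization $H \le \prod_j y_j^{1/p_j-1/s_j} a^{1/s}$ with $y_j \in Y_j$ and $a \in L^1$,
  and therefore $|T f| \le \prod_j g_j$ with $g_j = K_j^{1/r_j-1/p_j} y_j^{1/p_j-1/s_j} a^{1/s_j} \in X_j$.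
\<close>

section \<open>Unit balls of function spaces\<close>

text \<open>Since \<open>p0\<close> may be smaller than 1 and the product space is only
  quasi-normed, $T f$ itself cannot be treated by duality. The separate $Y_j$ can: raised to a
  finite power \<open>p0\<close>, the bound on \<open>H\<close> becomes an integral against a
  weighted geometric mean of the $v_j$ with exponents \<open>\<beta> j * p0\<close>, where the
  constant function 1 takes up the rest of the total weight 1. The case of infinite
  \<open>p0\<close> is elementary. Balls of nonnegative real functions replace norms, so that powers
  and duals become operations on sets and the scalar field stays out of the argument. Both powers of
  2 have one source: the iteration gives a majorant \<open>K\<close> with \<open>K / 2\<close> in
  the ball and $A_1$ constant $2||M||$. The $A_1$ constants of \<open>K\<close> and \<open>V\<close>
  put the 2 inside $C_j$. The halves give the outer factor: \<open>V / 2\<close> costs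
  \<open>2 powr \<beta> j\<close> when $f_j$ is measured in the weighted space, \<open>K / 2\<close>
  costs \<open>2 powr \<gamma> j\<close> when $K_j$ is put back, and
  \<open>\<gamma> j + \<beta> j\<close> is \<open>1 / r j - 1 / s j\<close>. The factorizations
  carry constants slightly above the optimal ones; this slack tends to 0 only at the very
  end.\<close>

definition nonneg_meas :: "'a measure \<Rightarrow> ('a \<Rightarrow> real) set" where
  "nonneg_meas M = {f \<in> borel_measurable M. \<forall>x. 0 \<le> f x}"

lemma nonneg_measD: "f \<in> nonneg_meas M \<Longrightarrow> f \<in> borel_measurable M" "f \<in> nonneg_meas M \<Longrightarrow> 0 \<le> f x"
  by (auto simp: nonneg_meas_def)

text \<open>For the positive part \<open>B\<close> of a unit ball this is the positive part of the
  unit ball of the Koethe dual. Other sets occur as well: the a.e. positive elements of a ball, and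
  the singleton of the constant 1, whose polar is the positive unit ball of $L^1$.\<close>

definition polar :: "'a measure \<Rightarrow> ('a \<Rightarrow> real) set \<Rightarrow> ('a \<Rightarrow> real) set" where
  "polar M B = {g \<in> nonneg_meas M. \<forall>f\<in>B. (\<integral>\<^sup>+x. ennreal (f x * g x) \<partial>M) \<le> 1}"

text \<open>Positive parts of unit balls of quasi-normed spaces with the ideal and Fatou properties.
  \<open>bounded\<close> is the definiteness of the norm: if all multiples of an indicator lie in
  \<open>B\<close>, the indicator has norm 0. \<open>solid\<close> also makes membership independent
  of null sets.\<close>

locale solid_ball =
  fixes M :: "'a measure" and B :: "('a \<Rightarrow> real) set"
  assumes nonneg_meas: "B \<subseteq> nonneg_meas M"
    and zero: "(\<lambda>x. 0) \<in> B"
    and solid: "\<And>f g. f \<in> B \<Longrightarrow> g \<in> nonneg_meas M \<Longrightarrow> (AE x in M. g x \<le> f x) \<Longrightarrow> g \<in> B"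
    and fatou: "\<And>g h. (\<And>n. g n \<in> B) \<Longrightarrow> h \<in> nonneg_meas M \<Longrightarrow>
        (AE x in M. incseq (\<lambda>n. g n x) \<and> (\<lambda>n. g n x) \<longlonglongrightarrow> h x) \<Longrightarrow> h \<in> B"
    and bounded: "\<And>E. E \<in> sets M \<Longrightarrow> (\<And>c. 0 < c \<Longrightarrow> (\<lambda>x. c * indicator E x) \<in> B) \<Longrightarrow> emeasure M E = 0"

text \<open>Convexity is kept apart because the unit ball of \<open>X\<close> is only solid. It
  becomes available for $X^r$ and for the balls derived from it.\<close>

locale function_ball = solid_ball +
  assumes convex: "\<And>f g a. f \<in> B \<Longrightarrow> g \<in> B \<Longrightarrow> 0 \<le> a \<Longrightarrow> a \<le> 1 \<Longrightarrow> (\<lambda>x. a * f x + (1 - a) * g x) \<in> B"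

context solid_ball
begin

lemma measurable: "f \<in> B \<Longrightarrow> f \<in> borel_measurable M"
  using nonneg_meas by (auto simp: nonneg_meas_def)

lemma nonneg: "f \<in> B \<Longrightarrow> 0 \<le> f x"
  using nonneg_meas by (auto simp: nonneg_meas_def)

lemma scale:
  assumes f: "f \<in> B" and a: "0 \<le> a" "a \<le> 1"
  shows "(\<lambda>x. a * f x) \<in> B"
proof (rule solid[OF f])
  show "(\<lambda>x. a * f x) \<in> nonneg_meas M"
    using measurable[OF f] nonneg[OF f] a by (auto simp: nonneg_meas_def)
  show "AE x in M. a * f x \<le> f x"
    using nonneg[OF f] a by (auto simp: mult_left_le_one_le)
qed

lemma cong: "f \<in> B \<Longrightarrow> g \<in> nonneg_meas M \<Longrightarrow> (AE x in M. g x = f x) \<Longrightarrow> g \<in> B"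
  by (rule solid) auto

text \<open>\<open>fatou\<close> covers increasing sequences only. The tail infima of
  \<open>f\<close> increase to the same limit and lie below the \<open>f n\<close>, hence belong to
  \<open>B\<close> by solidity.\<close>

lemma AE_limit:
  assumes f: "\<And>n. f n \<in> B" and h: "h \<in> nonneg_meas M"
    and lim: "AE x in M. (\<lambda>n. f n x) \<longlonglongrightarrow> h x"
  shows "h \<in> B"
proof -
  note [measurable] = measurable[OF f] nonneg_measD(1)[OF h]
  define e where "e n x = (INF k\<in>{n..}. ennreal (f k x))" for n x
  define g where "g n x = enn2real (e n x)" for n x
  have e_le: "e n x \<le> ennreal (f n x)" for n x
    unfolding e_def by (rule INF_lower) auto
  have fin: "e n x < \<infinity>" for n x
    using e_le[of n x] by (simp add: order_le_less_trans)
  have mono: "incseq (\<lambda>n. g n x)" for x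
  proof (rule incseq_SucI)
    fix n
    have "e n x \<le> e (Suc n) x"
      unfolding e_def by (rule INF_superset_mono) auto
    then show "g n x \<le> g (Suc n) x"
      unfolding g_def using fin[of "Suc n" x] by (simp add: enn2real_mono)
  qed
  have [measurable]: "e n \<in> borel_measurable M" for n
    unfolding e_def by (rule borel_measurable_INF) auto
  have g: "g n \<in> B" for n
  proof (rule solid[OF f])
    show "g n \<in> nonneg_meas M"
      by (simp add: nonneg_meas_def) (simp add: g_def[abs_def])
    have "g n x \<le> f n x" for x
      using enn2real_mono[OF e_le, of n x] nonneg[OF f, of n x] by (simp add: g_def)
    then show "AE x in M. g n x \<le> f n x" by simp
  qed
  show ?thesis
  proof (rule fatou[OF g h], use lim in eventually_elim)
    fix x assume x: "(\<lambda>n. f n x) \<longlonglongrightarrow> h x"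
    have "(\<lambda>n. ennreal (f n x)) \<longlonglongrightarrow> ennreal (h x)"
      using x by (rule tendsto_ennrealI)
    then have "liminf (\<lambda>n. ennreal (f n x)) = ennreal (h x)"
      by (rule lim_imp_Liminf[rotated]) simp
    moreover have "(\<lambda>n. e n x) \<longlonglongrightarrow> (SUP n. e n x)"
      by (rule LIMSEQ_SUP) (auto intro!: monoI INF_superset_mono simp: e_def)
    ultimately have "(\<lambda>n. e n x) \<longlonglongrightarrow> ennreal (h x)"
      by (simp add: liminf_SUP_INF e_def)
    then have "(\<lambda>n. g n x) \<longlonglongrightarrow> h x"
      unfolding g_def using nonneg_measD(2)[OF h] by (intro tendsto_enn2real) auto
    then show "incseq (\<lambda>n. g n x) \<and> (\<lambda>n. g n x) \<longlonglongrightarrow> h x"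
      using mono by blast
  qed
qed

text \<open>All multiples of \<open>f\<close> being in the ball, so are all multiples of the
  indicator of each set where \<open>f\<close> exceeds \<open>1 / Suc n\<close>;
  \<open>bounded\<close> makes these sets null.\<close>

lemma AE_zero:
  assumes f: "f \<in> nonneg_meas M" and all: "\<And>c. 0 < c \<Longrightarrow> (\<lambda>x. f x / c) \<in> B"
  shows "AE x in M. f x = 0"
proof -
  note [measurable] = nonneg_measD(1)[OF f]
  have f0: "0 \<le> f x" for x by (rule nonneg_measD(2)[OF f])
  have "AE x in M. f x \<le> 1 / Suc n" for n
  proof -
    define E where "E = {x \<in> space M. 1 / Suc n < f x}"
    have E[measurable]: "E \<in> sets M" unfolding E_def by measurable
    have "emeasure M E = 0"
    proof (rule bounded[OF E])
      fix c :: real assume c: "0 < c"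
      have "(\<lambda>x. f x / (1 / (c * real (Suc n)))) \<in> B" using c by (intro all) auto
      then show "(\<lambda>x. c * indicator E x) \<in> B"
      proof (rule solid)
        have "c \<le> c * (f x * real (Suc n))" if "x \<in> E" for x
          using that c by (simp add: E_def pos_divide_less_eq del: of_nat_Suc)
        then show "AE x in M. c * indicator E x \<le> f x / (1 / (c * real (Suc n)))"
          using c f0 by (intro AE_I2) (auto simp: indicator_def ac_simps)
      qed (use c in \<open>auto simp: nonneg_meas_def\<close>)
    qed
    then have "AE x in M. x \<notin> E" by (intro AE_not_in) (simp add: null_setsI)
    then show ?thesis using AE_space by eventually_elim (auto simp: E_def not_less)
  qed
  then have "AE x in M. \<forall>n. f x \<le> 1 / Suc n" unfolding AE_all_countable by blast
  then show ?thesis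
  proof eventually_elim
    case (elim x)
    have "f x \<le> 0" by (rule LIMSEQ_le_const[OF LIMSEQ_Suc[OF lim_1_over_n]]) (use elim in auto)
    with f0[of x] show ?case by simp
  qed
qed

end

context function_ball
begin

text \<open>Repeated midpoints: the first term is averaged with the series of the shifted sequence,
  and the leftover mass sits on the zero function.\<close>

lemma partial_series:
  assumes f: "\<And>n. f n \<in> B"
  shows "(\<lambda>x. \<Sum>k<n. f k x / 2 ^ Suc k) \<in> B"
  using f
proof (induction n arbitrary: f)
  case 0
  then show ?case by (simp add: zero)
next
  case (Suc n)
  have "(\<lambda>x. (1/2) * f 0 x + (1 - 1/2) * (\<Sum>k<n. f (Suc k) x / 2 ^ Suc k)) \<in> B"
    using Suc.IH[of "\<lambda>k. f (Suc k)"] Suc.prems by (intro convex) auto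
  moreover have "(1/2) * f 0 x + (1 - 1/2) * (\<Sum>k<n. f (Suc k) x / 2 ^ Suc k)
      = (\<Sum>k<Suc n. f k x / 2 ^ Suc k)" for x
    by (subst sum.lessThan_Suc_shift) (simp add: sum_divide_distrib)
  ultimately show ?case by simp
qed

text \<open>Countable convexity. If the sum were infinite on a set \<open>E\<close> of positive
  measure, the partial sums cut off by \<open>c * indicator E\<close> would increase to that
  function for every \<open>c\<close>, against \<open>bounded\<close>.\<close>

lemma series:
  assumes f: "\<And>n. f n \<in> B"
  defines "S \<equiv> \<lambda>x. \<Sum>n. ennreal (f n x / 2 ^ Suc n)"
  shows "AE x in M. S x < \<infinity>" and "(\<lambda>x. enn2real (S x)) \<in> B"
proof -
  note [measurable] = measurable[OF f]
  define P where "P n x = (\<Sum>k<n. f k x / 2 ^ Suc k)" for n x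
  have P: "P n \<in> B" for n
    unfolding P_def[abs_def] by (rule partial_series[OF f])
  have P_nn: "0 \<le> P n x" for n x
    by (rule nonneg[OF P])
  have P_mono: "incseq (\<lambda>n. P n x)" for x
    by (rule incseq_SucI) (simp add: P_def nonneg[OF f])
  have P_S: "(\<lambda>n. ennreal (P n x)) \<longlonglongrightarrow> S x" for x
  proof -
    have "ennreal (P n x) = (\<Sum>k<n. ennreal (f k x / 2 ^ Suc k))" for n
      unfolding P_def by (rule sum_ennreal[symmetric]) (simp add: nonneg[OF f])
    moreover have "(\<lambda>n. \<Sum>k<n. ennreal (f k x / 2 ^ Suc k)) \<longlonglongrightarrow> S x"
      unfolding S_def by (rule summable_LIMSEQ) simp
    ultimately show ?thesis by simp
  qed
  have [measurable]: "S \<in> borel_measurable M"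
    unfolding S_def by measurable
  define E where "E = {x \<in> space M. S x = \<infinity>}"
  have E[measurable]: "E \<in> sets M" unfolding E_def by measurable
  have "emeasure M E = 0"
  proof (rule bounded[OF E])
    fix c :: real assume c: "0 < c"
    show "(\<lambda>x. c * indicator E x) \<in> B"
    proof (rule fatou[where g="\<lambda>n x. min (P n x) (c * indicator E x)"])
      note [measurable] = measurable[OF P]
      show "(\<lambda>x. min (P n x) (c * indicator E x)) \<in> B" for n
        using c by (intro solid[OF P[of n]]) (auto simp: nonneg_meas_def P_nn)
      show "(\<lambda>x. c * indicator E x) \<in> nonneg_meas M"
        using c by (auto simp: nonneg_meas_def)
      show "AE x in M. incseq (\<lambda>n. min (P n x) (c * indicator E x)) \<and>
          (\<lambda>n. min (P n x) (c * indicator E x)) \<longlonglongrightarrow> c * indicator E x"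
      proof (intro AE_I2 conjI)
        fix x
        show "incseq (\<lambda>n. min (P n x) (c * indicator E x))"
          using P_mono[of x] by (auto simp: incseq_def intro: min.coboundedI1)
        show "(\<lambda>n. min (P n x) (c * indicator E x)) \<longlonglongrightarrow> c * indicator E x"
        proof (cases "x \<in> E")
          case True
          then have "S x = top" by (simp add: E_def)
          with P_S[of x] have "(\<lambda>n. ennreal (P n x)) \<longlonglongrightarrow> top" by simp
          then have "eventually (\<lambda>n. ennreal c < ennreal (P n x)) sequentially"
            by (rule order_tendstoD) simp
          then have "eventually (\<lambda>n. min (P n x) (c * indicator E x) = c * indicator E x) sequentially"
            using True c by (auto elim!: eventually_mono simp: ennreal_less_iff)
          then show ?thesis by (rule tendsto_eventually)
        next
          case False
          then have "min (P n x) (c * indicator E x) = 0" for n using P_nn[of n x] by simp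
          then show ?thesis using False by simp
        qed
      qed
    qed
  qed
  then have "AE x in M. x \<notin> E"
    by (intro AE_not_in) (simp add: null_setsI)
  then show fin: "AE x in M. S x < \<infinity>"
    by (rule AE_mp) (auto simp: E_def less_top)
  show "(\<lambda>x. enn2real (S x)) \<in> B"
  proof (rule fatou[OF P])
    show "(\<lambda>x. enn2real (S x)) \<in> nonneg_meas M"
      by (auto simp: nonneg_meas_def)
    show "AE x in M. incseq (\<lambda>n. P n x) \<and> (\<lambda>n. P n x) \<longlonglongrightarrow> enn2real (S x)"
      using fin
    proof eventually_elim
      case (elim x)
      then have "(\<lambda>n. enn2real (ennreal (P n x))) \<longlonglongrightarrow> enn2real (S x)"
        by (intro tendsto_enn2real) (use P_S[of x] in auto)
      then show ?case using P_mono P_nn by simp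
    qed
  qed
qed

end

section \<open>Separation of a function from a ball, and the bipolar theorem\<close>

lemma (in finite_measure) AE_summable_of_square_decay:
  assumes [measurable]: "\<And>n. g n \<in> borel_measurable M"
    and bound: "\<And>n. (\<integral>\<^sup>+x. ennreal ((g n x)\<^sup>2) \<partial>M) \<le> ennreal (C * (1/8) ^ n)" and "0 \<le> C"
  shows "AE x in M. summable (\<lambda>n. \<bar>g n x\<bar> :: real)"
proof -
  define m where "m = measure M (space M)"
  \<comment> \<open>This lets a square estimate control a sum of absolute values: against the decay
    \<open>(1/8) ^ n\<close> the second term contributes only \<open>C * (1/4) ^ n\<close>.\<close>
  have "\<bar>t\<bar> \<le> (1/2)^n + 2^n * t\<^sup>2" for t :: real and n :: nat
  proof (cases "\<bar>t\<bar> \<le> (1/2)^n")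
    case False
    have "1 = 2^n * (1/2::real)^n" by (simp add: power_one_over)
    also have "\<dots> \<le> 2^n * \<bar>t\<bar>" using False by (intro mult_left_mono) auto
    finally have "1 * \<bar>t\<bar> \<le> 2^n * \<bar>t\<bar> * \<bar>t\<bar>" by (intro mult_right_mono) auto
    then show ?thesis by (simp add: power2_eq_square mult.assoc add_increasing)
  qed (simp add: add_increasing2)
  then have "(\<integral>\<^sup>+x. ennreal \<bar>g n x\<bar> \<partial>M) \<le> (\<integral>\<^sup>+x. ennreal ((1/2)^n) + ennreal (2^n) * ennreal ((g n x)\<^sup>2) \<partial>M)" for n
    by (intro nn_integral_mono) (simp flip: ennreal_plus ennreal_mult)
  also have "\<And>n. \<dots> n = ennreal ((1/2)^n) * ennreal m + ennreal (2^n) * (\<integral>\<^sup>+x. ennreal ((g n x)\<^sup>2) \<partial>M)"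
    by (simp add: nn_integral_add nn_integral_cmult m_def emeasure_eq_measure)
  also have "\<And>n. \<dots> n \<le> ennreal ((1/2)^n) * ennreal m + ennreal (2^n) * ennreal (C * (1/8) ^ n)"
    by (intro add_left_mono mult_left_mono bound) simp
  also have "\<And>n. \<dots> n = ennreal ((1/2)^n * m + C * (1/4)^n)"
    using \<open>0 \<le> C\<close> by (simp add: m_def power_divide field_simps flip: ennreal_plus ennreal_mult power_mult_distrib)
  finally have le: "(\<integral>\<^sup>+x. ennreal \<bar>g n x\<bar> \<partial>M) \<le> ennreal ((1/2)^n * m + C * (1/4)^n)" for n .
  have "(\<integral>\<^sup>+x. (\<Sum>n. ennreal \<bar>g n x\<bar>) \<partial>M) = (\<Sum>n. \<integral>\<^sup>+x. ennreal \<bar>g n x\<bar> \<partial>M)"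
    by (rule nn_integral_suminf) simp
  also have "\<dots> \<le> (\<Sum>n. ennreal ((1/2)^n * m + C * (1/4)^n))"
    by (intro suminf_le le) auto
  also have "\<dots> = ennreal (\<Sum>n. (1/2)^n * m + C * (1/4)^n)"
    using \<open>0 \<le> C\<close> by (intro suminf_ennreal2 summable_add summable_mult summable_mult2 summable_geometric)
      (auto simp: m_def)
  also have "\<dots> < \<infinity>" by simp
  finally have "AE x in M. (\<Sum>n. ennreal \<bar>g n x\<bar>) \<noteq> \<infinity>"
    by (intro nn_integral_noteq_infinite) auto
  then show ?thesis
    by eventually_elim (rule summable_suminf_not_top, auto)
qed


lemma nn_integral_AE_limit_le:
  assumes [measurable]: "\<And>n. f n \<in> borel_measurable M" "g \<in> borel_measurable M"
    and lim: "AE x in M. (\<lambda>n. f n x) \<longlonglongrightarrow> g x"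
    and le: "\<And>n. (\<integral>\<^sup>+x. f n x \<partial>M) \<le> (C::ennreal)"
  shows "(\<integral>\<^sup>+x. g x \<partial>M) \<le> C"
proof -
  have "(\<integral>\<^sup>+x. g x \<partial>M) = (\<integral>\<^sup>+x. liminf (\<lambda>n. f n x) \<partial>M)"
    using lim by (intro nn_integral_cong_AE) (auto simp: lim_imp_Liminf)
  also have "\<dots> \<le> liminf (\<lambda>n. \<integral>\<^sup>+x. f n x \<partial>M)"
    by (rule nn_integral_liminf) simp
  also have "\<dots> \<le> C"
    using le by (intro Liminf_le) auto
  finally show ?thesis .
qed

text \<open>The lower limit supplies a representative that is measurable, finite and nonnegative
  everywhere, also off the set of convergence.\<close>

lemma nonneg_meas_limit:
  assumes g: "\<And>n. g n \<in> nonneg_meas M" and conv: "AE x in M. convergent (\<lambda>n. g n x)"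
  obtains h where "h \<in> nonneg_meas M" "AE x in M. (\<lambda>n. g n x) \<longlonglongrightarrow> h x"
proof -
  note [measurable] = nonneg_measD(1)[OF g]
  define h where "h x = enn2real (liminf (\<lambda>n. ennreal (g n x)))" for x
  have "h \<in> nonneg_meas M"
    unfolding nonneg_meas_def h_def[abs_def] by simp
  moreover have "AE x in M. (\<lambda>n. g n x) \<longlonglongrightarrow> h x"
    using conv
  proof eventually_elim
    case (elim x)
    then obtain l where l: "(\<lambda>n. g n x) \<longlonglongrightarrow> l" by (auto simp: convergent_def)
    then have "0 \<le> l" using nonneg_measD(2)[OF g] by (intro LIMSEQ_le_const[OF l]) auto
    have "liminf (\<lambda>n. ennreal (g n x)) = ennreal l"
      by (intro lim_imp_Liminf tendsto_ennrealI l) simp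
    with \<open>0 \<le> l\<close> l show ?case by (simp add: h_def)
  qed
  ultimately show ?thesis ..
qed

lemma tendsto_min_real: "(\<lambda>n. min x (real n)) \<longlonglongrightarrow> x"
proof (rule tendsto_eventually)
  obtain k :: nat where "x \<le> real k" using real_arch_simple by blast
  then show "eventually (\<lambda>n. min x (real n) = x) sequentially"
    by (intro eventually_sequentiallyI[of k]) auto
qed

lemma convergent_of_summable_diff:
  fixes a :: "nat \<Rightarrow> real"
  assumes "summable (\<lambda>n. \<bar>a n - a (Suc n)\<bar>)"
  shows "convergent a"
proof -
  have "(\<lambda>n. \<Sum>k<n. a k - a (Suc k)) \<longlonglongrightarrow> (\<Sum>k. a k - a (Suc k))"
    using summable_rabs_cancel[OF assms] by (rule summable_LIMSEQ)
  then have "(\<lambda>n. a 0 - a n) \<longlonglongrightarrow> (\<Sum>k. a k - a (Suc k))"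
    by (simp add: sum_lessThan_telescope')
  then have "(\<lambda>n. a 0 - (a 0 - a n)) \<longlonglongrightarrow> a 0 - (\<Sum>k. a k - a (Suc k))"
    by (intro tendsto_diff tendsto_const)
  then show ?thesis by (auto simp: convergent_def)
qed

text \<open>Bounded functions are integrable for the density of a positive integrable function, and
  almost everywhere means the same for both measures. The extremal problems below are set in this
  finite measure.\<close>

lemma (in sigma_finite_measure) equivalent_finite_measure:
  obtains h where "h \<in> borel_measurable M" "\<And>x. 0 < (h x :: real)"
    "finite_measure (density M (\<lambda>x. ennreal (h x)))"
    "\<And>P. (AE x in density M (\<lambda>x. ennreal (h x)). P x) \<longleftrightarrow> (AE x in M. P x)"
proof -
  obtain h where h[measurable]: "h \<in> borel_measurable M" and pos: "\<And>x. 0 < (h x :: real)"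
    and int: "integrable M h"
    using obtain_positive_integrable_function by metis
  have "finite_measure (density M (\<lambda>x. ennreal (h x)))"
  proof
    have "emeasure (density M (\<lambda>x. ennreal (h x))) (space M) = (\<integral>\<^sup>+x. ennreal (h x) \<partial>M)"
      by (simp add: emeasure_density cong: nn_integral_cong)
    also have "\<dots> < \<infinity>"
      using int pos by (simp add: nn_integral_eq_integral less_imp_le)
    finally show "emeasure (density M (\<lambda>x. ennreal (h x))) (space (density M (\<lambda>x. ennreal (h x)))) \<noteq> \<infinity>"
      by simp
  qed
  then show ?thesis
    by (rule that[OF h pos]) (simp add: AE_density pos)
qed

text \<open>The separating function is \<open>w - b\<close>, where \<open>b\<close> is the element of the ball nearest to \<open>w\<close>
  in $L^2$ of an equivalent finite measure.\<close>

lemma (in function_ball) separate_bounded: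
  assumes "sigma_finite_measure M" and w: "w \<in> nonneg_meas M" "\<And>x. w x \<le> c" and "w \<notin> B"
  obtains z where "z \<in> polar M B" "1 < (\<integral>\<^sup>+x. ennreal (w x * z x) \<partial>M)"
proof -
  interpret sigma_finite_measure M by fact
  obtain h where h[measurable]: "h \<in> borel_measurable M" and hpos: "\<And>x. 0 < (h x :: real)"
    and fin: "finite_measure (density M (\<lambda>x. ennreal (h x)))"
    and AE: "\<And>P. (AE x in density M (\<lambda>x. ennreal (h x)). P x) \<longleftrightarrow> (AE x in M. P x)"
    using equivalent_finite_measure by metis
  define N where "N = density M (\<lambda>x. ennreal (h x))"
  interpret N: finite_measure N unfolding N_def by (rule fin)
  have [measurable_cong]: "sets N = sets M" by (simp add: N_def)
  have AEN: "(AE x in N. P x) \<longleftrightarrow> (AE x in M. P x)" for P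
    unfolding N_def by (rule AE)
  have [measurable]: "w \<in> borel_measurable M" by (rule nonneg_measD[OF w(1)])
  have w0: "0 \<le> w x" for x by (rule nonneg_measD[OF w(1)])
  have c0: "0 \<le> c" using w0[of undefined] w(2)[of undefined] by simp
  have int: "integrable N f" if [measurable]: "f \<in> borel_measurable M" and "\<And>x. \<bar>f x\<bar> \<le> k" for f :: "'a \<Rightarrow> real" and k
    using that(2) by (intro N.integrable_const_bound[where B=k]) auto
  define \<Psi> where "\<Psi> b = (\<integral>x. (w x - b x)\<^sup>2 \<partial>N)" for b
  \<comment> \<open>Cutting an element of \<open>B\<close> down to \<open>w\<close> keeps it in
    \<open>B\<close> and does not increase its distance to \<open>w\<close>, so the minimization may
    be restricted to functions between 0 and \<open>w\<close>, all bounded by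
    \<open>c\<close>.\<close>
  define S where "S = {b \<in> B. \<forall>x. b x \<le> w x}"
  have S_meas: "b \<in> borel_measurable M" if "b \<in> S" for b using that measurable by (auto simp: S_def)
  have S_bd: "0 \<le> b x" "b x \<le> w x" "b x \<le> c" if "b \<in> S" for b x
    using that nonneg w(2)[of x] by (auto simp: S_def intro: order_trans)
  have \<Psi>_nn: "0 \<le> \<Psi> b" for b unfolding \<Psi>_def by simp
  have sq_bd: "\<bar>u * v\<bar> \<le> k * k" if "\<bar>u\<bar> \<le> k" "\<bar>v\<bar> \<le> k" for u v k :: real
    unfolding abs_mult using that by (intro mult_mono) auto
  have int_sq: "integrable N (\<lambda>x. (f x)\<^sup>2)" if [measurable]: "f \<in> borel_measurable M" and "\<And>x. \<bar>f x\<bar> \<le> k" for f :: "'a \<Rightarrow> real" and k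
    unfolding power2_eq_square by (intro int[where k="k*k"] sq_bd that(2)) measurable
  have intS: "integrable N (\<lambda>x. (w x - b x)\<^sup>2)" if "b \<in> S" for b
  proof (rule int_sq)
    show "(\<lambda>x. w x - b x) \<in> borel_measurable M" using S_meas[OF that] by simp
    show "\<bar>w x - b x\<bar> \<le> c" for x using S_bd[OF that, of x] w(2)[of x] by auto
  qed
  define d where "d = (INF b\<in>S. \<Psi> b)"
  have bdd: "bdd_below (\<Psi> ` S)" by (rule bdd_belowI2[where m=0]) (rule \<Psi>_nn)
  have d_le: "d \<le> \<Psi> b" if "b \<in> S" for b
    unfolding d_def by (rule cINF_lower[OF bdd that])
  have S0: "(\<lambda>x. 0) \<in> S" using zero w0 by (simp add: S_def)
  \<comment> \<open>The rate \<open>(1/8) ^ n\<close> is the one required by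
    \<open>N.AE_summable_of_square_decay\<close>.\<close>
  have "\<exists>b\<in>S. \<Psi> b < d + (1/8)^n" for n :: nat
    using cINF_less_iff[OF _ bdd, of "d + (1/8)^n"] S0 unfolding d_def by auto
  then obtain b where bS: "\<And>n. b n \<in> S" and b_lt: "\<And>n. \<Psi> (b n) < d + (1/8)^n" for n :: nat
    by metis
  note [measurable] = S_meas[OF bS]
  have mid: "(\<lambda>x. (1/2) * b n x + (1 - 1/2) * b m x) \<in> S" for n m
    using bS convex[of "b n" "b m" "1/2"] S_bd[OF bS]
    by (auto simp: S_def field_simps) (smt (verit))
  have "(\<integral>x. (b n x - b (Suc n) x)\<^sup>2 \<partial>N) \<le> 4 * (1/8)^n" for n
  proof -
    \<comment> \<open>Parallelogram law; the midpoint lies in \<open>S\<close>, so its squared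
      distance is at least \<open>d\<close>.\<close>
    have "(b n x - b (Suc n) x)\<^sup>2 = 2 * (w x - b n x)\<^sup>2 + 2 * (w x - b (Suc n) x)\<^sup>2
        - 4 * (w x - ((1/2) * b n x + (1 - 1/2) * b (Suc n) x))\<^sup>2" for x
      by (simp add: power2_eq_square field_simps)
    then have "(\<integral>x. (b n x - b (Suc n) x)\<^sup>2 \<partial>N)
        = 2 * \<Psi> (b n) + 2 * \<Psi> (b (Suc n)) - 4 * \<Psi> (\<lambda>x. (1/2) * b n x + (1 - 1/2) * b (Suc n) x)"
      unfolding \<Psi>_def using intS[OF bS[of n]] intS[OF bS[of "Suc n"]] intS[OF mid[of n "Suc n"]]
      by simp
    also have "\<dots> \<le> 4 * (1/8)^n"
    proof -
      have "(1/8::real) ^ Suc n \<le> (1/8) ^ n" by simp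
      with b_lt[of n] b_lt[of "Suc n"] d_le[OF mid[of n "Suc n"]] show ?thesis by linarith
    qed
    finally show ?thesis .
  qed
  moreover have "integrable N (\<lambda>x. (b n x - b (Suc n) x)\<^sup>2)" for n
  proof (rule int_sq)
    show "\<bar>b n x - b (Suc n) x\<bar> \<le> c" for x using S_bd[OF bS, of n x] S_bd[OF bS, of "Suc n" x] by auto
  qed measurable
  ultimately have "AE x in N. summable (\<lambda>n. \<bar>b n x - b (Suc n) x\<bar>)"
    by (intro N.AE_summable_of_square_decay[where C=4]) (auto simp: nn_integral_eq_integral)
  then have "AE x in M. convergent (\<lambda>n. b n x)"
    unfolding AEN by eventually_elim (rule convergent_of_summable_diff)
  moreover have bn: "b n \<in> nonneg_meas M" for n using bS nonneg_meas by (auto simp: S_def)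
  ultimately obtain b\<^sub>0 where b0: "b\<^sub>0 \<in> nonneg_meas M" "AE x in M. (\<lambda>n. b n x) \<longlonglongrightarrow> b\<^sub>0 x"
    using nonneg_meas_limit[of b M] by blast
  \<comment> \<open>The limit is below \<open>w\<close> only almost everywhere; the minimum makes
    this hold everywhere, as membership in \<open>S\<close> demands.\<close>
  define a where "a x = min (b\<^sub>0 x) (w x)" for x
  have [measurable]: "b\<^sub>0 \<in> borel_measurable M" by (rule nonneg_measD[OF b0(1)])
  have [measurable]: "a \<in> borel_measurable M" unfolding a_def[abs_def] by measurable
  have lim: "AE x in M. (\<lambda>n. b n x) \<longlonglongrightarrow> a x"
    using b0(2)
  proof eventually_elim
    case (elim x)
    then have "b\<^sub>0 x \<le> w x" using S_bd(2)[OF bS] by (intro LIMSEQ_le_const2[OF elim]) auto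
    with elim show ?case by (simp add: a_def)
  qed
  have a_bd: "0 \<le> a x" "a x \<le> w x" "a x \<le> c" for x
    using nonneg_measD(2)[OF b0(1), of x] w0[of x] w(2)[of x] by (auto simp: a_def)
  have aB: "a \<in> B"
    by (rule AE_limit[OF _ _ lim]) (use bS a_bd in \<open>auto simp: S_def nonneg_meas_def\<close>)
  have "(\<lambda>n. \<Psi> (b n)) \<longlonglongrightarrow> \<Psi> a"
    unfolding \<Psi>_def
  proof (rule integral_dominated_convergence[where w="\<lambda>x. c * c"])
    show "AE x in N. (\<lambda>n. (w x - b n x)\<^sup>2) \<longlonglongrightarrow> (w x - a x)\<^sup>2"
      unfolding AEN using lim by eventually_elim (intro tendsto_intros)
    show "AE x in N. norm ((w x - b n x)\<^sup>2) \<le> c * c" for n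
    proof (rule AE_I2)
      fix x
      have "\<bar>w x - b n x\<bar> \<le> c" using S_bd[OF bS, of n x] w(2)[of x] by auto
      then show "norm ((w x - b n x)\<^sup>2) \<le> c * c"
        unfolding power2_eq_square real_norm_def by (intro sq_bd)
    qed
  qed auto
  then have "\<Psi> a \<le> d + 0"
    by (rule LIMSEQ_le[OF _ tendsto_add[OF tendsto_const LIMSEQ_power_zero]])
       (use b_lt in \<open>auto intro!: exI[of _ 0] less_imp_le\<close>)
  moreover have aS: "a \<in> S" using aB a_bd by (simp add: S_def)
  ultimately have \<Psi>a: "\<Psi> a = d" using d_le[OF aS] by simp
  have dpos: "0 < d"
  proof (rule ccontr)
    assume "\<not> 0 < d"
    then have "\<Psi> a = 0" using \<Psi>_nn[of a] \<Psi>a by simp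
    then have "AE x in N. (w x - a x)\<^sup>2 = 0"
      unfolding \<Psi>_def using intS[OF aS] by (subst (asm) integral_nonneg_eq_0_iff_AE) auto
    then have "AE x in M. w x = a x" unfolding AEN by simp
    with cong[OF aB w(1)] \<open>w \<notin> B\<close> show False by simp
  qed
  define z where "z x = w x - a x" for x
  have [measurable]: "z \<in> borel_measurable M" unfolding z_def[abs_def] by measurable
  have z_bd: "0 \<le> z x" "z x \<le> c" for x using a_bd[of x] w0[of x] w(2)[of x] by (auto simp: z_def)
  define \<kappa> where "\<kappa> = (\<integral>x. z x * a x \<partial>N)"
  have \<kappa>0: "0 \<le> \<kappa>" unfolding \<kappa>_def using z_bd a_bd by (intro Bochner_Integration.integral_nonneg) simp
  have int_za: "integrable N (\<lambda>x. z x * a x)"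
    using z_bd a_bd c0 by (intro int[where k="c*c"] sq_bd) auto
  have int_z2: "integrable N (\<lambda>x. (z x)\<^sup>2)" using intS[OF aS] by (simp add: z_def)
  \<comment> \<open>First variation at the minimizer: moving from \<open>a\<close> towards
    \<open>b'\<close> by \<open>\<tau>\<close> cannot decrease the distance, up to a term of order
    \<open>\<tau>\<^sup>2\<close>. The moved function may leave \<open>S\<close> and is cut down to
    \<open>w\<close>, which only helps.\<close>
  have var: "(\<integral>x. z x * b' x \<partial>N) \<le> \<kappa>" if b': "b' \<in> B" "\<And>x. b' x \<le> k" for b' and k :: real
  proof -
    note [measurable] = measurable[OF b'(1)]
    have b'0: "0 \<le> b' x" for x by (rule nonneg[OF b'(1)])
    have k0: "0 \<le> k" using b'0[of undefined] b'(2)[of undefined] by simp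
    have int_zb: "integrable N (\<lambda>x. z x * b' x)"
      using z_bd b'0 b'(2) k0 c0 by (intro int[where k="c*k"]) (auto simp: abs_mult intro!: mult_mono)
    have int_D: "integrable N (\<lambda>x. (b' x - a x)\<^sup>2)"
    proof (rule int_sq)
      show "\<bar>b' x - a x\<bar> \<le> c + k" for x
        using b'0[of x] b'(2)[of x] a_bd[of x] k0 c0 by auto
    qed measurable
    define D where "D = (\<integral>x. (b' x - a x)\<^sup>2 \<partial>N)"
    have le: "2 * ((\<integral>x. z x * b' x \<partial>N) - \<kappa>) \<le> \<tau> * D" if \<tau>: "0 < \<tau>" "\<tau> \<le> 1" for \<tau>
    proof -
      define e where "e x = \<tau> * b' x + (1 - \<tau>) * a x" for x
      have eB: "e \<in> B" unfolding e_def[abs_def] using \<tau> by (intro convex b' aB) auto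
      note [measurable] = measurable[OF eB]
      have e0: "0 \<le> e x" for x by (rule nonneg[OF eB])
      have m: "(\<lambda>x. min (e x) (w x)) \<in> S"
        unfolding S_def using e0 w0 by (auto intro!: solid[OF eB] simp: nonneg_meas_def)
      have eq: "(w x - e x)\<^sup>2 = (z x)\<^sup>2 - 2 * \<tau> * (z x * b' x) + 2 * \<tau> * (z x * a x) + \<tau>\<^sup>2 * (b' x - a x)\<^sup>2" for x
        by (simp add: e_def z_def power2_eq_square algebra_simps)
      have "d \<le> \<Psi> (\<lambda>x. min (e x) (w x))" by (rule d_le[OF m])
      also have "\<dots> \<le> (\<integral>x. (w x - e x)\<^sup>2 \<partial>N)"
        unfolding \<Psi>_def
      proof (rule integral_mono)
        show "integrable N (\<lambda>x. (w x - e x)\<^sup>2)"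
          unfolding eq using int_z2 int_zb int_za int_D by simp
        show "(w x - min (e x) (w x))\<^sup>2 \<le> (w x - e x)\<^sup>2" for x
          by (auto simp: min_def)
      qed (rule intS[OF m])
      also have "\<dots> = d - 2 * \<tau> * (\<integral>x. z x * b' x \<partial>N) + 2 * \<tau> * \<kappa> + \<tau>\<^sup>2 * D"
        unfolding eq using int_z2 int_zb int_za int_D \<Psi>a
        by (simp add: \<kappa>_def D_def \<Psi>_def z_def)
      finally have "\<tau> * (2 * ((\<integral>x. z x * b' x \<partial>N) - \<kappa>)) \<le> \<tau> * (\<tau> * D)"
        by (simp add: power2_eq_square algebra_simps)
      then show ?thesis using \<tau> by simp
    qed
    have "((\<lambda>\<tau>. \<tau> * D) \<longlongrightarrow> 0 * D) (at_right 0)"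
      by (intro tendsto_intros)
    moreover have "eventually (\<lambda>\<tau>. 2 * ((\<integral>x. z x * b' x \<partial>N) - \<kappa>) \<le> \<tau> * D) (at_right 0)"
      unfolding eventually_at_right_field by (intro exI[of _ 1]) (use le in auto)
    ultimately have "2 * ((\<integral>x. z x * b' x \<partial>N) - \<kappa>) \<le> 0 * D"
      by (rule tendsto_lowerbound) simp
    then show ?thesis by simp
  qed
  \<comment> \<open>For \<open>N\<close>, the pairing with \<open>z\<close> is at most
    \<open>\<kappa>\<close> on the ball and equals \<open>\<kappa> + d\<close> at \<open>w\<close>;
    the normalizer lies strictly between. The factor \<open>h\<close> turns integrals for
    \<open>N\<close> into integrals for \<open>M\<close>.\<close>
  define q where "q x = z x * h x / (\<kappa> + d / 2)" for x
  have [measurable]: "q \<in> borel_measurable M" unfolding q_def[abs_def] by measurable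
  have q0: "0 \<le> q x" for x using z_bd hpos[of x] \<kappa>0 dpos by (simp add: q_def)
  have to_N: "(\<integral>\<^sup>+x. ennreal (f x * q x) \<partial>M) = ennreal (1 / (\<kappa> + d / 2)) * (\<integral>\<^sup>+x. ennreal (z x * f x) \<partial>N)"
    if [measurable]: "f \<in> borel_measurable M" and f0: "\<And>x. 0 \<le> f x" for f
  proof -
    have "(\<integral>\<^sup>+x. ennreal (f x * q x) \<partial>M) = (\<integral>\<^sup>+x. ennreal (1 / (\<kappa> + d / 2)) * (ennreal (h x) * ennreal (z x * f x)) \<partial>M)"
      using \<kappa>0 dpos z_bd f0 hpos
      by (intro nn_integral_cong) (simp add: q_def less_imp_le field_simps flip: ennreal_mult)
    then show ?thesis
      by (simp add: nn_integral_cmult N_def nn_integral_density)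
  qed
  have "(\<integral>\<^sup>+x. ennreal (f x * q x) \<partial>M) \<le> 1" if f: "f \<in> B" for f
  proof -
    note [measurable] = measurable[OF f]
    have "(\<integral>\<^sup>+x. ennreal (z x * f x) \<partial>N) \<le> ennreal \<kappa>"
    proof (rule nn_integral_AE_limit_le[where f="\<lambda>n x. ennreal (z x * min (f x) (real n))"])
      show "AE x in N. (\<lambda>n. ennreal (z x * min (f x) (real n))) \<longlonglongrightarrow> ennreal (z x * f x)"
        by (intro AE_I2 tendsto_ennrealI tendsto_mult tendsto_const tendsto_min_real)
      fix n
      have mB: "(\<lambda>x. min (f x) (real n)) \<in> B"
        using nonneg[OF f] by (intro solid[OF f]) (auto simp: nonneg_meas_def)
      have "integrable N (\<lambda>x. z x * min (f x) (real n))"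
        using z_bd nonneg[OF f] c0 by (intro int[where k="c*real n"]) (auto simp: abs_mult intro!: mult_mono)
      then show "(\<integral>\<^sup>+x. ennreal (z x * min (f x) (real n)) \<partial>N) \<le> ennreal \<kappa>"
        using var[OF mB, of "real n"] z_bd nonneg[OF f]
        by (subst nn_integral_eq_integral) (auto intro!: ennreal_leI)
    qed measurable
    then have "(\<integral>\<^sup>+x. ennreal (f x * q x) \<partial>M) \<le> ennreal (1 / (\<kappa> + d / 2)) * ennreal \<kappa>"
      using nonneg[OF f] by (subst to_N) (auto intro: mult_left_mono)
    also have "\<dots> \<le> 1"
      using \<kappa>0 dpos by (simp flip: ennreal_mult ennreal_1)
    finally show ?thesis .
  qed
  then have "q \<in> polar M B"
    using q0 by (auto simp: polar_def nonneg_meas_def)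
  moreover have "1 < (\<integral>\<^sup>+x. ennreal (w x * q x) \<partial>M)"
  proof -
    have eq: "z x * w x = z x * a x + (z x)\<^sup>2" for x by (simp add: z_def power2_eq_square algebra_simps)
    have "(\<integral>x. z x * w x \<partial>N) = \<kappa> + d"
      unfolding eq using int_za int_z2 \<Psi>a by (simp add: \<kappa>_def \<Psi>_def z_def)
    moreover have "integrable N (\<lambda>x. z x * w x)" unfolding eq using int_za int_z2 by simp
    ultimately have "(\<integral>\<^sup>+x. ennreal (z x * w x) \<partial>N) = ennreal (\<kappa> + d)"
      using z_bd w0 by (subst nn_integral_eq_integral) auto
    then have "(\<integral>\<^sup>+x. ennreal (w x * q x) \<partial>M) = ennreal ((\<kappa> + d) / (\<kappa> + d / 2))"
      using w0 \<kappa>0 dpos by (simp add: to_N flip: ennreal_mult ennreal_plus)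
    also have "\<dots> > 1"
      using \<kappa>0 dpos by simp
    finally show ?thesis .
  qed
  ultimately show ?thesis by (rule that)
qed

text \<open>The Lorentz--Luxemburg theorem.\<close>

lemma (in function_ball) bipolar:
  assumes "sigma_finite_measure M" and f: "f \<in> nonneg_meas M"
    and le: "\<And>z. z \<in> polar M B \<Longrightarrow> (\<integral>\<^sup>+x. ennreal (f x * z x) \<partial>M) \<le> 1"
  shows "f \<in> B"
proof (rule AE_limit[OF _ f])
  have [measurable]: "f \<in> borel_measurable M" and f0: "\<And>x. 0 \<le> f x"
    using f by (auto simp: nonneg_meas_def)
  \<comment> \<open>Separation is available for bounded functions only, so it is applied to
    truncations, which converge to \<open>f\<close>.\<close>
  show "(\<lambda>x. min (f x) (real n)) \<in> B" for n
  proof (rule ccontr)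
    assume "(\<lambda>x. min (f x) (real n)) \<notin> B"
    moreover have "(\<lambda>x. min (f x) (real n)) \<in> nonneg_meas M" using f0 by (auto simp: nonneg_meas_def)
    ultimately obtain z where z: "z \<in> polar M B" "1 < (\<integral>\<^sup>+x. ennreal (min (f x) (real n) * z x) \<partial>M)"
      using separate_bounded[OF assms(1), of "\<lambda>x. min (f x) (real n)" "real n"] by auto
    have "(\<integral>\<^sup>+x. ennreal (min (f x) (real n) * z x) \<partial>M) \<le> (\<integral>\<^sup>+x. ennreal (f x * z x) \<partial>M)"
      using z(1) by (intro nn_integral_mono ennreal_leI mult_right_mono) (auto simp: polar_def nonneg_meas_def)
    with le[OF z(1)] z(2) show False by simp
  qed
  show "AE x in M. (\<lambda>n. min (f x) (real n)) \<longlonglongrightarrow> f x"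
    by (intro AE_I2 tendsto_min_real)
qed

lemma ennreal_convex_comb:
  "0 \<le> a \<Longrightarrow> a \<le> 1 \<Longrightarrow> 0 \<le> u \<Longrightarrow> 0 \<le> v \<Longrightarrow>
    ennreal (a * u + (1 - a) * v) = ennreal a * ennreal u + ennreal (1 - a) * ennreal v"
  by (simp add: ennreal_mult ennreal_plus)

text \<open>Exhaustion. A series of elements whose supports nearly reach the supremum
  \<open>s\<close> of the finite measures has a support of measure \<open>s\<close>. An element of
  \<open>B\<close> that does not vanish off that support, averaged in, would exceed
  \<open>s\<close>.\<close>

lemma (in function_ball) strictly_positive:
  assumes "sigma_finite_measure M"
    and ex: "\<And>E. E \<in> sets M \<Longrightarrow> 0 < emeasure M E \<Longrightarrow> \<exists>f\<in>B. \<not> (AE x in M. x \<in> E \<longrightarrow> f x = 0)"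
  obtains f where "f \<in> B" "AE x in M. 0 < f x"
proof -
  interpret sigma_finite_measure M by fact
  obtain h where h[measurable]: "h \<in> borel_measurable M" and hpos: "\<And>x. 0 < (h x :: real)"
    and fin: "finite_measure (density M (\<lambda>x. ennreal (h x)))"
    and AE: "\<And>P. (AE x in density M (\<lambda>x. ennreal (h x)). P x) \<longleftrightarrow> (AE x in M. P x)"
    using equivalent_finite_measure by metis
  define N where "N = density M (\<lambda>x. ennreal (h x))"
  interpret N: finite_measure N unfolding N_def by (rule fin)
  have sN[measurable_cong]: "sets N = sets M" by (simp add: N_def)
  have spN: "space N = space M" by (simp add: N_def)
  have AEN: "(AE x in N. P x) \<longleftrightarrow> (AE x in M. P x)" for P
    unfolding N_def by (rule AE)
  define supp where "supp f = {x \<in> space M. 0 < f x}" for f :: "'a \<Rightarrow> real"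
  have [measurable]: "supp f \<in> sets M" if "f \<in> B" for f
    unfolding supp_def using measurable[OF that] by measurable
  define s where "s = (SUP f\<in>B. measure N (supp f))"
  have bdd: "bdd_above ((\<lambda>f. measure N (supp f)) ` B)"
    by (rule bdd_aboveI2[where M="measure N (space N)"]) (rule N.bounded_measure)
  have le_s: "measure N (supp f) \<le> s" if "f \<in> B" for f
    unfolding s_def by (rule cSUP_upper[OF that bdd])
  have "\<exists>f\<in>B. s - 1 / Suc n < measure N (supp f)" for n
    using less_cSUP_iff[OF _ bdd, of "s - 1 / Suc n"] zero unfolding s_def by auto
  then obtain f where fB: "\<And>n. f n \<in> B" and f_s: "\<And>n. s - 1 / Suc n < measure N (supp (f n))" for n
    by metis
  define S where "S x = (\<Sum>n. ennreal (f n x / 2 ^ Suc n))" for x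
  define g where "g x = enn2real (S x)" for x
  have S_fin: "AE x in M. S x < \<infinity>" and gB: "g \<in> B"
    using series[of f, OF fB] unfolding S_def g_def[abs_def] by auto
  have "measure N (supp (f n)) \<le> measure N (supp g)" for n
  proof (rule N.finite_measure_mono_AE)
    show "AE x in N. x \<in> supp (f n) \<longrightarrow> x \<in> supp g"
      unfolding AEN using S_fin
    proof eventually_elim
      case (elim x)
      have "0 < g x" if "0 < f n x"
      proof -
        have "0 < ennreal (f n x / 2 ^ Suc n)" using that by simp
        also have "\<dots> \<le> S x"
          unfolding S_def using sum_le_suminf[of "\<lambda>n. ennreal (f n x / 2 ^ Suc n)" "{n}"] by simp
        finally show ?thesis using elim by (simp add: g_def enn2real_positive_iff)
      qed
      then show ?case by (simp add: supp_def)
    qed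
  qed (use gB in \<open>simp add: sN\<close>)
  then have "s - 1 / Suc n < measure N (supp g)" for n
    using f_s[of n] by (rule less_le_trans[rotated])
  moreover have "(\<lambda>n. s - 1 / real (Suc n)) \<longlonglongrightarrow> s - 0"
    by (intro tendsto_intros LIMSEQ_Suc[OF lim_1_over_n])
  ultimately have "s - 0 \<le> measure N (supp g)"
    by (intro LIMSEQ_le_const2) (auto intro: less_imp_le)
  with le_s[OF gB] have s_eq: "measure N (supp g) = s" by simp
  define E where "E = space M - supp g"
  have E[measurable]: "E \<in> sets M" unfolding E_def using gB by measurable
  have "emeasure M E = 0"
  proof (rule ccontr)
    assume "emeasure M E \<noteq> 0"
    then obtain k where kB: "k \<in> B" and k: "\<not> (AE x in M. x \<in> E \<longrightarrow> k x = 0)"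
      using ex[OF E] by (auto simp: zero_less_iff_neq_zero)
    define l where "l x = (1/2) * g x + (1 - 1/2) * k x" for x
    have lB: "l \<in> B" unfolding l_def[abs_def] by (rule convex[OF gB kB]) auto
    have sub: "supp g \<union> (supp k \<inter> E) \<subseteq> supp l"
      using nonneg[OF gB] nonneg[OF kB] by (auto simp: supp_def l_def add_pos_nonneg add_nonneg_pos)
    have "measure N (supp g) + measure N (supp k \<inter> E) = measure N (supp g \<union> (supp k \<inter> E))"
      using gB kB by (intro N.finite_measure_Union[symmetric]) (auto simp: E_def sN)
    also have "\<dots> \<le> measure N (supp l)"
      using lB sub by (intro N.finite_measure_mono) (auto simp: sN)
    also have "\<dots> \<le> s" by (rule le_s[OF lB])
    finally have "measure N (supp k \<inter> E) = 0"
      using s_eq by (simp add: measure_le_0_iff)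
    then have "AE x in N. x \<notin> supp k \<inter> E"
      using kB by (intro AE_not_in null_setsI) (auto simp: sN N.emeasure_eq_measure)
    then have "AE x in M. x \<in> E \<longrightarrow> k x = 0"
      unfolding AEN using AE_space
      by eventually_elim (use nonneg[OF kB] in \<open>auto simp: supp_def order_less_le\<close>)
    with k show False by simp
  qed
  then have "AE x in M. x \<notin> E"
    by (intro AE_not_in) (simp add: null_setsI)
  then have "AE x in M. 0 < g x"
    using AE_space by eventually_elim (auto simp: E_def supp_def)
  with gB show ?thesis by (rule that)
qed

section \<open>Polars as balls\<close>

lemma polarD:
  assumes "g \<in> polar M B"
  shows "g \<in> nonneg_meas M" "f \<in> B \<Longrightarrow> (\<integral>\<^sup>+x. ennreal (f x * g x) \<partial>M) \<le> 1"
  using assms by (auto simp: polar_def)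

text \<open>The positive \<open>f\<^sub>0\<close> yields \<open>bounded\<close>: if all multiples of
  the indicator of \<open>E\<close> are in the polar, then \<open>c\<close> times the integral of
  \<open>f\<^sub>0\<close> over \<open>E\<close> is at most 1 for every \<open>c\<close>, so
  \<open>E\<close> is null. Closedness is Fatou's lemma.\<close>

lemma function_ball_polar:
  assumes B: "B \<subseteq> nonneg_meas M" and f0: "f\<^sub>0 \<in> B" "AE x in M. 0 < f\<^sub>0 x"
  shows "function_ball M (polar M B)"
proof
  have Bm[measurable]: "f \<in> borel_measurable M" and B0: "0 \<le> f x" if "f \<in> B" for f x
    using that B by (auto simp: nonneg_meas_def)
  show "polar M B \<subseteq> nonneg_meas M" by (auto simp: polar_def)
  show "(\<lambda>x. 0) \<in> polar M B" by (auto simp: polar_def nonneg_meas_def)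
  show "g \<in> polar M B" if f: "f \<in> polar M B" and g: "g \<in> nonneg_meas M" and le: "AE x in M. g x \<le> f x" for f g
  proof -
    have "(\<integral>\<^sup>+x. ennreal (k x * g x) \<partial>M) \<le> 1" if k: "k \<in> B" for k
    proof -
      have "(\<integral>\<^sup>+x. ennreal (k x * g x) \<partial>M) \<le> (\<integral>\<^sup>+x. ennreal (k x * f x) \<partial>M)"
        using le by (intro nn_integral_mono_AE) (auto intro!: ennreal_leI mult_left_mono B0[OF k])
      also have "\<dots> \<le> 1" by (rule polarD(2)[OF f k])
      finally show ?thesis .
    qed
    with g show ?thesis by (simp add: polar_def)
  qed
  show "(\<lambda>x. a * f x + (1 - a) * g x) \<in> polar M B"
    if f: "f \<in> polar M B" and g: "g \<in> polar M B" and a: "0 \<le> a" "a \<le> 1" for f g a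
  proof -
    note fg = polarD(1)[OF f] polarD(1)[OF g]
    note [measurable] = fg[THEN nonneg_measD(1)]
    note nn = fg[THEN nonneg_measD(2)]
    have "(\<integral>\<^sup>+x. ennreal (k x * (a * f x + (1 - a) * g x)) \<partial>M) \<le> 1" if k: "k \<in> B" for k
    proof -
      note [measurable] = Bm[OF k]
      have "(\<integral>\<^sup>+x. ennreal (k x * (a * f x + (1 - a) * g x)) \<partial>M)
          = (\<integral>\<^sup>+x. ennreal a * ennreal (k x * f x) + ennreal (1 - a) * ennreal (k x * g x) \<partial>M)"
        using a nn B0[OF k] by (intro nn_integral_cong, subst ennreal_convex_comb[symmetric]) (auto simp: algebra_simps)
      also have "\<dots> = ennreal a * (\<integral>\<^sup>+x. ennreal (k x * f x) \<partial>M) + ennreal (1 - a) * (\<integral>\<^sup>+x. ennreal (k x * g x) \<partial>M)"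
        by (simp add: nn_integral_add nn_integral_cmult)
      also have "\<dots> \<le> ennreal a * 1 + ennreal (1 - a) * 1"
        using polarD(2)[OF f k] polarD(2)[OF g k] by (intro add_mono mult_left_mono) auto
      also have "\<dots> = 1" using a by (simp flip: ennreal_plus)
      finally show ?thesis .
    qed
    with nn a show ?thesis by (auto simp: polar_def nonneg_meas_def)
  qed
  show "h \<in> polar M B" if g: "\<And>n. g n \<in> polar M B" and h: "h \<in> nonneg_meas M"
    and lim: "AE x in M. incseq (\<lambda>n. g n x) \<and> (\<lambda>n. g n x) \<longlonglongrightarrow> h x" for g h
  proof -
    note [measurable] = nonneg_measD(1)[OF polarD(1)[OF g]] nonneg_measD(1)[OF h]
    have "(\<integral>\<^sup>+x. ennreal (k x * h x) \<partial>M) \<le> 1" if k: "k \<in> B" for k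
    proof (rule nn_integral_AE_limit_le[where f="\<lambda>n x. ennreal (k x * g n x)"])
      note [measurable] = Bm[OF k]
      show "(\<lambda>x. ennreal (k x * g n x)) \<in> borel_measurable M" for n by measurable
      show "(\<lambda>x. ennreal (k x * h x)) \<in> borel_measurable M" by measurable
      show "AE x in M. (\<lambda>n. ennreal (k x * g n x)) \<longlonglongrightarrow> ennreal (k x * h x)"
        using lim by eventually_elim (auto intro!: tendsto_intros tendsto_ennrealI)
      show "(\<integral>\<^sup>+x. ennreal (k x * g n x) \<partial>M) \<le> 1" for n by (rule polarD(2)[OF g k])
    qed
    with h show ?thesis by (simp add: polar_def)
  qed
  show "emeasure M E = 0" if E[measurable]: "E \<in> sets M"
    and c: "\<And>c. 0 < c \<Longrightarrow> (\<lambda>x. c * indicator E x) \<in> polar M B" for E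
  proof -
    note [measurable] = Bm[OF f0(1)]
    define J where "J = (\<integral>\<^sup>+x. ennreal (f\<^sub>0 x * indicator E x) \<partial>M)"
    have le: "ennreal c * J \<le> 1" if "0 < c" for c
    proof -
      have "ennreal c * J = (\<integral>\<^sup>+x. ennreal c * ennreal (f\<^sub>0 x * indicator E x) \<partial>M)"
        unfolding J_def by (simp add: nn_integral_cmult)
      also have "\<dots> = (\<integral>\<^sup>+x. ennreal (f\<^sub>0 x * (c * indicator E x)) \<partial>M)"
        using that B0[OF f0(1)] by (intro nn_integral_cong) (simp add: ac_simps flip: ennreal_mult)
      also have "\<dots> \<le> 1" by (rule polarD(2)[OF c[OF that] f0(1)])
      finally show ?thesis .
    qed
    have "J < \<infinity>" using le[of 1] by (simp add: order_le_less_trans)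
    then obtain j where j: "0 \<le> j" "J = ennreal j" by (cases J) auto
    have "j \<le> 0"
    proof (rule ccontr)
      assume "\<not> j \<le> 0"
      then have "ennreal (2 / j) * ennreal j \<le> 1" using le[of "2/j"] j by simp
      then show False using \<open>\<not> j \<le> 0\<close> by (simp flip: ennreal_mult ennreal_1)
    qed
    then have "J = 0" using j by simp
    then have "AE x in M. ennreal (f\<^sub>0 x * indicator E x) = 0"
      unfolding J_def by (subst (asm) nn_integral_0_iff_AE) auto
    with f0(2) have "AE x in M. x \<notin> E"
      by eventually_elim (auto simp: indicator_def split: if_splits)
    then show ?thesis by (subst (asm) AE_iff_measurable[where N=E]) (auto dest: sets.sets_into_space[OF E, THEN subsetD])
  qed
qed

text \<open>For \<open>E\<close> of positive measure some multiple of its indicator is outside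
  \<open>B\<close>; the function separating it from \<open>B\<close> cannot vanish on
  \<open>E\<close>. The exhaustion lemma, applied to the polar, does the rest.\<close>

lemma (in function_ball) polar_strictly_positive:
  assumes "sigma_finite_measure M" and f0: "f\<^sub>0 \<in> B" "AE x in M. 0 < f\<^sub>0 x"
  obtains g where "g \<in> polar M B" "AE x in M. 0 < g x"
proof -
  interpret P: function_ball M "polar M B"
    by (rule function_ball_polar[OF nonneg_meas f0])
  show ?thesis
  proof (rule P.strictly_positive[OF assms(1)])
    fix E assume E[measurable]: "E \<in> sets M" and "0 < emeasure M E"
    then obtain c where c: "0 < c" "(\<lambda>x. c * indicator E x) \<notin> B"
      using bounded[OF E] by (metis less_irrefl)
    obtain z where z: "z \<in> polar M B" "1 < (\<integral>\<^sup>+x. ennreal (c * indicator E x * z x) \<partial>M)"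
    proof (rule separate_bounded[OF assms(1) _ _ c(2)])
      show "(\<lambda>x. c * indicator E x) \<in> nonneg_meas M" using c by (auto simp: nonneg_meas_def)
      show "c * indicator E x \<le> c" for x using c by (auto simp: indicator_def)
    qed
    have "\<not> (AE x in M. x \<in> E \<longrightarrow> z x = 0)"
    proof
      assume "AE x in M. x \<in> E \<longrightarrow> z x = 0"
      then have "(\<integral>\<^sup>+x. ennreal (c * indicator E x * z x) \<partial>M) = (\<integral>\<^sup>+x. 0 \<partial>M)"
        by (intro nn_integral_cong_AE) (auto elim!: eventually_mono simp: indicator_def)
      with z(2) show False by simp
    qed
    with z(1) show "\<exists>f\<in>polar M B. \<not> (AE x in M. x \<in> E \<longrightarrow> f x = 0)" by blast
  qed (rule that)
qed

lemma (in function_ball) positive_part_convex: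
  assumes "v \<in> {f \<in> B. AE x in M. 0 < f x}" "w \<in> {f \<in> B. AE x in M. 0 < f x}" "0 \<le> a" "a \<le> 1"
  shows "(\<lambda>x. a * v x + (1 - a) * w x) \<in> {f \<in> B. AE x in M. 0 < f x}"
proof -
  have "AE x in M. 0 < v x" "AE x in M. 0 < w x" using assms by auto
  then have "AE x in M. 0 < a * v x + (1 - a) * w x"
  proof eventually_elim
    case (elim x)
    show ?case
    proof (cases "a = 0")
      case False
      then show ?thesis using elim assms by (intro add_pos_nonneg) auto
    qed (use elim in auto)
  qed
  then show ?thesis using convex[of v w a] assms by auto
qed

text \<open>Any \<open>f\<close> in the ball is the limit of positive elements, obtained by mixing
  in a vanishing share of \<open>f\<^sub>0\<close>, and Fatou's lemma applies. This permits division
  by the elements of the ball in the minimax argument.\<close>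

lemma (in function_ball) polar_positive_part:
  assumes f0: "f\<^sub>0 \<in> B" "AE x in M. 0 < f\<^sub>0 x"
  shows "polar M {f \<in> B. AE x in M. 0 < f x} = polar M B"
proof (intro set_eqI iffI)
  fix g assume g: "g \<in> polar M {f \<in> B. AE x in M. 0 < f x}"
  note [measurable] = nonneg_measD(1)[OF polarD(1)[OF g]]
  have g0: "0 \<le> g x" for x by (rule nonneg_measD(2)[OF polarD(1)[OF g]])
  have "(\<integral>\<^sup>+x. ennreal (f x * g x) \<partial>M) \<le> 1" if f: "f \<in> B" for f
  proof -
    note [measurable] = measurable[OF f] measurable[OF f0(1)]
    show ?thesis
    proof (rule nn_integral_AE_limit_le)
      define k where "k n x = (1 / real (Suc n)) * f\<^sub>0 x + (1 - 1 / real (Suc n)) * f x" for n x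
      have kB: "k n \<in> B" for n unfolding k_def[abs_def] by (intro convex f0 f) auto
      have kpos: "AE x in M. 0 < k n x" for n
        using f0(2) unfolding k_def
        by eventually_elim (auto intro!: add_pos_nonneg mult_nonneg_nonneg nonneg[OF f])
      show "(\<integral>\<^sup>+x. ennreal (k n x * g x) \<partial>M) \<le> 1" for n
        by (rule polarD(2)[OF g]) (use kB kpos in auto)
      show "(\<lambda>x. ennreal (k n x * g x)) \<in> borel_measurable M" for n
        using measurable[OF kB] by measurable
      have "(\<lambda>n. k n x) \<longlonglongrightarrow> 0 * f\<^sub>0 x + (1 - 0) * f x" for x
        unfolding k_def by (intro tendsto_intros LIMSEQ_Suc[OF lim_1_over_n])
      then show "AE x in M. (\<lambda>n. ennreal (k n x * g x)) \<longlonglongrightarrow> ennreal (f x * g x)"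
        by (intro AE_I2 tendsto_ennrealI tendsto_mult tendsto_const) simp
    qed measurable
  qed
  with polarD(1)[OF g] show "g \<in> polar M B" by (simp add: polar_def)
qed (auto simp: polar_def)

section \<open>Minimax and factorization\<close>

text \<open>If \<open>P\<close> missed the quadrant below \<open>(d, d)\<close>, a line would
  separate them. The quadrant is unbounded downwards, so the normal has nonnegative components;
  normalized, they are the weights \<open>l\<close> for which the hypothesis fails.\<close>

lemma minimax_pair:
  fixes P :: "(real \<times> real) set"
  assumes "convex P" and nn: "\<And>a b. (a, b) \<in> P \<Longrightarrow> 0 \<le> a \<and> 0 \<le> b"
    and ex: "\<And>l. 0 < l \<Longrightarrow> l < 1 \<Longrightarrow> \<exists>(a, b)\<in>P. l * a + (1 - l) * b \<le> c"
    and c: "0 \<le> c" "c < d"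
  shows "\<exists>(a, b)\<in>P. a \<le> d \<and> b \<le> d"
proof (rule ccontr)
  assume neg: "\<not> ?thesis"
  define T where "T = {..d} \<times> {..d}"
  have "convex T" unfolding T_def by (intro convex_Times convex_real_interval)
  moreover have "T \<inter> P = {}" using neg by (auto simp: T_def)
  moreover have "P \<noteq> {}" using ex[of "1/2"] by auto
  moreover have "T \<noteq> {}" by (auto simp: T_def)
  ultimately obtain n e where n: "n \<noteq> 0" "\<And>x. x \<in> T \<Longrightarrow> inner n x \<le> e" "\<And>x. x \<in> P \<Longrightarrow> e \<le> inner n x"
    using separating_hyperplane_sets[OF _ \<open>convex P\<close>, of T] by metis
  obtain n1 n2 where nn12: "n = (n1, n2)" by (cases n)
  have T: "n1 * a + n2 * b \<le> e" if "a \<le> d" "b \<le> d" for a b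
    using n(2)[of "(a, b)"] that by (simp add: T_def nn12)
  have n1: "0 \<le> n1"
  proof (rule ccontr)
    assume "\<not> 0 \<le> n1"
    moreover from this obtain a where "a \<le> d" "e < n1 * a + n2 * d"
      by (intro that[of "min d ((e - n2 * d + 1) / n1)"])
         (auto simp: min_def field_simps split: if_splits)
    ultimately show False using T[of a d] by simp
  qed
  have n2: "0 \<le> n2"
  proof (rule ccontr)
    assume "\<not> 0 \<le> n2"
    moreover from this obtain a where "a \<le> d" "e < n1 * d + n2 * a"
      by (intro that[of "min d ((e - n1 * d + 1) / n2)"])
         (auto simp: min_def field_simps split: if_splits)
    ultimately show False using T[of d a] by simp
  qed
  have "n1 \<noteq> 0 \<or> n2 \<noteq> 0" using n(1) by (auto simp: nn12 zero_prod_def)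
  with n1 n2 have pos: "0 < n1 + n2" by linarith
  have P: "(n1 + n2) * d \<le> n1 * a + n2 * b" if "(a, b) \<in> P" for a b
    using n(3)[OF that] T[of d d] by (simp add: nn12 algebra_simps)
  \<comment> \<open>The hypothesis covers only weights strictly between 0 and 1, so a normal along
    an axis is handled with a weight close to the endpoint; \<open>\<delta>\<close> is small enough
    for \<open>(1 - \<delta>) * d\<close> to stay above \<open>c\<close>.\<close>
  define \<delta> where "\<delta> = (d - c) / (2 * d)"
  have \<delta>: "0 < \<delta>" "\<delta> < 1" "(1 - \<delta>) * d > c"
    using c by (auto simp: \<delta>_def field_simps)
  consider "n1 = 0" | "n2 = 0" | "0 < n1" "0 < n2" using n1 n2 by fastforce
  then show False
  proof cases
    case 1
    obtain a b where ab: "(a, b) \<in> P" "\<delta> * a + (1 - \<delta>) * b \<le> c" using ex[of \<delta>] \<delta> by auto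
    have "d \<le> b" using P[OF ab(1)] 1 pos by simp
    then have "(1 - \<delta>) * d \<le> (1 - \<delta>) * b" using \<delta> by (intro mult_left_mono) auto
    moreover have "0 \<le> \<delta> * a" using nn[OF ab(1)] \<delta> by simp
    ultimately show False using ab(2) \<delta>(3) by linarith
  next
    case 2
    obtain a b where ab: "(a, b) \<in> P" "(1 - \<delta>) * a + (1 - (1 - \<delta>)) * b \<le> c" using ex[of "1 - \<delta>"] \<delta> by auto
    have "d \<le> a" using P[OF ab(1)] 2 pos by simp
    then have "(1 - \<delta>) * d \<le> (1 - \<delta>) * a" using \<delta> by (intro mult_left_mono) auto
    moreover have "0 \<le> \<delta> * b" using nn[OF ab(1)] \<delta> by simp
    ultimately show False using ab(2) \<delta>(3) by simp
  next
    case 3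
    define l where "l = n1 / (n1 + n2)"
    have l: "0 < l" "l < 1" "1 - l = n2 / (n1 + n2)" using 3 by (auto simp: l_def field_simps)
    obtain a b where ab: "(a, b) \<in> P" "l * a + (1 - l) * b \<le> c" using ex[OF l(1,2)] by auto
    have "l * a + (1 - l) * b = (n1 * a + n2 * b) / (n1 + n2)"
      unfolding l(3) by (simp add: l_def add_divide_distrib)
    then have "(n1 * a + n2 * b) / (n1 + n2) \<le> c"
      using ab(2) by simp
    then have "n1 * a + n2 * b \<le> (n1 + n2) * c"
      using pos by (simp add: pos_divide_le_eq mult.commute)
    then have "(n1 + n2) * d \<le> (n1 + n2) * c" using P[OF ab(1)] by linarith
    then show False using pos c by simp
  qed
qed

text \<open>Induction on the number of constraints: the constraint of one \<open>u\<close> is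
  absorbed into the convex set \<open>K'\<close>, and \<open>minimax_pair\<close>, applied to the
  values at \<open>v\<close> and \<open>u\<close>, shows that \<open>K'\<close> still answers every
  \<open>v\<close>. Convexity is expressed through abstract mixing operations.\<close>

lemma minimax_finite:
  fixes \<Phi> :: "'y \<Rightarrow> 'v \<Rightarrow> ennreal"
  assumes K: "\<And>a y y'. y \<in> K \<Longrightarrow> y' \<in> K \<Longrightarrow> 0 \<le> a \<Longrightarrow> a \<le> 1 \<Longrightarrow> mY a y y' \<in> K"
    and V: "\<And>a v v'. v \<in> V \<Longrightarrow> v' \<in> V \<Longrightarrow> 0 \<le> a \<Longrightarrow> a \<le> 1 \<Longrightarrow> mV a v v' \<in> V"
    and \<Phi>Y: "\<And>a y y' v. y \<in> K \<Longrightarrow> y' \<in> K \<Longrightarrow> v \<in> V \<Longrightarrow> 0 \<le> a \<Longrightarrow> a \<le> 1 \<Longrightarrow>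
          \<Phi> (mY a y y') v = ennreal a * \<Phi> y v + ennreal (1 - a) * \<Phi> y' v"
    and \<Phi>V: "\<And>a y v v'. y \<in> K \<Longrightarrow> v \<in> V \<Longrightarrow> v' \<in> V \<Longrightarrow> 0 \<le> a \<Longrightarrow> a \<le> 1 \<Longrightarrow>
          \<Phi> y (mV a v v') = ennreal a * \<Phi> y v + ennreal (1 - a) * \<Phi> y v'"
    and A: "finite A" "A \<subseteq> V" and "V \<noteq> {}"
    and ex: "\<And>v. v \<in> V \<Longrightarrow> \<exists>y\<in>K. \<Phi> y v \<le> ennreal c"
    and c: "0 \<le> c" "c < d"
  shows "\<exists>y\<in>K. \<forall>v\<in>A. \<Phi> y v \<le> ennreal d"
  using A K \<Phi>Y \<Phi>V ex c
proof (induction A arbitrary: K c)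
  case empty
  then show ?case using \<open>V \<noteq> {}\<close> by blast
next
  case (insert u A)
  note K = insert.prems(2) and \<Phi>Y = insert.prems(3) and \<Phi>V = insert.prems(4) and ex = insert.prems(5)
  have u: "u \<in> V" using insert.prems(1) by simp
  \<comment> \<open>Each absorbed constraint raises the admissible level; halving the distance keeps
    it below \<open>d\<close> throughout the induction.\<close>
  define e where "e = (c + d) / 2"
  have e: "c < e" "e < d" "0 \<le> e" using insert.prems(6,7) by (auto simp: e_def)
  define K' where "K' = {y \<in> K. \<Phi> y u \<le> ennreal e}"
  have comb: "ennreal a * p + ennreal (1 - a) * q \<le> ennreal b"
    if "p \<le> ennreal b" "q \<le> ennreal b" "0 \<le> a" "a \<le> 1" "0 \<le> b" for a b p q
  proof -
    have "ennreal a * p + ennreal (1 - a) * q \<le> ennreal a * ennreal b + ennreal (1 - a) * ennreal b"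
      using that by (intro add_mono mult_left_mono) auto
    also have "\<dots> = ennreal b" using that by (subst ennreal_convex_comb[symmetric]) (auto simp: algebra_simps)
    finally show ?thesis .
  qed
  have ex': "\<exists>y\<in>K'. \<Phi> y v \<le> ennreal e" if v: "v \<in> V" for v
  proof -
    \<comment> \<open>Real upper bounds of the values instead of the values, which may be
      infinite.\<close>
    define P where "P = {(p, q). 0 \<le> p \<and> 0 \<le> q \<and> (\<exists>y\<in>K. \<Phi> y v \<le> ennreal p \<and> \<Phi> y u \<le> ennreal q)}"
    have "\<exists>(p, q)\<in>P. p \<le> e \<and> q \<le> e"
    proof (rule minimax_pair[OF _ _ _ insert.prems(6) e(1)])
      show "convex P"
        unfolding convex_def
      proof clarify
        fix p q p' q' a b :: real
        assume P: "(p, q) \<in> P" "(p', q') \<in> P" and ab: "0 \<le> a" "0 \<le> b" "a + b = 1"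
        then obtain y y' where y: "y \<in> K" "\<Phi> y v \<le> ennreal p" "\<Phi> y u \<le> ennreal q" "0 \<le> p" "0 \<le> q"
          and y': "y' \<in> K" "\<Phi> y' v \<le> ennreal p'" "\<Phi> y' u \<le> ennreal q'" "0 \<le> p'" "0 \<le> q'"
          by (auto simp: P_def)
        have b: "b = 1 - a" "a \<le> 1" using ab by auto
        have le: "\<Phi> (mY a y y') w \<le> ennreal (a * k + (1 - a) * k')"
          if "w \<in> V" "\<Phi> y w \<le> ennreal k" "\<Phi> y' w \<le> ennreal k'" "0 \<le> k" "0 \<le> k'" for w k k'
        proof -
          have "\<Phi> (mY a y y') w = ennreal a * \<Phi> y w + ennreal (1 - a) * \<Phi> y' w"
            using that y y' ab b by (intro \<Phi>Y) auto
          also have "\<dots> \<le> ennreal a * ennreal k + ennreal (1 - a) * ennreal k'"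
            using that by (intro add_mono mult_left_mono) auto
          also have "\<dots> = ennreal (a * k + (1 - a) * k')"
            using that ab b by (intro ennreal_convex_comb[symmetric]) auto
          finally show ?thesis .
        qed
        have "mY a y y' \<in> K" using y y' ab b by (intro K) auto
        then show "a *\<^sub>R (p, q) + b *\<^sub>R (p', q') \<in> P"
          using le[OF v y(2) y'(2) y(4) y'(4)] le[OF u y(3) y'(3) y(5) y'(5)] y y' ab unfolding b(1)
          by (auto simp: P_def simp del: ennreal_plus intro!: bexI[of _ "mY a y y'"])
      qed
      show "0 \<le> p \<and> 0 \<le> q" if "(p, q) \<in> P" for p q using that by (auto simp: P_def)
      show "\<exists>(p, q)\<in>P. l * p + (1 - l) * q \<le> c" if l: "0 < l" "l < 1" for l
      proof -
        have "mV l v u \<in> V" using v u l by (intro V) auto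
        then obtain y where y: "y \<in> K" "\<Phi> y (mV l v u) \<le> ennreal c" using ex by blast
        have eq: "\<Phi> y (mV l v u) = ennreal l * \<Phi> y v + ennreal (1 - l) * \<Phi> y u"
          using y v u l by (intro \<Phi>V) auto
        have "ennreal l * \<Phi> y v + ennreal (1 - l) * \<Phi> y u < top"
          by (rule order_le_less_trans[OF y(2)[unfolded eq] ennreal_less_top])
        then have "\<Phi> y v \<noteq> top" "\<Phi> y u \<noteq> top"
          using l by (auto simp: ennreal_mult_top)
        then obtain p q where pq: "0 \<le> p" "0 \<le> q" "\<Phi> y v = ennreal p" "\<Phi> y u = ennreal q"
          by (metis ennreal_cases)
        have "ennreal (l * p + (1 - l) * q) \<le> ennreal c"
          using y(2) eq pq l by (subst ennreal_convex_comb) auto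
        then have "l * p + (1 - l) * q \<le> c" using insert.prems(6) by simp
        moreover have "(p, q) \<in> P" using y(1) pq by (auto simp: P_def intro!: bexI[of _ y])
        ultimately show ?thesis by blast
      qed
    qed
    then obtain p q y where "p \<le> e" "q \<le> e" "y \<in> K" "\<Phi> y v \<le> ennreal p" "\<Phi> y u \<le> ennreal q"
      by (auto simp: P_def)
    then show ?thesis unfolding K'_def
      by (intro bexI[of _ y]) (auto intro: order_trans ennreal_leI)
  qed
  have "\<exists>y\<in>K'. \<forall>v\<in>A. \<Phi> y v \<le> ennreal d"
  proof (rule insert.IH)
    show "A \<subseteq> V" using insert.prems(1) by simp
    show "mY a y y' \<in> K'" if "y \<in> K'" "y' \<in> K'" "0 \<le> a" "a \<le> 1" for a y y'
      using that K[of y y' a] comb[of "\<Phi> y u" e "\<Phi> y' u" a] e \<Phi>Y[of y y' u a] u by (auto simp: K'_def)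
  qed (use \<Phi>Y \<Phi>V ex' e in \<open>auto simp: K'_def\<close>)
  then obtain y where y: "y \<in> K" "\<Phi> y u \<le> ennreal e" "\<forall>v\<in>A. \<Phi> y v \<le> ennreal d"
    by (auto simp: K'_def)
  moreover have "\<Phi> y u \<le> ennreal d"
    by (rule order_trans[OF y(2)]) (use e in \<open>simp add: ennreal_leI\<close>)
  ultimately show ?case by blast
qed

section \<open>Weighted geometric means and duals of Calderon products\<close>

lemma weighted_arith_geom_mean:
  fixes \<theta> x :: "'i \<Rightarrow> real"
  assumes "finite I" and "\<And>i. i \<in> I \<Longrightarrow> 0 < \<theta> i" and "(\<Sum>i\<in>I. \<theta> i) = 1" and "\<And>i. i \<in> I \<Longrightarrow> 0 < x i"
  shows "(\<Prod>i\<in>I. x i powr \<theta> i) \<le> (\<Sum>i\<in>I. \<theta> i * x i)"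
proof -
  have "I \<noteq> {}" using assms(3) by auto
  have pos: "0 < (\<Sum>i\<in>I. \<theta> i * x i)"
    using assms \<open>I \<noteq> {}\<close> by (intro sum_pos) auto
  have "(\<Sum>i\<in>I. \<theta> i * ln (x i)) \<le> ln (\<Sum>i\<in>I. \<theta> i *\<^sub>R x i)"
    by (rule concave_on_sum[OF assms(1) \<open>I \<noteq> {}\<close> ln_concave]) (use assms in \<open>auto intro: less_imp_le\<close>)
  then have "exp (\<Sum>i\<in>I. \<theta> i * ln (x i)) \<le> (\<Sum>i\<in>I. \<theta> i * x i)"
    using pos by (simp add: ln_ge_iff)
  moreover have "exp (\<Sum>i\<in>I. \<theta> i * ln (x i)) = (\<Prod>i\<in>I. x i powr \<theta> i)"
    unfolding exp_sum[OF assms(1)] using assms(4) by (intro prod.cong) (auto simp: powr_def order_less_le)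
  ultimately show ?thesis by simp
qed

text \<open>Makes the set of \<open>y\<close> with geometric mean at least \<open>F\<close> convex:
  \<open>F = F powr a * F powr (1 - a)\<close> is estimated by the two products, and Young's
  inequality is applied in each factor. For positive \<open>F\<close> no factor can vanish.\<close>

lemma geometric_mean_mix:
  fixes \<theta> x y :: "'i \<Rightarrow> real"
  assumes "finite I" and \<theta>: "\<And>i. i \<in> I \<Longrightarrow> 0 < \<theta> i"
    and x: "\<And>i. i \<in> I \<Longrightarrow> 0 \<le> x i" and y: "\<And>i. i \<in> I \<Longrightarrow> 0 \<le> y i"
    and F: "0 \<le> F" "F \<le> (\<Prod>i\<in>I. x i powr \<theta> i)" "F \<le> (\<Prod>i\<in>I. y i powr \<theta> i)" and a: "0 \<le> a" "a \<le> 1"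
  shows "F \<le> (\<Prod>i\<in>I. (a * x i + (1 - a) * y i) powr \<theta> i)"
proof (cases "F = 0")
  case True
  then show ?thesis by (auto intro: prod_nonneg)
next
  case False
  then have Fpos: "0 < F" using F by simp
  have xpos: "0 < x i" if "i \<in> I" for i
  proof (rule ccontr)
    assume "\<not> 0 < x i"
    then have "(\<Prod>i\<in>I. x i powr \<theta> i) = 0"
      using x[OF that] assms(1) that by (auto intro!: bexI[of _ i])
    with F Fpos show False by simp
  qed
  have ypos: "0 < y i" if "i \<in> I" for i
  proof (rule ccontr)
    assume "\<not> 0 < y i"
    then have "(\<Prod>i\<in>I. y i powr \<theta> i) = 0"
      using y[OF that] assms(1) that by (auto intro!: bexI[of _ i])
    with F Fpos show False by simp
  qed
  have "F = F powr a * F powr (1 - a)"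
    using Fpos by (simp flip: powr_add)
  also have "\<dots> \<le> (\<Prod>i\<in>I. x i powr \<theta> i) powr a * (\<Prod>i\<in>I. y i powr \<theta> i) powr (1 - a)"
    using F a by (intro mult_mono powr_mono2) auto
  also have "\<dots> = (\<Prod>i\<in>I. (x i powr a * y i powr (1 - a)) powr \<theta> i)"
    by (simp add: prod_powr_distrib prod.distrib powr_mult powr_powr mult.commute xpos ypos less_imp_le
        cong: prod.cong)
  also have "\<dots> \<le> (\<Prod>i\<in>I. (a * x i + (1 - a) * y i) powr \<theta> i)"
    using a \<theta> xpos ypos by (intro prod_mono conjI powr_mono2 Youngs_inequality_0) (auto intro: less_imp_le)
  finally show ?thesis .
qed

text \<open>The parallelogram law adapted to the integral of \<open>exp (- y)\<close>: the cross
  term is the value at the midpoint, written so that \<open>mix (1/2)\<close> can be folded.\<close>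

lemma square_diff_exp:
  "(exp (- a / 2) - exp (- b / 2))\<^sup>2 = exp (- a) + exp (- b) - 2 * exp (- ((1/2) * a + (1 - 1/2) * b :: real))"
proof -
  have "exp (- a / 2) * exp (- a / 2) = exp (- a)" "exp (- b / 2) * exp (- b / 2) = exp (- b)"
    "exp (- a / 2) * exp (- b / 2) = exp (- ((1/2) * a + (1 - 1/2) * b))"
    by (simp_all add: mult_exp_exp field_simps)
  then show ?thesis
    by (simp add: power2_eq_square algebra_simps)
qed

text \<open>\<open>F\<close> lies in the polar of the weighted geometric means of elements of the
  \<open>V i\<close>; the aim is to bound it by a geometric mean of elements of the polars.
  Positivity of the \<open>v\<close> allows division by them, and positivity of the
  \<open>\<theta> i\<close> means that factors with exponent 0 have been removed beforehand.\<close>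

locale geometric_mean_problem = sigma_finite_measure M
  for M :: "'a measure" +
  fixes I :: "'i set" and \<theta> :: "'i \<Rightarrow> real" and V :: "'i \<Rightarrow> ('a \<Rightarrow> real) set" and F :: "'a \<Rightarrow> real"
  assumes fin: "finite I" and \<theta>_pos: "\<And>i. i \<in> I \<Longrightarrow> 0 < \<theta> i" and \<theta>_sum: "(\<Sum>i\<in>I. \<theta> i) = 1"
    and V_meas: "\<And>i. i \<in> I \<Longrightarrow> V i \<subseteq> nonneg_meas M"
    and V_ne: "\<And>i. i \<in> I \<Longrightarrow> V i \<noteq> {}"
    and V_pos: "\<And>i v. i \<in> I \<Longrightarrow> v \<in> V i \<Longrightarrow> AE x in M. 0 < v x"
    and V_convex: "\<And>i v w a. i \<in> I \<Longrightarrow> v \<in> V i \<Longrightarrow> w \<in> V i \<Longrightarrow> 0 \<le> a \<Longrightarrow> a \<le> 1 \<Longrightarrow>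
          (\<lambda>x. a * v x + (1 - a) * w x) \<in> V i"
    and F: "F \<in> nonneg_meas M"
    and F_le: "\<And>v. (\<And>i. i \<in> I \<Longrightarrow> v i \<in> V i) \<Longrightarrow>
          (\<integral>\<^sup>+x. ennreal (F x * (\<Prod>i\<in>I. v i x powr \<theta> i)) \<partial>M) \<le> 1"
begin

definition VV :: "('i \<Rightarrow> 'a \<Rightarrow> real) set" where
  "VV = {v. \<forall>i\<in>I. v i \<in> V i}"

definition K :: "('i \<Rightarrow> 'a \<Rightarrow> real) set" where
  "K = {y. (\<forall>i\<in>I. y i \<in> nonneg_meas M) \<and> (AE x in M. F x \<le> (\<Prod>i\<in>I. y i x powr \<theta> i))}"

text \<open>For \<open>y\<close> in \<open>K\<close>, the arithmetic-geometric mean inequality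
  bounds \<open>\<Phi> y v\<close> below by the integral of \<open>F\<close> times the geometric
  mean of \<open>v\<close>. Unlike that integral, \<open>\<Phi>\<close> is affine in both arguments,
  as the minimax lemma requires.\<close>

definition \<Phi> :: "('i \<Rightarrow> 'a \<Rightarrow> real) \<Rightarrow> ('i \<Rightarrow> 'a \<Rightarrow> real) \<Rightarrow> ennreal" where
  "\<Phi> y v = (\<integral>\<^sup>+x. ennreal (\<Sum>i\<in>I. \<theta> i * (y i x * v i x)) \<partial>M)"

definition mix :: "real \<Rightarrow> ('i \<Rightarrow> 'a \<Rightarrow> real) \<Rightarrow> ('i \<Rightarrow> 'a \<Rightarrow> real) \<Rightarrow> 'i \<Rightarrow> 'a \<Rightarrow> real" where
  "mix a y z i x = a * y i x + (1 - a) * z i x"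

lemma I_ne: "I \<noteq> {}" using \<theta>_sum by auto

lemma VV_measurable: "v \<in> VV \<Longrightarrow> i \<in> I \<Longrightarrow> v i \<in> borel_measurable M"
  and VV_nn: "v \<in> VV \<Longrightarrow> i \<in> I \<Longrightarrow> 0 \<le> v i x"
  using V_meas by (auto simp: VV_def nonneg_meas_def)

lemma K_measurable: "y \<in> K \<Longrightarrow> i \<in> I \<Longrightarrow> y i \<in> borel_measurable M"
  and K_nn: "y \<in> K \<Longrightarrow> i \<in> I \<Longrightarrow> 0 \<le> y i x"
  by (auto simp: K_def nonneg_meas_def)

lemma F_measurable: "F \<in> borel_measurable M" and F_nn: "0 \<le> F x"
  using F by (auto simp: nonneg_meas_def)

lemma mix_VV: "v \<in> VV \<Longrightarrow> w \<in> VV \<Longrightarrow> 0 \<le> a \<Longrightarrow> a \<le> 1 \<Longrightarrow> mix a v w \<in> VV"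
  using V_convex by (auto simp: VV_def mix_def[abs_def])

lemma mix_K: assumes "y \<in> K" "z \<in> K" "0 \<le> a" "a \<le> 1" shows "mix a y z \<in> K"
proof -
  have "AE x in M. F x \<le> (\<Prod>i\<in>I. y i x powr \<theta> i)" "AE x in M. F x \<le> (\<Prod>i\<in>I. z i x powr \<theta> i)"
    using assms by (auto simp: K_def)
  then have "AE x in M. F x \<le> (\<Prod>i\<in>I. mix a y z i x powr \<theta> i)"
    by eventually_elim (unfold mix_def, rule geometric_mean_mix[OF fin \<theta>_pos],
      use K_nn F_nn assms in auto)
  moreover have "mix a y z i \<in> nonneg_meas M" if "i \<in> I" for i
    using K_measurable[OF assms(1) that] K_measurable[OF assms(2) that] K_nn[OF assms(1) that] K_nn[OF assms(2) that] assms(3,4)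
    by (auto simp: nonneg_meas_def mix_def[abs_def])
  ultimately show ?thesis by (auto simp: K_def)
qed

lemma integrand_nn: "y \<in> K \<Longrightarrow> v \<in> VV \<Longrightarrow> 0 \<le> (\<Sum>i\<in>I. \<theta> i * (y i x * v i x))"
  using \<theta>_pos by (intro sum_nonneg mult_nonneg_nonneg) (auto simp: less_imp_le K_nn VV_nn)

lemma integrand_measurable: "y \<in> K \<Longrightarrow> v \<in> VV \<Longrightarrow> (\<lambda>x. \<Sum>i\<in>I. \<theta> i * (y i x * v i x)) \<in> borel_measurable M"
  by (intro borel_measurable_sum borel_measurable_times borel_measurable_const K_measurable VV_measurable)

lemma affine_integral:
  assumes [measurable]: "f \<in> borel_measurable M" "g \<in> borel_measurable M"
    and "\<And>x. 0 \<le> f x" "\<And>x. 0 \<le> g x" "0 \<le> a" "a \<le> 1"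
  shows "(\<integral>\<^sup>+x. ennreal (a * f x + (1 - a) * g x) \<partial>M)
    = ennreal a * (\<integral>\<^sup>+x. ennreal (f x) \<partial>M) + ennreal (1 - a) * (\<integral>\<^sup>+x. ennreal (g x) \<partial>M)"
proof -
  have "(\<integral>\<^sup>+x. ennreal (a * f x + (1 - a) * g x) \<partial>M)
      = (\<integral>\<^sup>+x. ennreal a * ennreal (f x) + ennreal (1 - a) * ennreal (g x) \<partial>M)"
    using assms(3-) by (intro nn_integral_cong ennreal_convex_comb)
  then show ?thesis by (simp add: nn_integral_add nn_integral_cmult)
qed

lemma \<Phi>_mix_left:
  assumes "y \<in> K" "z \<in> K" "v \<in> VV" "0 \<le> a" "a \<le> 1"
  shows "\<Phi> (mix a y z) v = ennreal a * \<Phi> y v + ennreal (1 - a) * \<Phi> z v"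
proof -
  have "(\<Sum>i\<in>I. \<theta> i * (mix a y z i x * v i x))
      = a * (\<Sum>i\<in>I. \<theta> i * (y i x * v i x)) + (1 - a) * (\<Sum>i\<in>I. \<theta> i * (z i x * v i x))" for x
    by (simp add: mix_def sum_distrib_left algebra_simps sum.distrib sum_subtractf)
  then show ?thesis
    unfolding \<Phi>_def using assms by (simp only:) (intro affine_integral integrand_nn integrand_measurable)
qed

lemma \<Phi>_mix_right:
  assumes "y \<in> K" "v \<in> VV" "w \<in> VV" "0 \<le> a" "a \<le> 1"
  shows "\<Phi> y (mix a v w) = ennreal a * \<Phi> y v + ennreal (1 - a) * \<Phi> y w"
proof -
  have "(\<Sum>i\<in>I. \<theta> i * (y i x * mix a v w i x))
      = a * (\<Sum>i\<in>I. \<theta> i * (y i x * v i x)) + (1 - a) * (\<Sum>i\<in>I. \<theta> i * (y i x * w i x))" for x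
    by (simp add: mix_def sum_distrib_left algebra_simps sum.distrib sum_subtractf)
  then show ?thesis
    unfolding \<Phi>_def using assms by (simp only:) (intro affine_integral integrand_nn integrand_measurable)
qed

text \<open>The minimizer of \<open>\<Phi> \<cdot> v\<close> over \<open>K\<close>, by the equality case of the arithmetic-geometric mean inequality.\<close>

lemma K_optimal:
  assumes v: "v \<in> VV"
  obtains y where "y \<in> K" "\<Phi> y v \<le> 1"
proof
  define G where "G x = (\<Prod>i\<in>I. v i x powr \<theta> i)" for x
  \<comment> \<open>All products \<open>y i x * v i x\<close> are now equal to
    \<open>F x * G x\<close>, and the geometric mean of the \<open>y i\<close> is \<open>F\<close>
    because the \<open>\<theta> i\<close> add up to 1.\<close>
  define y where "y i x = F x * G x / v i x" for i x
  note [measurable] = VV_measurable[OF v] F_measurable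
  have [measurable]: "G \<in> borel_measurable M"
    unfolding G_def[abs_def] by (intro borel_measurable_prod powr_real_measurable) (auto intro: VV_measurable[OF v])
  have G_nn: "0 \<le> G x" for x unfolding G_def by (intro prod_nonneg) simp
  have pos: "AE x in M. \<forall>i\<in>I. 0 < v i x"
    using v V_pos fin by (subst AE_finite_all) (auto simp: VV_def)
  have "AE x in M. F x \<le> (\<Prod>i\<in>I. y i x powr \<theta> i)"
    using pos
  proof eventually_elim
    case (elim x)
    have Gp: "0 < G x" unfolding G_def using elim by (intro prod_pos) (metis powr_gt_zero less_irrefl)
    have "(\<Prod>i\<in>I. y i x powr \<theta> i) = (\<Prod>i\<in>I. (F x * G x) powr \<theta> i / v i x powr \<theta> i)"
      unfolding y_def using elim F_nn G_nn by (intro prod.cong) (auto simp: powr_divide less_imp_le)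
    also have "\<dots> = (\<Prod>i\<in>I. (F x * G x) powr \<theta> i) / G x"
      by (simp add: prod_dividef G_def)
    also have "(\<Prod>i\<in>I. (F x * G x) powr \<theta> i) = F x * G x"
    proof (cases "F x = 0")
      case True
      then show ?thesis using I_ne fin by (simp add: card_gt_0_iff)
    next
      case False
      then have "0 < F x * G x" using Gp F_nn[of x] by simp
      then have "(\<Prod>i\<in>I. (F x * G x) powr \<theta> i) = (F x * G x) powr 1"
        unfolding \<theta>_sum[symmetric] by (intro powr_sum[symmetric]) linarith
      with \<open>0 < F x * G x\<close> show ?thesis by (simp only: powr_one less_imp_le)
    qed
    finally show ?case using Gp by simp
  qed
  then show "y \<in> K"
    using F_nn G_nn VV_nn[OF v] unfolding K_def y_def[abs_def]
    by (auto simp: nonneg_meas_def)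
  have "\<Phi> y v = (\<integral>\<^sup>+x. ennreal (F x * G x) \<partial>M)"
    unfolding \<Phi>_def
  proof (rule nn_integral_cong_AE, use pos in eventually_elim)
    case (elim x)
    have "(\<Sum>i\<in>I. \<theta> i * (y i x * v i x)) = (\<Sum>i\<in>I. \<theta> i * (F x * G x))"
      using elim by (intro sum.cong) (auto simp: y_def)
    also have "\<dots> = F x * G x" using \<theta>_sum by (simp flip: sum_distrib_right)
    finally show ?case by simp
  qed
  also have "\<dots> \<le> 1"
    unfolding G_def by (rule F_le) (use v in \<open>auto simp: VV_def\<close>)
  finally show "\<Phi> y v \<le> 1" .
qed

definition C :: "real \<Rightarrow> ('i \<Rightarrow> 'a \<Rightarrow> real) set \<Rightarrow> ('i \<Rightarrow> 'a \<Rightarrow> real) set" where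
  "C c A = {y \<in> K. \<forall>v\<in>A. \<Phi> y v \<le> ennreal c}"

lemma VV_ne: "VV \<noteq> {}"
proof -
  have "\<forall>i\<in>I. \<exists>v. v \<in> V i" using V_ne by auto
  then obtain v where "\<forall>i\<in>I. v i \<in> V i" by (auto dest: bchoice)
  then show ?thesis by (auto simp: VV_def)
qed

text \<open>Finite intersection property of the constraints. \<open>K_optimal\<close> answers every
  single \<open>v\<close> with a value at most 1; an answer uniform over finitely many
  \<open>v\<close> costs an arbitrarily small excess, hence \<open>1 < c\<close>.\<close>

lemma C_ne: "finite A \<Longrightarrow> A \<subseteq> VV \<Longrightarrow> 1 < c \<Longrightarrow> C c A \<noteq> {}"
  using minimax_finite[of K mix VV mix \<Phi> A 1 c, OF mix_K mix_VV \<Phi>_mix_left \<Phi>_mix_right _ _ VV_ne] K_optimal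
  by (auto simp: C_def) metis

lemma C_antimono: "A \<subseteq> A' \<Longrightarrow> C c A' \<subseteq> C c A"
  by (auto simp: C_def)

lemma mix_C:
  assumes "y \<in> C c A" "z \<in> C c A" "0 \<le> a" "a \<le> 1" "A \<subseteq> VV" "0 \<le> c"
  shows "mix a y z \<in> C c A"
proof -
  have "\<Phi> (mix a y z) v \<le> ennreal c" if v: "v \<in> A" for v
  proof -
    have "\<Phi> (mix a y z) v = ennreal a * \<Phi> y v + ennreal (1 - a) * \<Phi> z v"
      using assms v by (intro \<Phi>_mix_left) (auto simp: C_def)
    also have "\<dots> \<le> ennreal a * ennreal c + ennreal (1 - a) * ennreal c"
      using assms v by (intro add_mono mult_left_mono) (auto simp: C_def)
    also have "\<dots> = ennreal c"
      using assms by (subst ennreal_convex_comb[symmetric]) (auto simp: algebra_simps)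
    finally show ?thesis .
  qed
  with mix_K assms show ?thesis by (auto simp: C_def)
qed

text \<open>The two closedness properties that replace compactness: the pointwise constraint passes
  to the limit by continuity, the integral constraints by Fatou's lemma.\<close>

lemma C_limit:
  assumes y: "\<And>n. y n \<in> K" and z: "\<And>i. i \<in> I \<Longrightarrow> z i \<in> nonneg_meas M"
    and lim: "\<And>i. i \<in> I \<Longrightarrow> AE x in M. (\<lambda>n. y n i x) \<longlonglongrightarrow> z i x"
  shows "z \<in> K" and "\<And>v. v \<in> VV \<Longrightarrow> (\<And>n. \<Phi> (y n) v \<le> c) \<Longrightarrow> \<Phi> z v \<le> c"
proof -
  have lim': "AE x in M. \<forall>i\<in>I. (\<lambda>n. y n i x) \<longlonglongrightarrow> z i x"
    using lim fin by (subst AE_finite_all) auto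
  have "AE x in M. \<forall>n. F x \<le> (\<Prod>i\<in>I. y n i x powr \<theta> i)"
    unfolding AE_all_countable using y by (simp add: K_def)
  with lim' have "AE x in M. F x \<le> (\<Prod>i\<in>I. z i x powr \<theta> i)"
  proof eventually_elim
    case (elim x)
    have "(\<lambda>n. \<Prod>i\<in>I. y n i x powr \<theta> i) \<longlonglongrightarrow> (\<Prod>i\<in>I. z i x powr \<theta> i)"
    proof (rule tendsto_prod)
      fix i assume i: "i \<in> I"
      show "(\<lambda>n. y n i x powr \<theta> i) \<longlonglongrightarrow> z i x powr \<theta> i"
        using elim i \<theta>_pos[OF i] K_nn[OF y i] by (intro tendsto_powr') auto
    qed
    then show ?case by (rule LIMSEQ_le_const) (use elim in auto)
  qed
  with z show zK: "z \<in> K" by (auto simp: K_def)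
  show "\<Phi> z v \<le> c" if v: "v \<in> VV" and le: "\<And>n. \<Phi> (y n) v \<le> c" for v
    unfolding \<Phi>_def
  proof (rule nn_integral_AE_limit_le)
    show "(\<integral>\<^sup>+x. ennreal (\<Sum>i\<in>I. \<theta> i * (y n i x * v i x)) \<partial>M) \<le> c" for n
      using le[of n] by (simp add: \<Phi>_def)
    show "(\<lambda>x. ennreal (\<Sum>i\<in>I. \<theta> i * (y n i x * v i x))) \<in> borel_measurable M" for n
      using integrand_measurable[OF y v] by simp
    show "(\<lambda>x. ennreal (\<Sum>i\<in>I. \<theta> i * (z i x * v i x))) \<in> borel_measurable M"
      using integrand_measurable[OF zK v] by simp
    show "AE x in M. (\<lambda>n. ennreal (\<Sum>i\<in>I. \<theta> i * (y n i x * v i x))) \<longlonglongrightarrow> ennreal (\<Sum>i\<in>I. \<theta> i * (z i x * v i x))"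
      using lim' by eventually_elim (auto intro!: tendsto_ennrealI tendsto_sum tendsto_mult)
  qed
qed

text \<open>Compactness is replaced by minimizing the strictly convex functional $\sum_i \int e^{-y_i}$ over
  \<open>C c A\<close> for larger and larger finite \<open>A\<close>: by \<open>square_diff_exp\<close>, near-minimizers \<open>y\<close> have Cauchy
  functions $e^{-y_i/2}$, and adding one more \<open>v\<close> to all the \<open>A\<close> does not change the limit.\<close>

lemma solution_exists:
  assumes c: "1 < c"
  obtains y where "y \<in> K" "\<And>v. v \<in> VV \<Longrightarrow> \<Phi> y v \<le> ennreal c"
proof -
  obtain h where h[measurable]: "h \<in> borel_measurable M" and hpos: "\<And>x. 0 < (h x :: real)"
    and finN: "finite_measure (density M (\<lambda>x. ennreal (h x)))"
    and AE: "\<And>P. (AE x in density M (\<lambda>x. ennreal (h x)). P x) \<longleftrightarrow> (AE x in M. P x)"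
    using equivalent_finite_measure by metis
  define N where "N = density M (\<lambda>x. ennreal (h x))"
  interpret N: finite_measure N unfolding N_def by (rule finN)
  have [measurable_cong]: "sets N = sets M" by (simp add: N_def)
  have AEN: "(AE x in N. P x) \<longleftrightarrow> (AE x in M. P x)" for P
    unfolding N_def by (rule AE)
  \<comment> \<open>\<open>exp (- y i x)\<close> is at most 1 and so integrable for
    \<open>N\<close>, while \<open>y\<close> itself need not be. Minimizing favours large
    \<open>y\<close>; the constraints \<open>\<Phi> y v \<le> ennreal c\<close> work against
    this.\<close>
  define \<Psi> where "\<Psi> y = (\<Sum>i\<in>I. \<integral>x. exp (- y i x) \<partial>N)" for y :: "'i \<Rightarrow> 'a \<Rightarrow> real"
  have int_exp: "integrable N (\<lambda>x. exp (- y i x))" if "y \<in> K" "i \<in> I" for y i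
    using K_measurable[OF that] K_nn[OF that] by (intro N.integrable_const_bound[where B=1]) auto
  have \<Psi>_nn: "0 \<le> \<Psi> y" for y unfolding \<Psi>_def by (intro sum_nonneg) simp
  define m where "m = real (card I) * measure N (space N)"
  have \<Psi>_le: "\<Psi> y \<le> m" if "y \<in> K" for y
  proof -
    have "\<Psi> y \<le> (\<Sum>i\<in>I. \<integral>x. 1 \<partial>N)"
      unfolding \<Psi>_def using int_exp that K_nn[OF that] by (intro sum_mono integral_mono) auto
    then show ?thesis by (simp add: m_def)
  qed
  define J where "J A = (INF y\<in>C c A. \<Psi> y)" for A
  have bdd: "bdd_below (\<Psi> ` C c A)" for A by (rule bdd_belowI2[where m=0]) (rule \<Psi>_nn)
  have J_le: "J A \<le> \<Psi> y" if "y \<in> C c A" for A y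
    unfolding J_def by (rule cINF_lower[OF bdd that])
  have J_ex: "\<exists>y\<in>C c A. \<Psi> y < J A + e" if "finite A" "A \<subseteq> VV" "0 < e" for A e
    using cINF_less_iff[OF C_ne[OF that(1,2) c] bdd, of "J A + e"] that(3) unfolding J_def by auto
  have J_mono: "J A \<le> J A'" if "A \<subseteq> A'" "finite A'" "A' \<subseteq> VV" for A A'
    unfolding J_def using that by (intro cINF_superset_mono C_ne c bdd C_antimono) auto
  define \<F> where "\<F> = {A. finite A \<and> A \<subseteq> VV}"
  define s where "s = (SUP A\<in>\<F>. J A)"
  have bdd_s: "bdd_above (J ` \<F>)"
  proof (rule bdd_aboveI2[where M=m])
    fix A assume "A \<in> \<F>"
    then obtain y where y: "y \<in> C c A" using C_ne[OF _ _ c] by (auto simp: \<F>_def)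
    then have "J A \<le> \<Psi> y" by (rule J_le)
    also have "\<dots> \<le> m" by (rule \<Psi>_le) (use y in \<open>simp add: C_def\<close>)
    finally show "J A \<le> m" .
  qed
  have J_s: "J A \<le> s" if "finite A" "A \<subseteq> VV" for A
    unfolding s_def by (rule cSUP_upper[OF _ bdd_s]) (use that in \<open>simp add: \<F>_def\<close>)
  have "\<exists>A\<in>\<F>. s - (1/8)^n < J A" for n :: nat
    using less_cSUP_iff[OF _ bdd_s, of "s - (1/8)^n"] unfolding s_def by (auto simp: \<F>_def)
  then obtain A' where A': "\<And>n. A' n \<in> \<F>" "\<And>n :: nat. s - (1/8)^n < J (A' n)" by metis
  obtain v\<^sub>0 where v0: "v\<^sub>0 \<in> VV" using VV_ne by auto
  \<comment> \<open>Increasing sets on which \<open>J\<close> comes within \<open>(1/8) ^ n\<close>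
    of its supremum \<open>s\<close>. The fixed \<open>v\<^sub>0\<close> is included because its
    constraint keeps the limit finite.\<close>
  define A where "A n = insert v\<^sub>0 (\<Union>k\<le>n. A' k)" for n
  have A: "finite (A n)" "A n \<subseteq> VV" "v\<^sub>0 \<in> A n" for n
    using A'(1) v0 by (auto simp: A_def \<F>_def)
  have A_mono: "A n \<subseteq> A (Suc n)" for n by (force simp: A_def)
  have J_A: "s - (1/8)^n < J (A n)" for n
  proof -
    have "J (A' n) \<le> J (A n)" by (rule J_mono[OF _ A(1,2)]) (auto simp: A_def)
    with A'(2)[of n] show ?thesis by linarith
  qed
  \<comment> \<open>The midpoint meets the constraints of \<open>A n\<close>, so
    \<open>\<Psi>\<close> exceeds \<open>s - (1/8) ^ n\<close> there, while at \<open>y\<close> and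
    \<open>z\<close> it is at most \<open>s + (1/8) ^ n\<close>.\<close>
  have close: "(\<integral>x. (exp (- y i x / 2) - exp (- z i x / 2))\<^sup>2 \<partial>N) \<le> 4 * (1/8)^n"
    if y: "y \<in> C c (A n)" "\<Psi> y \<le> s + (1/8)^n" and z: "z \<in> C c (A n)" "\<Psi> z \<le> s + (1/8)^n" and i: "i \<in> I" for y z n i
  proof -
    have K: "y \<in> K" "z \<in> K" using y z by (auto simp: C_def)
    have mK: "mix (1/2) y z \<in> C c (A n)" using y z A c by (intro mix_C) auto
    then have mK': "mix (1/2) y z \<in> K" by (simp add: C_def)
    have ints: "integrable N (\<lambda>x. (exp (- y i x / 2) - exp (- z i x / 2))\<^sup>2)"
      and eqs: "(\<integral>x. (exp (- y i x / 2) - exp (- z i x / 2))\<^sup>2 \<partial>N)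
        = (\<integral>x. exp (- y i x) \<partial>N) + (\<integral>x. exp (- z i x) \<partial>N) - 2 * (\<integral>x. exp (- mix (1/2) y z i x) \<partial>N)"
      if "i \<in> I" for i
      unfolding square_diff_exp mix_def[symmetric]
      using int_exp[OF K(1) that] int_exp[OF K(2) that] int_exp[OF mK' that] by simp_all
    have "(\<integral>x. (exp (- y i x / 2) - exp (- z i x / 2))\<^sup>2 \<partial>N)
        \<le> (\<Sum>i\<in>I. \<integral>x. (exp (- y i x / 2) - exp (- z i x / 2))\<^sup>2 \<partial>N)"
      using i fin by (intro member_le_sum) auto
    also have "\<dots> = (\<Sum>i\<in>I. (\<integral>x. exp (- y i x) \<partial>N) + (\<integral>x. exp (- z i x) \<partial>N)
        - 2 * (\<integral>x. exp (- mix (1/2) y z i x) \<partial>N))"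
      by (rule sum.cong[OF refl eqs])
    also have "\<dots> = \<Psi> y + \<Psi> z - 2 * \<Psi> (mix (1/2) y z)"
      unfolding \<Psi>_def by (simp add: sum.distrib sum_subtractf sum_distrib_left)
    also have "\<dots> \<le> 4 * (1/8)^n"
      using y(2) z(2) J_le[OF mK] J_A[of n] by linarith
    finally show ?thesis .
  qed
  have sq: "AE x in M. summable (\<lambda>n. \<bar>exp (- y n i x / 2) - exp (- z n i x / 2)\<bar>)"
    if y: "\<And>n. y n \<in> C c (A n)" "\<And>n. \<Psi> (y n) \<le> s + (1/8)^n"
      and z: "\<And>n. z n \<in> C c (A n)" "\<And>n. \<Psi> (z n) \<le> s + (1/8)^n" and i: "i \<in> I" for y z i
  proof -
    have K: "y n \<in> K" "z n \<in> K" for n using y z by (auto simp: C_def)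
    note [measurable] = K_measurable[OF K(1) i] K_measurable[OF K(2) i]
    have "\<bar>exp (- y n i x / 2) - exp (- z n i x / 2)\<bar> \<le> 1" for n x
    proof -
      have "exp (- y n i x / 2) \<le> 1" "exp (- z n i x / 2) \<le> 1"
        using K_nn[OF K(1) i] K_nn[OF K(2) i] by auto
      moreover have "0 \<le> exp (- y n i x / 2)" "0 \<le> exp (- z n i x / 2)" by auto
      ultimately show ?thesis by linarith
    qed
    then have "integrable N (\<lambda>x. (exp (- y n i x / 2) - exp (- z n i x / 2))\<^sup>2)" for n
      by (intro N.integrable_const_bound[where B=1]) (auto simp: abs_square_le_1)
    then show ?thesis
      using close[OF y z i]
      by (subst AEN[symmetric], intro N.AE_summable_of_square_decay[where C=4]) (auto simp: nn_integral_eq_integral)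
  qed
  have J_ex_s: "\<exists>y\<in>C c A. \<Psi> y < s + (1/8)^n" if "finite A" "A \<subseteq> VV" for A and n :: nat
  proof -
    have "J A \<le> s" by (rule J_s[OF that])
    moreover obtain y where "y \<in> C c A" "\<Psi> y < J A + (1/8)^n"
      using J_ex[OF \<open>finite A\<close> \<open>A \<subseteq> VV\<close>, of "(1/8)^n"] by auto
    ultimately show ?thesis by (intro bexI[of _ y]) linarith+
  qed
  have "\<exists>y\<in>C c (A n). \<Psi> y < s + (1/8)^n" for n by (rule J_ex_s[OF A(1,2)])
  then obtain y where y: "\<And>n. y n \<in> C c (A n)" "\<And>n. \<Psi> (y n) < s + (1/8)^n" by metis
  have yK: "y n \<in> K" for n using y by (simp add: C_def)
  have ySuc: "y (Suc n) \<in> C c (A n)" "\<Psi> (y (Suc n)) \<le> s + (1/8)^n" for n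
  proof -
    show "y (Suc n) \<in> C c (A n)" using y(1)[of "Suc n"] C_antimono[OF A_mono] by blast
    have "(1/8::real) ^ Suc n \<le> (1/8) ^ n" by simp
    with y(2)[of "Suc n"] show "\<Psi> (y (Suc n)) \<le> s + (1/8)^n" by linarith
  qed
  have "\<exists>e\<in>nonneg_meas M. AE x in M. (\<lambda>n. exp (- y n i x / 2)) \<longlonglongrightarrow> e x" if i: "i \<in> I" for i
  proof -
    have "AE x in M. convergent (\<lambda>n. exp (- y n i x / 2))"
      using sq[of y "\<lambda>n. y (Suc n)", OF y(1) less_imp_le[OF y(2)] ySuc i]
      by eventually_elim (rule convergent_of_summable_diff)
    moreover have "(\<lambda>x. exp (- y n i x / 2)) \<in> nonneg_meas M" for n
      using K_measurable[OF yK i] by (auto simp: nonneg_meas_def)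
    ultimately obtain h where "h \<in> nonneg_meas M" "AE x in M. (\<lambda>n. exp (- y n i x / 2)) \<longlonglongrightarrow> h x"
      using nonneg_meas_limit[of "\<lambda>n x. exp (- y n i x / 2)" M] by blast
    then show ?thesis by blast
  qed
  then have "\<forall>i\<in>I. \<exists>e. e \<in> nonneg_meas M \<and> (AE x in M. (\<lambda>n. exp (- y n i x / 2)) \<longlonglongrightarrow> e x)"
    by blast
  from bchoice[OF this] obtain e where
    "\<forall>i\<in>I. e i \<in> nonneg_meas M \<and> (AE x in M. (\<lambda>n. exp (- y n i x / 2)) \<longlonglongrightarrow> e i x)" ..
  then have e: "\<And>i. i \<in> I \<Longrightarrow> e i \<in> nonneg_meas M"
    "\<And>i. i \<in> I \<Longrightarrow> AE x in M. (\<lambda>n. exp (- y n i x / 2)) \<longlonglongrightarrow> e i x"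
    by (simp_all only: simp_thms)
  \<comment> \<open>A zero of \<open>e i\<close> is a point where \<open>y n i\<close> tends to
    infinity. The constraint of \<open>v\<^sub>0\<close> bounds the integrals of
    \<open>\<theta> i * (y n i x * v\<^sub>0 i x)\<close>, and \<open>v\<^sub>0 i\<close> is
    positive, so Fatou's lemma confines such points to a null set.\<close>
  have e_pos: "AE x in M. 0 < e i x" if i: "i \<in> I" for i
  proof -
    note [measurable] = K_measurable[OF yK i] VV_measurable[OF v0 i]
    have le: "(\<integral>\<^sup>+x. ennreal (\<theta> i * (y n i x * v\<^sub>0 i x)) \<partial>M) \<le> ennreal c" for n
    proof -
      have "(\<integral>\<^sup>+x. ennreal (\<theta> i * (y n i x * v\<^sub>0 i x)) \<partial>M) \<le> \<Phi> (y n) v\<^sub>0"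
        unfolding \<Phi>_def
      proof (intro nn_integral_mono ennreal_leI)
        fix x
        show "\<theta> i * (y n i x * v\<^sub>0 i x) \<le> (\<Sum>i\<in>I. \<theta> i * (y n i x * v\<^sub>0 i x))"
          by (rule member_le_sum[OF i _ fin])
             (simp add: K_nn[OF yK] VV_nn[OF v0] \<theta>_pos less_imp_le)
      qed
      also have "\<dots> \<le> ennreal c" using y(1)[of n] A(3)[of n] by (simp add: C_def)
      finally show ?thesis .
    qed
    have "(\<integral>\<^sup>+x. liminf (\<lambda>n. ennreal (\<theta> i * (y n i x * v\<^sub>0 i x))) \<partial>M)
        \<le> liminf (\<lambda>n. \<integral>\<^sup>+x. ennreal (\<theta> i * (y n i x * v\<^sub>0 i x)) \<partial>M)"
      by (rule nn_integral_liminf) simp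
    also have "\<dots> \<le> ennreal c" using le by (intro Liminf_le) auto
    also have "\<dots> < \<infinity>" by simp
    finally have "AE x in M. liminf (\<lambda>n. ennreal (\<theta> i * (y n i x * v\<^sub>0 i x))) \<noteq> \<infinity>"
      by (intro nn_integral_noteq_infinite) auto
    moreover have "AE x in M. 0 < v\<^sub>0 i x" using v0 V_pos i by (auto simp: VV_def)
    ultimately show ?thesis using e(2)[OF i]
    proof eventually_elim
      case (elim x)
      have "e i x \<noteq> 0"
      proof
        assume "e i x = 0"
        have k: "0 < \<theta> i * v\<^sub>0 i x" using elim \<theta>_pos[OF i] by simp
        have "filterlim (\<lambda>n. exp (- y n i x / 2)) (at_right 0) sequentially"
          using elim(3) \<open>e i x = 0\<close> by (auto simp: filterlim_at)
        then have "filterlim (\<lambda>n. ln (exp (- y n i x / 2))) at_bot sequentially"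
          by (rule filterlim_compose[OF ln_at_0])
        then have "filterlim (\<lambda>n. - (- y n i x / 2)) at_top sequentially"
          by (simp add: filterlim_uminus_at_top)
        then have "filterlim (\<lambda>n. (2 * (\<theta> i * v\<^sub>0 i x)) * (- (- y n i x / 2))) at_top sequentially"
          using k by (intro filterlim_tendsto_pos_mult_at_top[OF tendsto_const]) auto
        then have "filterlim (\<lambda>n. \<theta> i * (y n i x * v\<^sub>0 i x)) at_top sequentially"
          by (simp add: ac_simps)
        then have "(\<lambda>n. ennreal (\<theta> i * (y n i x * v\<^sub>0 i x))) \<longlonglongrightarrow> \<infinity>"
          by (simp add: ennreal_tendsto_top_eq_at_top)
        then have "liminf (\<lambda>n. ennreal (\<theta> i * (y n i x * v\<^sub>0 i x))) = \<infinity>"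
          by (rule lim_imp_Liminf[rotated]) simp
        with elim show False by simp
      qed
      with nonneg_measD(2)[OF e(1)[OF i], of x] show ?case by simp
    qed
  qed
  \<comment> \<open>Inverts \<open>exp (- t / 2)\<close>; the maximum with 0 changes the function
    only on a null set.\<close>
  define Y where "Y i x = max 0 (- 2 * ln (e i x))" for i x
  have Y: "Y i \<in> nonneg_meas M" if "i \<in> I" for i
    using nonneg_measD(1)[OF e(1)[OF that]] unfolding nonneg_meas_def Y_def[abs_def] by simp
  have to_Y: "AE x in M. (\<lambda>n. z n i x) \<longlonglongrightarrow> Y i x"
    if z: "\<And>n. z n \<in> K" and lim: "AE x in M. (\<lambda>n. exp (- z n i x / 2)) \<longlonglongrightarrow> e i x" and i: "i \<in> I" for z :: "nat \<Rightarrow> 'i \<Rightarrow> 'a \<Rightarrow> real" and i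
    using lim e_pos[OF i]
  proof eventually_elim
    case (elim x)
    have "(\<lambda>n. - 2 * ln (exp (- z n i x / 2))) \<longlonglongrightarrow> - 2 * ln (e i x)"
      using elim by (intro tendsto_intros) auto
    then have *: "(\<lambda>n. z n i x) \<longlonglongrightarrow> - 2 * ln (e i x)" by simp
    then have "0 \<le> - 2 * ln (e i x)"
      using K_nn[OF z i] by (intro LIMSEQ_le_const[OF *]) auto
    with * show ?case by (simp add: Y_def)
  qed
  have "Y \<in> K" by (rule C_limit(1)[OF yK Y to_Y[OF yK e(2)]])
  moreover have "\<Phi> Y v \<le> ennreal c" if v: "v \<in> VV" for v
  proof -
    \<comment> \<open>One sequence cannot serve uncountably many \<open>v\<close>. Near-minimizers
      for \<open>A n\<close> enlarged by \<open>v\<close> meet the constraint of \<open>v\<close>,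
      still lie in \<open>C c (A n)\<close> and obey the same bound through \<open>s\<close>, so
      \<open>close\<close> forces on them the limit of the \<open>y n\<close>.\<close>
    have "\<exists>z\<in>C c (insert v (A n)). \<Psi> z < s + (1/8)^n" for n
      by (rule J_ex_s) (use A v in auto)
    then obtain z where z: "\<And>n. z n \<in> C c (insert v (A n))" "\<And>n. \<Psi> (z n) < s + (1/8)^n" by metis
    have zA: "z n \<in> C c (A n)" for n using z(1)[of n] by (auto simp: C_def)
    have zK: "z n \<in> K" for n using zA by (simp add: C_def)
    have lim: "AE x in M. (\<lambda>n. exp (- z n i x / 2)) \<longlonglongrightarrow> e i x" if i: "i \<in> I" for i
      using sq[OF y(1) less_imp_le[OF y(2)] zA less_imp_le[OF z(2)] i] e(2)[OF i]
    proof eventually_elim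
      case (elim x)
      have "(\<lambda>n. exp (- y n i x / 2) - exp (- z n i x / 2)) \<longlonglongrightarrow> 0"
        using summable_LIMSEQ_zero[OF elim(1)] by (simp add: tendsto_rabs_zero_iff)
      from tendsto_diff[OF elim(2) this] show ?case by simp
    qed
    show ?thesis
      by (rule C_limit(2)[OF zK Y to_Y[OF zK lim] v]) (use z(1) in \<open>auto simp: C_def\<close>)
  qed
  ultimately show ?thesis by (rule that)
qed

text \<open>Half of Lozanovskii's theorem on the duals of Calderon products.\<close>

theorem factorization:
  assumes c: "1 < c"
  obtains y where "\<And>i. i \<in> I \<Longrightarrow> y i \<in> polar M (V i)" "AE x in M. F x \<le> c * (\<Prod>i\<in>I. y i x powr \<theta> i)"
proof -
  \<comment> \<open>Budget: one \<open>\<delta>\<close> is lost in choosing nearly optimal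
    \<open>v i\<close>, another in making the normalizers \<open>k i\<close> positive.\<close>
  define c' where "c' = (1 + c) / 2"
  define \<delta> where "\<delta> = (c - 1) / 8"
  have c': "1 < c'" "0 < \<delta>" "c' + 2 * \<delta> \<le> c" using c by (auto simp: c'_def \<delta>_def field_simps)
  obtain y where y: "y \<in> K" "\<And>v. v \<in> VV \<Longrightarrow> \<Phi> y v \<le> ennreal c'"
    using solution_exists[OF c'(1)] by blast
  have sum_eq: "\<Phi> y v = (\<Sum>i\<in>I. ennreal (\<theta> i) * (\<integral>\<^sup>+x. ennreal (v i x * y i x) \<partial>M))" if v: "v \<in> VV" for v
  proof -
    have "\<Phi> y v = (\<integral>\<^sup>+x. (\<Sum>i\<in>I. ennreal (\<theta> i) * ennreal (v i x * y i x)) \<partial>M)"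
      unfolding \<Phi>_def using \<theta>_pos K_nn[OF y(1)] VV_nn[OF v]
      by (intro nn_integral_cong) (simp add: less_imp_le mult.commute mult.left_commute sum_nonneg flip: ennreal_mult)
    also have "\<dots> = (\<Sum>i\<in>I. \<integral>\<^sup>+x. ennreal (\<theta> i) * ennreal (v i x * y i x) \<partial>M)"
      using K_measurable[OF y(1)] VV_measurable[OF v] by (intro nn_integral_sum) measurable
    also have "\<dots> = (\<Sum>i\<in>I. ennreal (\<theta> i) * (\<integral>\<^sup>+x. ennreal (v i x * y i x) \<partial>M))"
      using K_measurable[OF y(1)] VV_measurable[OF v] by (intro sum.cong refl nn_integral_cmult) measurable
    finally show ?thesis .
  qed
  \<comment> \<open>The norms of the \<open>y i\<close> as functionals on \<open>V i\<close>. The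
    components of \<open>v\<close> can be chosen independently, so the bound on
    \<open>\<Phi> y v\<close> bounds the weighted arithmetic mean of these norms and with it their
    geometric mean; division by the norms then normalizes the \<open>y i\<close>.\<close>
  define n where "n i = (SUP v\<in>V i. \<integral>\<^sup>+x. ennreal (v x * y i x) \<partial>M)" for i
  obtain v\<^sub>0 where v0: "v\<^sub>0 \<in> VV" using VV_ne by auto
  have n_fin: "n i < top" if i: "i \<in> I" for i
  proof -
    have "(\<integral>\<^sup>+x. ennreal (v x * y i x) \<partial>M) \<le> ennreal (c' / \<theta> i)" if v: "v \<in> V i" for v
    proof -
      define w where "w = v\<^sub>0(i := v)"
      have w: "w \<in> VV" using v0 v by (auto simp: VV_def w_def)
      have "ennreal (\<theta> i) * (\<integral>\<^sup>+x. ennreal (w i x * y i x) \<partial>M) \<le> \<Phi> y w"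
        unfolding sum_eq[OF w] using i fin by (intro member_le_sum) auto
      also have "\<dots> \<le> ennreal c'" by (rule y(2)[OF w])
      finally have "ennreal (1 / \<theta> i) * (ennreal (\<theta> i) * (\<integral>\<^sup>+x. ennreal (v x * y i x) \<partial>M)) \<le> ennreal (1 / \<theta> i) * ennreal c'"
        by (intro mult_left_mono) (auto simp: w_def)
      moreover have "ennreal (1 / \<theta> i) * (ennreal (\<theta> i) * X) = X" for X
        using \<theta>_pos[OF i] by (simp add: mult.assoc[symmetric] flip: ennreal_mult)
      ultimately show ?thesis using \<theta>_pos[OF i] c' by (simp flip: ennreal_mult)
    qed
    then have "n i \<le> ennreal (c' / \<theta> i)" unfolding n_def by (rule SUP_least)
    then show ?thesis by (simp add: order_le_less_trans)
  qed
  define k where "k i = enn2real (n i) + \<delta>" for i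
  have k_pos: "0 < k i" for i using c' by (simp add: k_def add_nonneg_pos)
  have n_k: "n i = ennreal (enn2real (n i))" if "i \<in> I" for i using n_fin[OF that] by simp
  have "\<exists>v\<in>V i. ennreal (enn2real (n i) - \<delta>) \<le> (\<integral>\<^sup>+x. ennreal (v x * y i x) \<partial>M)" if i: "i \<in> I" for i
  proof (cases "n i = 0")
    case True
    then show ?thesis using V_ne[OF i] c' by (auto simp: ennreal_neg)
  next
    case False
    then have "0 < enn2real (n i)" using n_fin[OF i] by (simp add: enn2real_positive_iff zero_less_iff_neq_zero)
    then have "ennreal (enn2real (n i) - \<delta>) < n i"
      using c' by (subst n_k[OF i]) (rule ennreal_lessI, auto)
    then show ?thesis unfolding n_def less_SUP_iff by (auto intro: less_imp_le)
  qed
  then obtain v where v: "\<And>i. i \<in> I \<Longrightarrow> v i \<in> V i"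
    "\<And>i. i \<in> I \<Longrightarrow> ennreal (enn2real (n i) - \<delta>) \<le> (\<integral>\<^sup>+x. ennreal (v i x * y i x) \<partial>M)" by metis
  have vV: "v \<in> VV" using v by (simp add: VV_def)
  have "ennreal (\<Sum>i\<in>I. \<theta> i * max 0 (enn2real (n i) - \<delta>)) = (\<Sum>i\<in>I. ennreal (\<theta> i) * ennreal (enn2real (n i) - \<delta>))"
    using \<theta>_pos by (subst sum_ennreal[symmetric]) (auto intro!: sum.cong simp: less_imp_le ennreal_mult max_def ennreal_neg)
  also have "\<dots> \<le> \<Phi> y v"
    unfolding sum_eq[OF vV] by (intro sum_mono mult_left_mono v) auto
  also have "\<dots> \<le> ennreal c'" by (rule y(2)[OF vV])
  finally have "(\<Sum>i\<in>I. \<theta> i * max 0 (enn2real (n i) - \<delta>)) \<le> c'" using c' by simp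
  moreover have "(\<Sum>i\<in>I. \<theta> i * (k i - 2 * \<delta>)) \<le> (\<Sum>i\<in>I. \<theta> i * max 0 (enn2real (n i) - \<delta>))"
    using \<theta>_pos by (intro sum_mono mult_left_mono) (auto simp: k_def less_imp_le)
  moreover have "(\<Sum>i\<in>I. \<theta> i * (k i - 2 * \<delta>)) = (\<Sum>i\<in>I. \<theta> i * k i) - 2 * \<delta>"
    using \<theta>_sum by (simp add: right_diff_distrib sum_subtractf flip: sum_distrib_right)
  ultimately have "(\<Sum>i\<in>I. \<theta> i * k i) \<le> c" using c'(3) by linarith
  then have k_c: "(\<Prod>i\<in>I. k i powr \<theta> i) \<le> c"
    using weighted_arith_geom_mean[OF fin \<theta>_pos \<theta>_sum, of k] k_pos by fastforce
  define z where "z i x = y i x / k i" for i x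
  show ?thesis
  proof (rule that)
    fix i assume i: "i \<in> I"
    note [measurable] = K_measurable[OF y(1) i]
    have "(\<integral>\<^sup>+x. ennreal (v x * z i x) \<partial>M) \<le> 1" if v: "v \<in> V i" for v
    proof -
      have [measurable]: "v \<in> borel_measurable M" and v_nn: "\<And>x. 0 \<le> v x"
        using V_meas[OF i] v by (auto simp: nonneg_meas_def)
      have "(\<integral>\<^sup>+x. ennreal (v x * z i x) \<partial>M) = (\<integral>\<^sup>+x. ennreal (1 / k i) * ennreal (v x * y i x) \<partial>M)"
        using k_pos v_nn K_nn[OF y(1) i] by (intro nn_integral_cong) (simp add: z_def less_imp_le flip: ennreal_mult)
      also have "\<dots> = ennreal (1 / k i) * (\<integral>\<^sup>+x. ennreal (v x * y i x) \<partial>M)"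
        by (rule nn_integral_cmult) measurable
      also have "\<dots> \<le> ennreal (1 / k i) * n i"
        unfolding n_def using v by (intro mult_left_mono SUP_upper) auto
      also have "\<dots> \<le> ennreal (1 / k i) * ennreal (k i)"
        by (subst n_k[OF i], intro mult_left_mono ennreal_leI) (use c' in \<open>auto simp: k_def\<close>)
      also have "\<dots> = 1" using k_pos[of i] by (simp flip: ennreal_mult)
      finally show ?thesis .
    qed
    moreover have "z i \<in> nonneg_meas M"
      using K_nn[OF y(1) i] k_pos by (auto simp: nonneg_meas_def z_def[abs_def] less_imp_le)
    ultimately show "z i \<in> polar M (V i)" by (simp add: polar_def)
  next
    have "AE x in M. F x \<le> (\<Prod>i\<in>I. y i x powr \<theta> i)" using y by (simp add: K_def)
    then show "AE x in M. F x \<le> c * (\<Prod>i\<in>I. z i x powr \<theta> i)"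
    proof eventually_elim
      case (elim x)
      have "(\<Prod>i\<in>I. y i x powr \<theta> i) = (\<Prod>i\<in>I. k i powr \<theta> i * z i x powr \<theta> i)"
        using k_pos K_nn[OF y(1)] by (intro prod.cong) (simp_all add: z_def powr_divide less_imp_le order_less_imp_not_eq2)
      also have "\<dots> = (\<Prod>i\<in>I. k i powr \<theta> i) * (\<Prod>i\<in>I. z i x powr \<theta> i)"
        by (rule prod.distrib)
      also have "\<dots> \<le> c * (\<Prod>i\<in>I. z i x powr \<theta> i)"
        by (intro mult_right_mono k_c prod_nonneg) auto
      finally show ?case using elim by simp
    qed
  qed
qed

end

section \<open>Function spaces and their unit balls\<close>

text \<open>Says that the norm of \<open>X\<close> is the Minkowski functional of \<open>B\<close>
  and its carrier the set where this functional is finite, so \<open>B\<close> determines both.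
  Powers and duals of spaces can then be followed on the level of balls.\<close>

definition fs_ball :: "'a measure \<Rightarrow> ('a, 'k::{real_normed_field, euclidean_space}) fspace \<Rightarrow> ('a \<Rightarrow> real) set \<Rightarrow> bool" where
  "fs_ball M X B \<longleftrightarrow>
     (\<forall>f. f \<in> fs_carrier X \<longleftrightarrow> f \<in> L0 M \<and> (\<exists>c>0. (\<lambda>x. norm (f x) / c) \<in> B)) \<and>
     (\<forall>f\<in>fs_carrier X. 0 \<le> fs_norm X f \<and> (\<forall>c>0. fs_norm X f \<le> c \<longleftrightarrow> (\<lambda>x. norm (f x) / c) \<in> B))"

lemma L0_real: "f \<in> borel_measurable M \<Longrightarrow> (\<lambda>x. of_real (f x) :: 'k::{real_normed_field, euclidean_space}) \<in> L0 M"
  unfolding L0_def by measurable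

lemma L0_norm: "f \<in> L0 M \<Longrightarrow> (\<lambda>x. norm (f x)) \<in> nonneg_meas M"
  unfolding L0_def nonneg_meas_def by auto

lemma real_le_iff_pos:
  fixes a b :: real
  assumes "0 \<le> a" "0 \<le> b" "\<And>c. 0 < c \<Longrightarrow> a \<le> c \<longleftrightarrow> b \<le> c"
  shows "a = b"
  using assms by (metis dense_ge linorder_not_less order.strict_trans1 order_antisym order_le_less)

context
  fixes M :: "'a measure" and X :: "('a, 'k::{real_normed_field, euclidean_space}) fspace" and B
  assumes rel: "fs_ball M X B"
begin

lemma fs_ball_carrier: "f \<in> fs_carrier X \<longleftrightarrow> f \<in> L0 M \<and> (\<exists>c>0. (\<lambda>x. norm (f x) / c) \<in> B)"
  using rel unfolding fs_ball_def by blast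

lemma fs_ball_norm_nonneg: "f \<in> fs_carrier X \<Longrightarrow> 0 \<le> fs_norm X f"
  using rel unfolding fs_ball_def by blast

lemma fs_ball_norm_le: "f \<in> fs_carrier X \<Longrightarrow> 0 < c \<Longrightarrow> fs_norm X f \<le> c \<longleftrightarrow> (\<lambda>x. norm (f x) / c) \<in> B"
  using rel unfolding fs_ball_def by blast

lemma fs_ball_of_real:
  assumes "f \<in> nonneg_meas M"
  shows "(\<lambda>x. of_real (f x)) \<in> fs_carrier X \<longleftrightarrow> (\<exists>c>0. (\<lambda>x. f x / c) \<in> B)"
    and "0 < c \<Longrightarrow> (\<lambda>x. f x / c) \<in> B \<Longrightarrow> fs_norm X (\<lambda>x. of_real (f x)) \<le> c"
proof -
  have eq: "norm (of_real (f x) :: 'k) = f x" for x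
    using assms by (simp add: nonneg_meas_def)
  have L: "(\<lambda>x. of_real (f x) :: 'k) \<in> L0 M"
    using assms by (intro L0_real) (simp add: nonneg_meas_def)
  show *: "(\<lambda>x. of_real (f x)) \<in> fs_carrier X \<longleftrightarrow> (\<exists>c>0. (\<lambda>x. f x / c) \<in> B)"
    unfolding fs_ball_carrier eq using L by simp
  show "fs_norm X (\<lambda>x. of_real (f x)) \<le> c" if "0 < c" "(\<lambda>x. f x / c) \<in> B"
    using fs_ball_norm_le[of "\<lambda>x. of_real (f x)" c, unfolded eq] that * by blast
qed

lemma fs_ball_member:
  assumes "f \<in> nonneg_meas M" "f \<in> B"
  shows "(\<lambda>x. of_real (f x)) \<in> fs_carrier X" and "fs_norm X (\<lambda>x. of_real (f x)) \<le> 1"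
  using fs_ball_of_real[OF assms(1)] assms(2) by (auto intro!: exI[of _ "1::real"])

lemma fs_ball_scale:
  assumes f: "f \<in> fs_carrier X" and a: "0 < a"
  shows "(\<lambda>x. of_real a * f x) \<in> fs_carrier X" and "fs_norm X (\<lambda>x. of_real a * f x) = a * fs_norm X f"
proof -
  have eq: "norm (of_real a * f x) / c = norm (f x) / (c / a)" for x c
    using a by (simp add: norm_mult)
  obtain c where c: "0 < c" "(\<lambda>x. norm (f x) / c) \<in> B" and L: "f \<in> L0 M"
    using f unfolding fs_ball_carrier by auto
  have "(\<lambda>x. norm (of_real a * f x) / (a * c)) \<in> B"
    unfolding eq using a c by simp
  moreover have "(\<lambda>x. of_real a * f x) \<in> L0 M" using L unfolding L0_def by measurable
  ultimately show *: "(\<lambda>x. of_real a * f x) \<in> fs_carrier X"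
    unfolding fs_ball_carrier using a c by (intro conjI exI[of _ "a * c"]) auto
  show "fs_norm X (\<lambda>x. of_real a * f x) = a * fs_norm X f"
  proof (rule real_le_iff_pos)
    fix c :: real assume c: "0 < c"
    have "fs_norm X (\<lambda>x. of_real a * f x) \<le> c \<longleftrightarrow> fs_norm X f \<le> c / a"
      using fs_ball_norm_le[OF * c] fs_ball_norm_le[OF f, of "c / a"] a c unfolding eq by simp
    also have "\<dots> \<longleftrightarrow> a * fs_norm X f \<le> c" using a by (simp add: pos_le_divide_eq mult.commute)
    finally show "fs_norm X (\<lambda>x. of_real a * f x) \<le> c \<longleftrightarrow> a * fs_norm X f \<le> c" .
  qed (use a f * fs_ball_norm_nonneg in auto)
qed

end

definition power_ball :: "'a measure \<Rightarrow> ('a \<Rightarrow> real) set \<Rightarrow> real \<Rightarrow> ('a \<Rightarrow> real) set" where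
  "power_ball M B p = {f \<in> nonneg_meas M. (\<lambda>x. f x powr (1 / p)) \<in> B}"

lemma nonneg_meas_powr: "f \<in> nonneg_meas M \<Longrightarrow> (\<lambda>x. f x powr a) \<in> nonneg_meas M"
  unfolding nonneg_meas_def by auto

lemma (in solid_ball) solid_ball_power:
  assumes p: "0 < p"
  shows "solid_ball M (power_ball M B p)"
proof
  show "power_ball M B p \<subseteq> nonneg_meas M" by (auto simp: power_ball_def)
  show "(\<lambda>x. 0) \<in> power_ball M B p" using zero by (auto simp: power_ball_def nonneg_meas_def)
  show "g \<in> power_ball M B p"
    if f: "f \<in> power_ball M B p" and g: "g \<in> nonneg_meas M" and le: "AE x in M. g x \<le> f x" for f g
  proof -
    have "(\<lambda>x. g x powr (1 / p)) \<in> B"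
    proof (rule solid)
      show "(\<lambda>x. f x powr (1 / p)) \<in> B" using f by (simp add: power_ball_def)
      show "AE x in M. g x powr (1 / p) \<le> f x powr (1 / p)"
        using le by eventually_elim (use g p in \<open>auto simp: nonneg_meas_def intro: powr_mono2\<close>)
    qed (rule nonneg_meas_powr[OF g])
    with g show ?thesis by (simp add: power_ball_def)
  qed
  show "h \<in> power_ball M B p" if g: "\<And>n. g n \<in> power_ball M B p" and h: "h \<in> nonneg_meas M"
    and lim: "AE x in M. incseq (\<lambda>n. g n x) \<and> (\<lambda>n. g n x) \<longlonglongrightarrow> h x" for g h
  proof -
    have g0: "0 \<le> g n x" for n x using g[of n] by (simp add: power_ball_def nonneg_meas_def)
    have "(\<lambda>x. h x powr (1 / p)) \<in> B"
    proof (rule AE_limit)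
      show "(\<lambda>x. g n x powr (1 / p)) \<in> B" for n using g by (simp add: power_ball_def)
      show "AE x in M. (\<lambda>n. g n x powr (1 / p)) \<longlonglongrightarrow> h x powr (1 / p)"
        using lim by eventually_elim (use p g0 in \<open>auto intro!: tendsto_powr'\<close>)
    qed (rule nonneg_meas_powr[OF h])
    with h show ?thesis by (simp add: power_ball_def)
  qed
  show "emeasure M E = 0" if E: "E \<in> sets M"
    and c: "\<And>c. 0 < c \<Longrightarrow> (\<lambda>x. c * indicator E x) \<in> power_ball M B p" for E
  proof (rule bounded[OF E])
    fix c :: real assume c0: "0 < c"
    have "(\<lambda>x. (c powr p * indicator E x) powr (1 / p)) \<in> B"
      using c[of "c powr p"] c0 by (simp add: power_ball_def)
    also have "(\<lambda>x. (c powr p * indicator E x) powr (1 / p)) = (\<lambda>x. c * indicator E x)"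
      using c0 p by (auto simp: indicator_def powr_powr fun_eq_iff)
    finally show "(\<lambda>x. c * indicator E x) \<in> B" .
  qed
qed

lemma fs_ball_power:
  fixes X :: "('a, 'k::{real_normed_field, euclidean_space}) fspace"
  assumes rel: "fs_ball M X B" and p: "0 < p"
  shows "fs_ball M (fs_power M X p) (power_ball M B p)"
proof -
  let ?f = "\<lambda>f::'a \<Rightarrow> 'k. \<lambda>x. norm (f x) powr (1 / p)"
  have eq: "(\<lambda>x. norm (f x) / c) \<in> power_ball M B p \<longleftrightarrow> (\<lambda>x. ?f f x / c powr (1 / p)) \<in> B"
    if "f \<in> L0 M" "0 < c" for f :: "'a \<Rightarrow> 'k" and c
    using L0_norm[OF that(1)] that(2) by (simp add: power_ball_def powr_divide nonneg_meas_def)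
  have nm: "?f f \<in> nonneg_meas M" if "f \<in> L0 M" for f :: "'a \<Rightarrow> 'k"
    by (rule nonneg_meas_powr[OF L0_norm[OF that]])
  have ex: "(\<exists>c>0. (\<lambda>x. ?f f x / c) \<in> B) \<longleftrightarrow> (\<exists>c>0. (\<lambda>x. norm (f x) / c) \<in> power_ball M B p)"
    if f: "f \<in> L0 M" for f :: "'a \<Rightarrow> 'k"
  proof
    assume "\<exists>c>0. (\<lambda>x. ?f f x / c) \<in> B"
    then obtain c where c: "0 < c" "(\<lambda>x. ?f f x / c) \<in> B" by blast
    then have "(\<lambda>x. norm (f x) / c powr p) \<in> power_ball M B p"
      using p by (subst eq[OF f]) (auto simp: powr_powr)
    then show "\<exists>c>0. (\<lambda>x. norm (f x) / c) \<in> power_ball M B p" using c by (intro exI[of _ "c powr p"]) simp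
  next
    assume "\<exists>c>0. (\<lambda>x. norm (f x) / c) \<in> power_ball M B p"
    then obtain c where "0 < c" "(\<lambda>x. norm (f x) / c) \<in> power_ball M B p" by blast
    then show "\<exists>c>0. (\<lambda>x. ?f f x / c) \<in> B" by (intro exI[of _ "c powr (1 / p)"]) (simp add: eq[OF f])
  qed
  have car: "f \<in> fs_carrier (fs_power M X p) \<longleftrightarrow> f \<in> L0 M \<and> (\<exists>c>0. (\<lambda>x. norm (f x) / c) \<in> power_ball M B p)" for f
    using fs_ball_of_real(1)[OF rel nm] ex by (auto simp: fs_power_def)
  moreover have "0 \<le> fs_norm (fs_power M X p) f \<and>
      (\<forall>c>0. fs_norm (fs_power M X p) f \<le> c \<longleftrightarrow> (\<lambda>x. norm (f x) / c) \<in> power_ball M B p)"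
    if f: "f \<in> fs_carrier (fs_power M X p)" for f
  proof (intro conjI allI impI)
    have fX: "(\<lambda>x. of_real (?f f x)) \<in> fs_carrier X" and fL: "f \<in> L0 M" using f by (auto simp: fs_power_def)
    have nn: "0 \<le> fs_norm X (\<lambda>x. of_real (?f f x))" by (rule fs_ball_norm_nonneg[OF rel fX])
    show "0 \<le> fs_norm (fs_power M X p) f" by (simp add: fs_power_def)
    fix c :: real assume c: "0 < c"
    have "fs_norm (fs_power M X p) f \<le> c \<longleftrightarrow> fs_norm X (\<lambda>x. of_real (?f f x)) powr p \<le> (c powr (1 / p)) powr p"
      using c p by (simp add: fs_power_def powr_powr)
    also have "\<dots> \<longleftrightarrow> fs_norm X (\<lambda>x. of_real (?f f x)) \<le> c powr (1 / p)"
      using nn p by (meson linorder_not_less powr_ge_zero powr_less_mono2 powr_mono2 less_imp_le)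
    also have "\<dots> \<longleftrightarrow> (\<lambda>x. norm (f x) / c) \<in> power_ball M B p"
      using fs_ball_norm_le[OF rel fX, of "c powr (1 / p)"] c by (simp add: eq[OF fL])
    finally show "fs_norm (fs_power M X p) f \<le> c \<longleftrightarrow> (\<lambda>x. norm (f x) / c) \<in> power_ball M B p" .
  qed
  ultimately show ?thesis unfolding fs_ball_def by blast
qed

text \<open>Every \<open>g\<close> in the dual is a bounded functional: otherwise a series of \<open>f\<^sub>n\<close> in the ball with
  $\int f_n |g| > 4^n$ would give an \<open>f\<close> in the space with $\int f |g| = \infty$.\<close>

lemma (in function_ball) fs_ball_kothe_dual:
  fixes X :: "('a, 'k::{real_normed_field, euclidean_space}) fspace"
  assumes rel: "fs_ball M X B" and f0: "f\<^sub>0 \<in> B" "\<not> (AE x in M. f\<^sub>0 x = 0)"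
  shows "fs_ball M (kothe_dual M X) (polar M B)"
proof -
  let ?X' = "kothe_dual M X"
  have int_le: "integrable M (\<lambda>x. f x * g x) \<and> (LINT x|M. norm (f x * g x)) \<le> d * c"
    if f: "f \<in> L0 M" "(\<lambda>x. norm (f x) / d) \<in> B" "0 < d"
      and g: "g \<in> L0 M" "(\<lambda>x. norm (g x) / c) \<in> polar M B" "0 < c" for f g :: "'a \<Rightarrow> 'k" and c d
  proof -
    have [measurable]: "f \<in> borel_measurable M" "g \<in> borel_measurable M" using f g by (auto simp: L0_def)
    have "(\<integral>\<^sup>+x. ennreal (norm (f x * g x)) \<partial>M)
        = (\<integral>\<^sup>+x. ennreal (d * c) * ennreal (norm (f x) / d * (norm (g x) / c)) \<partial>M)"
      using f(3) g(3) by (intro nn_integral_cong) (simp add: norm_mult flip: ennreal_mult)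
    also have "\<dots> = ennreal (d * c) * (\<integral>\<^sup>+x. ennreal (norm (f x) / d * (norm (g x) / c)) \<partial>M)"
      by (rule nn_integral_cmult) measurable
    also have "\<dots> \<le> ennreal (d * c) * 1"
      by (intro mult_left_mono polarD(2)[OF g(2) f(2)]) simp
    finally have le: "(\<integral>\<^sup>+x. ennreal (norm (f x * g x)) \<partial>M) \<le> ennreal (d * c)" by simp
    then have int: "integrable M (\<lambda>x. f x * g x)"
      by (intro integrableI_bounded) (auto simp: order_le_less_trans)
    then have "(\<integral>\<^sup>+x. ennreal (norm (f x * g x)) \<partial>M) = ennreal (LINT x|M. norm (f x * g x))"
      by (intro nn_integral_eq_integral) auto
    with le int show ?thesis using f(3) g(3) by simp
  qed
  have car: "g \<in> fs_carrier ?X' \<longleftrightarrow> g \<in> L0 M \<and> (\<exists>c>0. (\<lambda>x. norm (g x) / c) \<in> polar M B)" for g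
  proof
    assume g: "g \<in> L0 M \<and> (\<exists>c>0. (\<lambda>x. norm (g x) / c) \<in> polar M B)"
    then show "g \<in> fs_carrier ?X'"
      using int_le unfolding kothe_dual_def by (auto simp: fs_ball_carrier[OF rel])
  next
    assume g: "g \<in> fs_carrier ?X'"
    then have gL: "g \<in> L0 M" by (simp add: kothe_dual_def)
    then have [measurable]: "g \<in> borel_measurable M" by (simp add: L0_def)
    have "\<exists>c>0. (\<lambda>x. norm (g x) / c) \<in> polar M B"
    proof (rule ccontr)
      assume no: "\<not> ?thesis"
      have "\<exists>f\<in>B. ennreal (4 ^ n) \<le> (\<integral>\<^sup>+x. ennreal (f x * norm (g x)) \<partial>M)" for n :: nat
      proof -
        have "(\<lambda>x. norm (g x) / 4 ^ n) \<notin> polar M B" using no by auto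
        moreover have "(\<lambda>x. norm (g x) / 4 ^ n) \<in> nonneg_meas M" by (auto simp: nonneg_meas_def)
        ultimately obtain f where f: "f \<in> B" "1 < (\<integral>\<^sup>+x. ennreal (f x * (norm (g x) / 4 ^ n)) \<partial>M)"
          by (auto simp: polar_def not_le)
        note [measurable] = measurable[OF f(1)]
        have "ennreal (4 ^ n) * 1 \<le> ennreal (4 ^ n) * (\<integral>\<^sup>+x. ennreal (f x * (norm (g x) / 4 ^ n)) \<partial>M)"
          using f(2) by (intro mult_left_mono) auto
        also have "\<dots> = (\<integral>\<^sup>+x. ennreal (4 ^ n) * ennreal (f x * (norm (g x) / 4 ^ n)) \<partial>M)"
          by (rule nn_integral_cmult[symmetric]) measurable
        also have "\<dots> = (\<integral>\<^sup>+x. ennreal (f x * norm (g x)) \<partial>M)"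
          using nonneg[OF f(1)] by (intro nn_integral_cong) (simp flip: ennreal_mult)
        finally show ?thesis using f(1) by auto
      qed
      then obtain f where fB: "\<And>n. f n \<in> B"
        and big: "\<And>n. ennreal (4 ^ n) \<le> (\<integral>\<^sup>+x. ennreal (f n x * norm (g x)) \<partial>M)" by metis
      define S where "S x = (\<Sum>n. ennreal (f n x / 2 ^ Suc n))" for x
      have S_fin: "AE x in M. S x < \<infinity>" and SB: "(\<lambda>x. enn2real (S x)) \<in> B"
        using series[of f, OF fB] by (auto simp: S_def)
      note [measurable] = measurable[OF SB] measurable[OF fB]
      have SX: "(\<lambda>x. of_real (enn2real (S x))) \<in> fs_carrier X"
        by (rule fs_ball_member(1)[OF rel subsetD[OF nonneg_meas SB] SB])
      then have "integrable M (\<lambda>x. of_real (enn2real (S x)) * g x)"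
        using g by (simp add: kothe_dual_def)
      then have "(\<integral>\<^sup>+x. ennreal (norm (of_real (enn2real (S x)) * g x)) \<partial>M) < \<infinity>"
        by (simp add: integrable_iff_bounded)
      then obtain J where J: "0 \<le> J" "(\<integral>\<^sup>+x. ennreal (enn2real (S x) * norm (g x)) \<partial>M) = ennreal J"
        by (cases "\<integral>\<^sup>+x. ennreal (enn2real (S x) * norm (g x)) \<partial>M") (auto simp: norm_mult)
      have "2 ^ n / 2 \<le> J" for n :: nat
      proof -
        have "ennreal (4 ^ n) \<le> (\<integral>\<^sup>+x. ennreal (f n x * norm (g x)) \<partial>M)" by (rule big)
        also have "\<dots> \<le> (\<integral>\<^sup>+x. ennreal (2 ^ Suc n) * ennreal (enn2real (S x) * norm (g x)) \<partial>M)"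
        proof (rule nn_integral_mono_AE, use S_fin in eventually_elim)
          case (elim x)
          have "ennreal (f n x / 2 ^ Suc n) \<le> S x"
            unfolding S_def using sum_le_suminf[of "\<lambda>n. ennreal (f n x / 2 ^ Suc n)" "{n}"] by simp
          then have "enn2real (ennreal (f n x / 2 ^ Suc n)) \<le> enn2real (S x)"
            using elim by (intro enn2real_mono) auto
          then have "f n x \<le> 2 ^ Suc n * enn2real (S x)"
            using nonneg[OF fB, of n x] by (simp add: field_simps)
          then have "f n x * norm (g x) \<le> 2 ^ Suc n * enn2real (S x) * norm (g x)"
            by (intro mult_right_mono) auto
          then show ?case by (simp add: mult.assoc ennreal_leI flip: ennreal_mult)
        qed
        also have "\<dots> = ennreal (2 ^ Suc n) * ennreal J"
          by (subst nn_integral_cmult) (auto simp: J(2))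
        also have "\<dots> = ennreal (2 ^ Suc n * J)" using J by (simp add: ennreal_mult)
        finally have "(4::real) ^ n \<le> 2 ^ Suc n * J" using J(1) by (subst (asm) ennreal_le_iff) auto
        moreover have "(4::real) ^ n = 2 ^ n * 2 ^ n" by (simp flip: power_mult_distrib)
        ultimately have "(2::real) ^ n * (2 ^ n / 2) \<le> 2 ^ n * J" by simp
        then show ?thesis by (subst (asm) mult_le_cancel_left_pos) auto
      qed
      moreover obtain n :: nat where "2 * J < 2 ^ n" using real_arch_pow[of 2] by auto
      ultimately show False by (smt (verit) field_sum_of_halves)
    qed
    with gL show "g \<in> L0 M \<and> (\<exists>c>0. (\<lambda>x. norm (g x) / c) \<in> polar M B)" by blast
  qed
  have f0X: "(\<lambda>x. of_real (f\<^sub>0 x)) \<in> fs_carrier X"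
    by (rule fs_ball_member(1)[OF rel subsetD[OF nonneg_meas f0(1)] f0(1)])
  have pos_norm: "0 < fs_norm X f" if f: "f \<in> fs_carrier X" "\<not> (AE x in M. f x = 0)" for f
  proof (rule ccontr)
    assume "\<not> 0 < fs_norm X f"
    then have "fs_norm X f \<le> c" if "0 < c" for c using that by linarith
    then have "AE x in M. norm (f x) = 0"
      using f fs_ball_norm_le[OF rel f(1)] by (intro AE_zero L0_norm) (auto simp: fs_ball_carrier[OF rel])
    with f(2) show False by simp
  qed
  have normalize: "(\<lambda>x. of_real (1 / fs_norm X f) * f x) \<in> {f \<in> fs_carrier X. fs_norm X f = 1}"
    if f: "f \<in> fs_carrier X" "0 < fs_norm X f" for f
    using fs_ball_scale[OF rel f(1), of "1 / fs_norm X f"] f(2) by simp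
  \<comment> \<open>The dual norm is a real supremum over this set, hence meaningful only if the set
    is nonempty; normalizing \<open>f\<^sub>0\<close> provides an element.\<close>
  have ne: "{f \<in> fs_carrier X. fs_norm X f = 1} \<noteq> {}"
    using normalize[OF f0X pos_norm[OF f0X]] f0(2) by auto
  have norm1: "(\<lambda>x. norm (f x) / 1) \<in> B" "f \<in> L0 M" if "f \<in> {f \<in> fs_carrier X. fs_norm X f = 1}" for f
    using that fs_ball_norm_le[OF rel, of f 1] fs_ball_carrier[OF rel, of f] by auto
  have "0 \<le> fs_norm ?X' g \<and> (\<forall>c>0. fs_norm ?X' g \<le> c \<longleftrightarrow> (\<lambda>x. norm (g x) / c) \<in> polar M B)"
    if g: "g \<in> fs_carrier ?X'" for g
  proof -
    let ?I = "\<lambda>f. LINT x|M. norm (f x * g x)"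
    have gL: "g \<in> L0 M" and "\<exists>c>0. (\<lambda>x. norm (g x) / c) \<in> polar M B" using g unfolding car by auto
    then obtain c' where c': "0 < c'" "(\<lambda>x. norm (g x) / c') \<in> polar M B" by blast
    have [measurable]: "g \<in> borel_measurable M" using gL by (simp add: L0_def)
    have N: "fs_norm ?X' g = (SUP f\<in>{f \<in> fs_carrier X. fs_norm X f = 1}. ?I f)" by (simp add: kothe_dual_def)
    have I_le: "?I f \<le> c" if "f \<in> {f \<in> fs_carrier X. fs_norm X f = 1}" "0 < c" "(\<lambda>x. norm (g x) / c) \<in> polar M B" for f c
      using int_le[OF norm1(2)[OF that(1)] norm1(1)[OF that(1)] _ gL that(3,2)] by simp
    have bdd: "bdd_above (?I ` {f \<in> fs_carrier X. fs_norm X f = 1})"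
      using I_le c' by (intro bdd_aboveI2[where M=c']) auto
    have up: "?I f \<le> fs_norm ?X' g" if "f \<in> {f \<in> fs_carrier X. fs_norm X f = 1}" for f
      unfolding N by (rule cSUP_upper[OF that bdd])
    obtain f\<^sub>1 where "f\<^sub>1 \<in> {f \<in> fs_carrier X. fs_norm X f = 1}" using ne by blast
    then have "?I f\<^sub>1 \<le> fs_norm ?X' g" by (rule up)
    moreover have "0 \<le> ?I f\<^sub>1" by (rule Bochner_Integration.integral_nonneg) simp
    ultimately have "0 \<le> fs_norm ?X' g" by linarith
    moreover have "fs_norm ?X' g \<le> c \<longleftrightarrow> (\<lambda>x. norm (g x) / c) \<in> polar M B" if c: "0 < c" for c
    proof
      assume "(\<lambda>x. norm (g x) / c) \<in> polar M B"
      then show "fs_norm ?X' g \<le> c" unfolding N using I_le c by (intro cSUP_least[OF ne]) auto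
    next
      assume le: "fs_norm ?X' g \<le> c"
      have "(\<integral>\<^sup>+x. ennreal (f x * (norm (g x) / c)) \<partial>M) \<le> 1" if f: "f \<in> B" for f
      proof (cases "AE x in M. f x = 0")
        case True
        then have "(\<integral>\<^sup>+x. ennreal (f x * (norm (g x) / c)) \<partial>M) = (\<integral>\<^sup>+x. 0 \<partial>M)"
          by (intro nn_integral_cong_AE) auto
        then show ?thesis by simp
      next
        case False
        note [measurable] = measurable[OF f]
        have fN: "f \<in> nonneg_meas M" using f nonneg_meas by auto
        let ?f = "\<lambda>x. of_real (f x) :: 'k"
        have fX: "?f \<in> fs_carrier X"
          by (rule fs_ball_member(1)[OF rel fN f])
        have pos: "0 < fs_norm X ?f" using False by (intro pos_norm[OF fX]) simp
        have le1: "fs_norm X ?f \<le> 1" by (rule fs_ball_member(2)[OF rel fN f])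
        have "?I (\<lambda>x. of_real (1 / fs_norm X ?f) * ?f x) \<le> c"
          using up[OF normalize[OF fX pos]] le by linarith
        moreover have "?I (\<lambda>x. of_real (1 / fs_norm X ?f) * ?f x) = ?I ?f / fs_norm X ?f"
          using pos by (simp add: norm_mult norm_divide)
        ultimately have "?I ?f \<le> c * fs_norm X ?f" using pos by (simp add: pos_divide_le_eq)
        also have "\<dots> \<le> c" using le1 c pos by (simp add: mult_left_le)
        finally have Ic: "?I ?f \<le> c" .
        have "integrable M (\<lambda>x. ?f x * g x)" using g fX by (simp add: kothe_dual_def)
        then have "integrable M (\<lambda>x. norm (?f x * g x) / c)" by (intro integrable_divide integrable_norm) auto
        then have "integrable M (\<lambda>x. f x * (norm (g x) / c))"
          using nonneg[OF f] by (simp add: norm_mult)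
        then have "(\<integral>\<^sup>+x. ennreal (f x * (norm (g x) / c)) \<partial>M) = ennreal (LINT x|M. f x * (norm (g x) / c))"
          using nonneg[OF f] c by (intro nn_integral_eq_integral) auto
        also have "(LINT x|M. f x * (norm (g x) / c)) = ?I ?f / c"
          using nonneg[OF f] by (simp add: norm_mult)
        also have "ennreal (?I ?f / c) \<le> 1" using Ic c by (simp flip: ennreal_1)
        finally show ?thesis .
      qed
      moreover have "(\<lambda>x. norm (g x) / c) \<in> nonneg_meas M" using c by (auto simp: nonneg_meas_def)
      ultimately show "(\<lambda>x. norm (g x) / c) \<in> polar M B" by (simp add: polar_def)
    qed
    ultimately show ?thesis by blast
  qed
  with car show ?thesis unfolding fs_ball_def by blast
qed

lemma rcp_ennreal: "0 < S \<Longrightarrow> rcp (ennreal S) = 1 / S"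
  by (simp add: rcp_def divide_ennreal flip: ennreal_1)

lemma rcp_top [simp]: "rcp top = 0"
  by (simp add: rcp_def)

lemma rcp_nonneg: "0 \<le> rcp s"
  by (simp add: rcp_def)

lemma pow0_nonneg: "0 \<le> pow0 x a"
  by (simp add: pow0_def)

lemma weighted_young:
  assumes "0 \<le> u" "0 \<le> v" "0 \<le> a" "0 \<le> b" "a + b = (1::real)"
  shows "pow0 u a * pow0 v b \<le> a * u + b * v"
proof -
  consider "a = 0" | "b = 0" | "a \<noteq> 0" "b \<noteq> 0" "u = 0 \<or> v = 0" | "a \<noteq> 0" "b \<noteq> 0" "0 < u" "0 < v"
    using assms(1,2) by fastforce
  then show ?thesis
    by cases (use assms Youngs_inequality_0[of a b u v] in \<open>auto simp: pow0_def\<close>)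
qed

section \<open>Unit balls of quasi-Banach function spaces\<close>

definition unit_ball :: "'a measure \<Rightarrow> ('a, 'k::{real_normed_field, euclidean_space}) fspace \<Rightarrow> ('a \<Rightarrow> real) set" where
  "unit_ball M X = {f \<in> nonneg_meas M. (\<lambda>x. of_real (f x)) \<in> fs_carrier X \<and> fs_norm X (\<lambda>x. of_real (f x)) \<le> 1}"

context
  fixes M :: "'a measure" and X :: "('a, 'k::{real_normed_field, euclidean_space}) fspace"
  assumes BFS: "quasi_BFS M X"
begin

lemma qbfs_ideal:
  assumes "f \<in> fs_carrier X" "g \<in> L0 M" "AE x in M. norm (g x) \<le> norm (f x)"
  shows "g \<in> fs_carrier X" "fs_norm X g \<le> fs_norm X f"
  using BFS assms unfolding quasi_BFS_def ideal_property_def by blast+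

lemma qbfs_L0: "f \<in> fs_carrier X \<Longrightarrow> f \<in> L0 M"
  using BFS unfolding quasi_BFS_def quasi_normed_def by blast

lemma qbfs_norm_nonneg: "f \<in> fs_carrier X \<Longrightarrow> 0 \<le> fs_norm X f"
  using BFS unfolding quasi_BFS_def quasi_normed_def by blast

lemma qbfs_norm_zero: "f \<in> fs_carrier X \<Longrightarrow> fs_norm X f = 0 \<longleftrightarrow> (AE x in M. f x = 0)"
  using BFS unfolding quasi_BFS_def quasi_normed_def by blast

lemma qbfs_scale:
  "f \<in> fs_carrier X \<Longrightarrow> (\<lambda>x. c * f x) \<in> fs_carrier X"
  "f \<in> fs_carrier X \<Longrightarrow> fs_norm X (\<lambda>x. c * f x) = norm c * fs_norm X f"
  using BFS unfolding quasi_BFS_def quasi_normed_def by blast+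

lemma qbfs_add: "f \<in> fs_carrier X \<Longrightarrow> g \<in> fs_carrier X \<Longrightarrow> (\<lambda>x. f x + g x) \<in> fs_carrier X"
  using BFS unfolding quasi_BFS_def quasi_normed_def by blast

lemma qbfs_norm_cong:
  assumes f: "f \<in> fs_carrier X" and g: "g \<in> L0 M" and eq: "AE x in M. norm (g x) = norm (f x)"
  shows "g \<in> fs_carrier X" "fs_norm X g = fs_norm X f"
proof -
  show *: "g \<in> fs_carrier X" by (rule qbfs_ideal(1)[OF f g]) (use eq in \<open>auto elim!: eventually_mono\<close>)
  have "fs_norm X g \<le> fs_norm X f" by (rule qbfs_ideal(2)[OF f g]) (use eq in \<open>auto elim!: eventually_mono\<close>)
  moreover have "fs_norm X f \<le> fs_norm X g"
    by (rule qbfs_ideal(2)[OF * qbfs_L0[OF f]]) (use eq in \<open>auto elim!: eventually_mono\<close>)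
  ultimately show "fs_norm X g = fs_norm X f" by simp
qed

lemma qbfs_scale_real:
  assumes "(\<lambda>x. of_real (f x)) \<in> fs_carrier X" "0 \<le> c"
  shows "(\<lambda>x. of_real (c * f x)) \<in> fs_carrier X"
    "fs_norm X (\<lambda>x. of_real (c * f x)) = c * fs_norm X (\<lambda>x. of_real (f x))"
  using qbfs_scale[OF assms(1), of "of_real c"] assms(2) by simp_all

lemma qbfs_ideal_real:
  assumes f: "(\<lambda>x. of_real (f x)) \<in> fs_carrier X" "f \<in> nonneg_meas M"
    and g: "g \<in> nonneg_meas M" "AE x in M. g x \<le> f x"
  shows "(\<lambda>x. of_real (g x)) \<in> fs_carrier X"
    "fs_norm X (\<lambda>x. of_real (g x)) \<le> fs_norm X (\<lambda>x. of_real (f x))"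
proof -
  have "AE x in M. norm (of_real (g x) :: 'k) \<le> norm (of_real (f x) :: 'k)"
    using g(2) by eventually_elim (use g(1) f(2) in \<open>auto simp: nonneg_meas_def\<close>)
  from qbfs_ideal[OF f(1) L0_real[OF nonneg_measD(1)[OF g(1)]] this]
  show "(\<lambda>x. of_real (g x)) \<in> fs_carrier X"
    "fs_norm X (\<lambda>x. of_real (g x)) \<le> fs_norm X (\<lambda>x. of_real (f x))" by blast+
qed

lemma solid_ball_unit_ball: "solid_ball M (unit_ball M X)"
proof
  show "unit_ball M X \<subseteq> nonneg_meas M" by (auto simp: unit_ball_def)
  have "(\<lambda>x. of_real 0) \<in> fs_carrier X"
    using BFS unfolding quasi_BFS_def quasi_normed_def by simp
  then show "(\<lambda>x. 0) \<in> unit_ball M X"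
    using qbfs_norm_zero[of "\<lambda>x. 0"] by (auto simp: unit_ball_def nonneg_meas_def)
  show "g \<in> unit_ball M X"
    if "f \<in> unit_ball M X" "g \<in> nonneg_meas M" "AE x in M. g x \<le> f x" for f g
    using that qbfs_ideal_real[of f g] by (auto simp: unit_ball_def)
  show "h \<in> unit_ball M X" if g: "\<And>n. g n \<in> unit_ball M X" and h: "h \<in> nonneg_meas M"
    and lim: "AE x in M. incseq (\<lambda>n. g n x) \<and> (\<lambda>n. g n x) \<longlonglongrightarrow> h x" for g h
  proof -
    have "(\<forall>n. (\<lambda>x. of_real (g n x)) \<in> fs_carrier X)" using g by (simp add: unit_ball_def)
    moreover have "h \<in> borel_measurable M" using h by (simp add: nonneg_meas_def)
    moreover have "AE x in M. (\<forall>n. 0 \<le> g n x) \<and> incseq (\<lambda>n. g n x) \<and> (\<lambda>n. g n x) \<longlonglongrightarrow> h x"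
      using lim by eventually_elim (use g in \<open>auto simp: unit_ball_def nonneg_meas_def\<close>)
    moreover have "bdd_above (range (\<lambda>n. fs_norm X (\<lambda>x. of_real (g n x))))"
      using g by (intro bdd_aboveI2[where M=1]) (simp add: unit_ball_def)
    ultimately have "(\<lambda>x. of_real (h x)) \<in> fs_carrier X \<and>
        fs_norm X (\<lambda>x. of_real (h x)) = (SUP n. fs_norm X (\<lambda>x. of_real (g n x)))"
      using BFS unfolding quasi_BFS_def fatou_property_def by blast
    moreover have "(SUP n. fs_norm X (\<lambda>x. of_real (g n x))) \<le> 1"
      using g by (intro cSUP_least) (auto simp: unit_ball_def)
    ultimately show ?thesis using h by (simp add: unit_ball_def)
  qed
  show "emeasure M E = 0" if E[measurable]: "E \<in> sets M"
    and c: "\<And>c. 0 < c \<Longrightarrow> (\<lambda>x. c * indicator E x) \<in> unit_ball M X" for E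
  proof -
    let ?e = "\<lambda>x. of_real (indicator E x) :: 'k"
    have eX: "?e \<in> fs_carrier X" using c[of 1] by (simp add: unit_ball_def)
    have "fs_norm X ?e \<le> 1 / c" if "0 < c" for c
      using c[OF that] qbfs_scale_real(2)[OF eX, of c] that by (simp add: unit_ball_def field_simps)
    from this[of "1 / d" for d] have "fs_norm X ?e \<le> 0 + d" if "0 < d" for d using that by simp
    then have "fs_norm X ?e \<le> 0" by (rule field_le_epsilon)
    then have "fs_norm X ?e = 0" using qbfs_norm_nonneg[OF eX] by simp
    then have "AE x in M. ?e x = 0" using qbfs_norm_zero[OF eX] by simp
    then have "AE x in M. x \<notin> E" by eventually_elim (auto simp: indicator_def split: if_splits)
    then show ?thesis by (subst (asm) AE_iff_measurable[where N=E]) (auto dest: sets.sets_into_space[OF E, THEN subsetD])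
  qed
qed

lemma fs_ball_unit_ball: "fs_ball M X (unit_ball M X)"
proof -
  let ?n = "\<lambda>f x. of_real (norm (f x :: 'k)) :: 'k"
  have nX: "?n f \<in> fs_carrier X" "fs_norm X (?n f) = fs_norm X f" if f: "f \<in> fs_carrier X" for f
    using qbfs_norm_cong[OF f L0_real[OF nonneg_measD(1)[OF L0_norm[OF qbfs_L0[OF f]]]]] by simp_all
  have mem: "(\<lambda>x. norm (f x) / c) \<in> unit_ball M X \<longleftrightarrow> fs_norm X f \<le> c" if f: "f \<in> fs_carrier X" and c: "0 < c" for f c
  proof -
    have "(\<lambda>x. norm (f x) / c) \<in> nonneg_meas M"
      using L0_norm[OF qbfs_L0[OF f]] c by (auto simp: nonneg_meas_def)
    moreover have "(\<lambda>x. of_real (norm (f x) / c)) \<in> fs_carrier X"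
      and "fs_norm X (\<lambda>x. of_real (norm (f x) / c)) = fs_norm X f / c"
      using qbfs_scale_real[OF nX(1)[OF f], of "1 / c"] c by (simp_all add: nX(2)[OF f])
    ultimately show ?thesis
      using c unfolding unit_ball_def by (simp only: mem_Collect_eq simp_thms pos_divide_le_eq mult_1)
  qed
  have "f \<in> fs_carrier X \<longleftrightarrow> f \<in> L0 M \<and> (\<exists>c>0. (\<lambda>x. norm (f x) / c) \<in> unit_ball M X)" for f
  proof
    assume f: "f \<in> fs_carrier X"
    have "0 < fs_norm X f + 1" using qbfs_norm_nonneg[OF f] by simp
    with mem[OF f this] qbfs_L0[OF f] show "f \<in> L0 M \<and> (\<exists>c>0. (\<lambda>x. norm (f x) / c) \<in> unit_ball M X)" by auto
  next
    assume "f \<in> L0 M \<and> (\<exists>c>0. (\<lambda>x. norm (f x) / c) \<in> unit_ball M X)"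
    then obtain c where f: "f \<in> L0 M" and c: "0 < c" "(\<lambda>x. norm (f x) / c) \<in> unit_ball M X" by blast
    have "?n f \<in> fs_carrier X"
      using qbfs_scale_real(1)[of "\<lambda>x. norm (f x) / c" c] c by (simp add: unit_ball_def)
    then show "f \<in> fs_carrier X" using qbfs_norm_cong(1)[of "?n f" f] f by simp
  qed
  then show ?thesis
    unfolding fs_ball_def by (intro conjI allI ballI impI) (simp_all only: mem qbfs_norm_nonneg)
qed

text \<open>\<open>a * F x + (1 - a) * G x\<close> is the sum of the \<open>r\<close>-th powers of
  \<open>a powr (1 / r) * f x\<close> and \<open>(1 - a) powr (1 / r) * g x\<close>, so
  \<open>r\<close>-convexity with constant 1 is exactly convexity of the ball of $X^r$.\<close>

lemma function_ball_power_convex: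
  assumes r: "0 < r" and conv: "p_convex (ennreal r) X"
  shows "function_ball M (power_ball M (unit_ball M X) r)"
proof -
  interpret B: solid_ball M "unit_ball M X" by (rule solid_ball_unit_ball)
  interpret P: solid_ball M "power_ball M (unit_ball M X) r" by (rule B.solid_ball_power[OF r])
  show ?thesis
  proof
    fix F G a assume F: "F \<in> power_ball M (unit_ball M X) r" and G: "G \<in> power_ball M (unit_ball M X) r"
      and a: "0 \<le> a" "a \<le> (1::real)"
    define H where "H x = a * F x + (1 - a) * G x" for x
    define f where "f x = F x powr (1 / r)" for x
    define g where "g x = G x powr (1 / r)" for x
    define h where "h x = H x powr (1 / r)" for x
    have f: "f \<in> unit_ball M X" and g: "g \<in> unit_ball M X"
      using F G by (auto simp: power_ball_def f_def[abs_def] g_def[abs_def])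
    have F0: "0 \<le> F x" and G0: "0 \<le> G x" for x using P.nonneg F G by auto
    have H: "H \<in> nonneg_meas M"
      using P.measurable[OF F] P.measurable[OF G] F0 G0 a unfolding H_def[abs_def] by (auto simp: nonneg_meas_def)
    then have hN: "h \<in> nonneg_meas M" unfolding h_def[abs_def] by (rule nonneg_meas_powr)
    have fX: "(\<lambda>x. of_real (f x)) \<in> fs_carrier X" "fs_norm X (\<lambda>x. of_real (f x)) \<le> 1"
      and gX: "(\<lambda>x. of_real (g x)) \<in> fs_carrier X" "fs_norm X (\<lambda>x. of_real (g x)) \<le> 1"
      using f g by (auto simp: unit_ball_def)
    have f0: "0 \<le> f x" and g0: "0 \<le> g x" for x by (auto simp: f_def g_def)
    define u where "u x = a powr (1 / r) * f x" for x
    define v where "v x = (1 - a) powr (1 / r) * g x" for x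
    have uX: "(\<lambda>x. of_real (u x)) \<in> fs_carrier X" "fs_norm X (\<lambda>x. of_real (u x)) = a powr (1 / r) * fs_norm X (\<lambda>x. of_real (f x))"
      unfolding u_def using qbfs_scale_real[OF fX(1), of "a powr (1 / r)"] by auto
    have vX: "(\<lambda>x. of_real (v x)) \<in> fs_carrier X" "fs_norm X (\<lambda>x. of_real (v x)) = (1 - a) powr (1 / r) * fs_norm X (\<lambda>x. of_real (g x))"
      unfolding v_def using qbfs_scale_real[OF gX(1), of "(1 - a) powr (1 / r)"] by auto
    have pw: "(b powr (1 / r) * t) powr r = b * t powr r" if "0 \<le> b" "0 \<le> t" for b t :: real
      using that r by (simp add: powr_mult powr_powr)
    have norm_uv: "norm (of_real (u x) :: 'k) = u x" "norm (of_real (v x) :: 'k) = v x" for x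
      unfolding norm_of_real by (auto simp: u_def v_def f0 g0)
    have h_eq: "lsum (ennreal r) (norm (of_real (u x) :: 'k)) (norm (of_real (v x) :: 'k)) = h x" for x
      unfolding norm_uv using r a F0 G0
      by (simp add: lsum_def u_def v_def h_def H_def pw f_def g_def powr_powr)
    \<comment> \<open>\<open>p_convex\<close> bounds the norm but does not assert membership, which
      follows from \<open>h \<le> f + g\<close> and the ideal property.\<close>
    have hX: "(\<lambda>x. of_real (h x)) \<in> fs_carrier X"
    proof (rule qbfs_ideal_real(1)[OF _ _ hN])
      show "(\<lambda>x. of_real (f x + g x)) \<in> fs_carrier X" using qbfs_add[OF fX(1) gX(1)] by simp
      show "(\<lambda>x. f x + g x) \<in> nonneg_meas M" using B.measurable[OF f] B.measurable[OF g] f0 g0 by (auto simp: nonneg_meas_def)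
      have "h x \<le> f x + g x" for x
      proof -
        have "H x \<le> a * max (F x) (G x) + (1 - a) * max (F x) (G x)"
          unfolding H_def using a by (intro add_mono mult_left_mono) auto
        also have "\<dots> = max (F x) (G x)" by (simp add: algebra_simps)
        finally have "h x \<le> max (F x) (G x) powr (1 / r)"
          unfolding h_def using nonneg_measD(2)[OF H] r by (intro powr_mono2) auto
        also have "\<dots> \<le> f x + g x" by (auto simp: max_def f_def g_def)
        finally show ?thesis .
      qed
      then show "AE x in M. h x \<le> f x + g x" by simp
    qed
    have "fs_norm X (\<lambda>x. of_real (h x)) \<le> lsum (ennreal r) (fs_norm X (\<lambda>x. of_real (u x))) (fs_norm X (\<lambda>x. of_real (v x)))"
      using conv[unfolded p_convex_def, rule_format, OF uX(1) vX(1)] unfolding h_eq .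
    also have "\<dots> \<le> 1"
    proof -
      have n: "0 \<le> fs_norm X (\<lambda>x. of_real (f x))" "0 \<le> fs_norm X (\<lambda>x. of_real (g x))"
        using qbfs_norm_nonneg fX gX by auto
      have "a * fs_norm X (\<lambda>x. of_real (f x)) powr r + (1 - a) * fs_norm X (\<lambda>x. of_real (g x)) powr r \<le> a * 1 + (1 - a) * 1"
        using n fX gX a r by (intro add_mono mult_left_mono powr_le1) auto
      then show ?thesis
        using r a n by (simp add: lsum_def uX(2) vX(2) pw powr_le1)
    qed
    finally have "h \<in> unit_ball M X" using hN hX by (simp add: unit_ball_def)
    then show "(\<lambda>x. a * F x + (1 - a) * G x) \<in> power_ball M (unit_ball M X) r"
      using H unfolding power_ball_def h_def[abs_def] H_def[abs_def] by simp
  qed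
qed

end

section \<open>Convex and concave spaces\<close>

locale convex_concave_space = sigma_finite_measure M
  for M :: "'a measure" +
  fixes X :: "('a, 'k::{real_normed_field, euclidean_space}) fspace" and r :: real and s :: ennreal
  assumes nontrivial: "emeasure M (space M) \<noteq> 0"
    and BFS: "quasi_BFS M X" and r: "0 < r" and rs: "ennreal r < s"
    and convex: "p_convex (ennreal r) X" and concave: "q_concave s X"
begin

abbreviation "\<sigma> \<equiv> rcp s"

text \<open>\<open>\<tau>\<close> is the reciprocal of $(s/r)'$. The balls that follow belong, in
  this order, to $X$, $X^r$, $(X^r)'$, $[(X^r)']^{(s/r)'}$, $Y = X_{r,s}$ and $Y'$.\<close>

definition \<tau> :: real where "\<tau> = 1 - r * \<sigma>"
definition BX where "BX = unit_ball M X"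
definition BW where "BW = power_ball M BX r"
definition BW' where "BW' = polar M BW"
definition BU where "BU = power_ball M BW' (1 / \<tau>)"
definition BY where "BY = polar M BU"
definition BY' where "BY' = polar M BY"

lemma s_cases:
  obtains "s = top" "\<sigma> = 0" "\<tau> = 1"
  | S where "s = ennreal S" "r < S" "0 < S" "\<sigma> = 1 / S" "0 < \<sigma>" "0 < \<tau>" "\<tau> < 1"
proof (cases s)
  case (real S)
  then have S: "r < S" using rs r by (simp add: ennreal_less_iff)
  then have S0: "0 < S" using r by simp
  have \<sigma>: "\<sigma> = 1 / S" using S0 unfolding \<open>s = ennreal S\<close> by (rule rcp_ennreal)
  have \<tau>: "\<tau> = 1 - r / S" unfolding \<tau>_def \<sigma> by simp
  show ?thesis
    by (rule that(2)[OF \<open>s = ennreal S\<close> S S0 \<sigma>]) (use S S0 r in \<open>simp_all add: \<sigma> \<tau>\<close>)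
next
  case top
  then have \<sigma>: "\<sigma> = 0" by (simp only: rcp_top)
  have "\<tau> = 1" unfolding \<tau>_def \<sigma> by simp
  then show ?thesis by (rule that(1)[OF top \<sigma>])
qed

lemma \<tau>: "0 < \<tau>" "\<tau> \<le> 1"
  by (cases rule: s_cases, linarith, linarith)+

lemma \<tau>_eq: "\<tau> = r * (1 / r - \<sigma>)"
  using r by (simp add: \<tau>_def algebra_simps)

sublocale BX: solid_ball M BX
  unfolding BX_def by (rule solid_ball_unit_ball[OF BFS])

sublocale BW: function_ball M BW
  unfolding BW_def BX_def by (rule function_ball_power_convex[OF BFS r convex])

lemma not_AE_zero: "AE x in M. 0 < f x \<Longrightarrow> \<not> (AE x in M. f x = (0::real))"
proof
  assume "AE x in M. 0 < f x" "AE x in M. f x = 0"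
  then have "AE x in M. False" by eventually_elim simp
  then show False using nontrivial by (simp add: eventually_False ae_filter_eq_bot_iff)
qed

text \<open>Saturation supplies inside every set of positive measure a small multiple of an
  indicator that lies in the ball; the exhaustion lemma combines them.\<close>

lemma BW_positive: obtains F where "F \<in> BW" "AE x in M. 0 < F x"
proof (rule BW.strictly_positive[OF sigma_finite_measure_axioms])
  fix E assume E: "E \<in> sets M" "0 < emeasure M E"
  then obtain A where A: "A \<in> sets M" "A \<subseteq> E" "0 < emeasure M A" "indicator A \<in> fs_carrier X"
    using BFS unfolding quasi_BFS_def saturation_property_def by blast
  have eq: "indicator A = (\<lambda>x. of_real (indicator A x) :: 'k)" by (auto simp: indicator_def fun_eq_iff)
  note AX = A(4)[unfolded eq]
  define c where "c = 1 / (fs_norm X (\<lambda>x. of_real (indicator A x)) + 1)"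
  have n: "0 \<le> fs_norm X (\<lambda>x. of_real (indicator A x))" by (rule qbfs_norm_nonneg[OF BFS AX])
  then have c: "0 < c" by (simp add: c_def)
  have "c * fs_norm X (\<lambda>x. of_real (indicator A x)) \<le> 1" using n by (simp add: c_def)
  then have "(\<lambda>x. c * indicator A x) \<in> BX"
    using qbfs_scale_real[OF BFS AX, of c] c A(1) by (simp add: BX_def unit_ball_def nonneg_meas_def)
  moreover have "(c powr r * indicator A x) powr (1 / r) = c * indicator A x" for x
    using c r by (auto simp: indicator_def powr_powr)
  ultimately have "(\<lambda>x. c powr r * indicator A x) \<in> BW"
    using A(1) by (simp add: BW_def power_ball_def nonneg_meas_def)
  moreover have "\<not> (AE x in M. x \<in> E \<longrightarrow> c powr r * indicator A x = 0)"
  proof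
    assume "AE x in M. x \<in> E \<longrightarrow> c powr r * indicator A x = 0"
    then have "AE x in M. x \<notin> A" using A(2) c by (auto elim!: eventually_mono simp: indicator_def)
    then have "emeasure M A = 0"
      by (subst (asm) AE_iff_measurable[where N=A]) (auto dest: sets.sets_into_space[OF A(1), THEN subsetD] intro: A(1))
    with A(3) show False by simp
  qed
  ultimately show "\<exists>f\<in>BW. \<not> (AE x in M. x \<in> E \<longrightarrow> f x = 0)" by (intro bexI)
qed (rule that)

lemma BW'_ball: "function_ball M BW'"
proof -
  obtain F where F: "F \<in> BW" "AE x in M. 0 < F x" by (rule BW_positive)
  show ?thesis unfolding BW'_def by (rule function_ball_polar[OF BW.nonneg_meas F])
qed

sublocale BW': function_ball M BW' by (rule BW'_ball)

lemma BW'_positive: obtains z where "z \<in> BW'" "AE x in M. 0 < z x"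
proof -
  obtain F where F: "F \<in> BW" "AE x in M. 0 < F x" by (rule BW_positive)
  show ?thesis
    by (rule BW.polar_strictly_positive[OF sigma_finite_measure_axioms F]) (rule that, simp_all add: BW'_def)
qed

text \<open>The duality bound in homogeneous form, for the pieces into which concavity splits a
  function of norm at most 1. Norm 0 is treated apart because the proof normalizes.\<close>

lemma pairing:
  assumes f: "f \<in> nonneg_meas M" "(\<lambda>x. of_real (f x)) \<in> fs_carrier X" and z: "z \<in> BW'"
  shows "(\<integral>\<^sup>+x. ennreal (f x powr r * z x) \<partial>M) \<le> ennreal (fs_norm X (\<lambda>x. of_real (f x)) powr r)"
proof -
  define n where "n = fs_norm X (\<lambda>x. of_real (f x))"
  have n0: "0 \<le> n" unfolding n_def by (rule qbfs_norm_nonneg[OF BFS f(2)])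
  have [measurable]: "f \<in> borel_measurable M" by (rule nonneg_measD(1)[OF f(1)])
  note [measurable] = BW'.measurable[OF z]
  have f0: "0 \<le> f x" for x by (rule nonneg_measD(2)[OF f(1)])
  show ?thesis
  proof (cases "n = 0")
    case True
    then have "AE x in M. (of_real (f x) :: 'k) = 0" using qbfs_norm_zero[OF BFS f(2)] by (simp add: n_def)
    then have "(\<integral>\<^sup>+x. ennreal (f x powr r * z x) \<partial>M) = (\<integral>\<^sup>+x. 0 \<partial>M)"
      by (intro nn_integral_cong_AE) (auto elim!: eventually_mono)
    then show ?thesis by simp
  next
    case False
    then have n: "0 < n" using n0 by simp
    define F where "F x = (f x / n) powr r" for x
    have "(\<lambda>x. f x / n) \<in> BX"
      using qbfs_scale_real[OF BFS f(2), of "1 / n"] n f0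
      by (simp add: BX_def unit_ball_def nonneg_meas_def n_def[symmetric])
    then have F: "F \<in> BW"
      using r n f0 by (simp add: BW_def power_ball_def F_def[abs_def] nonneg_meas_def powr_powr)
    note [measurable] = BW.measurable[OF F]
    have "(\<integral>\<^sup>+x. ennreal (f x powr r * z x) \<partial>M) = (\<integral>\<^sup>+x. ennreal (n powr r) * ennreal (F x * z x) \<partial>M)"
      using n f0 BW'.nonneg[OF z] by (intro nn_integral_cong) (simp add: F_def powr_divide flip: ennreal_mult)
    also have "\<dots> = ennreal (n powr r) * (\<integral>\<^sup>+x. ennreal (F x * z x) \<partial>M)"
      by (rule nn_integral_cmult) measurable
    also have "\<dots> \<le> ennreal (n powr r) * 1"
      using z F by (intro mult_left_mono polarD(2)) (auto simp: BW'_def)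
    finally show ?thesis by (simp add: n_def)
  qed
qed

text \<open>The $s$-concavity of $X$ makes $X^r$ an $(s/r)$-concave space, so its dual is $(s/r)'$-convex.\<close>

lemma BU_ball: "function_ball M BU"
proof -
  interpret U: solid_ball M BU unfolding BU_def by (rule BW'.solid_ball_power) (simp add: \<tau>)
  show ?thesis
  proof
    fix u v a assume u: "u \<in> BU" and v: "v \<in> BU" and a: "0 \<le> a" "a \<le> (1::real)"
    define w where "w x = a * u x + (1 - a) * v x" for x
    note [measurable] = U.measurable[OF u] U.measurable[OF v]
    have u0: "0 \<le> u x" and v0: "0 \<le> v x" for x using U.nonneg u v by auto
    have w: "w \<in> nonneg_meas M" using u0 v0 a by (auto simp: nonneg_meas_def w_def[abs_def])
    note [measurable] = nonneg_measD(1)[OF w]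
    have w0: "0 \<le> w x" for x by (rule nonneg_measD(2)[OF w])
    have uz: "(\<lambda>x. u x powr \<tau>) \<in> BW'" and vz: "(\<lambda>x. v x powr \<tau>) \<in> BW'"
      using u v \<tau> by (auto simp: BU_def power_ball_def)
    have "(\<lambda>x. w x powr \<tau>) \<in> BW'"
    proof (cases rule: s_cases)
      case 1
      then show ?thesis
        using BW'.convex[OF uz vz a] u0 v0 w0 by (simp add: w_def[abs_def])
    next
      case (2 S)
      define \<rho> where "\<rho> = r * \<sigma>"
      have \<rho>: "0 < \<rho>" "\<tau> + \<rho> = 1" "\<rho> = r / S"
        unfolding \<rho>_def using r 2(5) by (simp_all add: \<tau>_def 2(4))
      have "(\<integral>\<^sup>+x. ennreal (F x * w x powr \<tau>) \<partial>M) \<le> 1" if F: "F \<in> BW" for F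
      proof -
        note [measurable] = BW.measurable[OF F]
        have F0: "0 \<le> F x" for x by (rule BW.nonneg[OF F])
        define f where "f x = F x powr (1 / r)" for x
        have fB: "f \<in> BX" using F by (simp add: BW_def power_ball_def f_def[abs_def])
        then have fN: "f \<in> nonneg_meas M" and fX: "(\<lambda>x. of_real (f x)) \<in> fs_carrier X"
          and f1: "fs_norm X (\<lambda>x. of_real (f x)) \<le> 1"
          by (auto simp: BX_def unit_ball_def)
        have f0: "0 \<le> f x" for x by (simp add: f_def)
        note [measurable] = nonneg_measD(1)[OF fN]
        \<comment> \<open>\<open>f\<close> is split according to the shares of \<open>a * u\<close>
          and \<open>(1 - a) * v\<close> in \<open>w\<close>. The shares add up to 1, or to 0 where
          \<open>w\<close> vanishes, so the \<open>S\<close>-th powers of \<open>g\<close> and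
          \<open>h\<close> add up to at most that of \<open>f\<close>, and concavity bounds the
          norms \<open>m\<close> and \<open>n\<close> accordingly.\<close>
        define g where "g x = f x * (a * u x / w x) powr \<sigma>" for x
        define h where "h x = f x * ((1 - a) * v x / w x) powr \<sigma>" for x
        have frac: "0 \<le> a * u x / w x" "a * u x / w x \<le> 1" "0 \<le> (1 - a) * v x / w x" "(1 - a) * v x / w x \<le> 1" for x
        proof -
          have *: "0 \<le> p / (p + q) \<and> p / (p + q) \<le> 1" if "0 \<le> p" "0 \<le> q" for p q :: real
          proof (cases "p + q = 0")
            case False
            then have "0 < p + q" using that by linarith
            then show ?thesis using that by simp
          qed simp
          show "0 \<le> a * u x / w x" "a * u x / w x \<le> 1" "0 \<le> (1 - a) * v x / w x" "(1 - a) * v x / w x \<le> 1"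
            using *[of "a * u x" "(1 - a) * v x"] *[of "(1 - a) * v x" "a * u x"] a u0[of x] v0[of x]
            by (simp_all add: w_def add.commute)
        qed
        have gN: "g \<in> nonneg_meas M" and hN: "h \<in> nonneg_meas M"
          using f0 by (auto simp: nonneg_meas_def g_def[abs_def] h_def[abs_def])
        have gf: "g x \<le> f x" and hf: "h x \<le> f x" for x
          unfolding g_def h_def using frac[of x] f0[of x] 2
          by (auto intro!: mult_left_le powr_le1)
        have gX: "(\<lambda>x. of_real (g x)) \<in> fs_carrier X"
          by (rule qbfs_ideal_real(1)[OF BFS fX fN gN]) (simp add: gf)
        have hX: "(\<lambda>x. of_real (h x)) \<in> fs_carrier X"
          by (rule qbfs_ideal_real(1)[OF BFS fX fN hN]) (simp add: hf)
        define m where "m = fs_norm X (\<lambda>x. of_real (g x))"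
        define n where "n = fs_norm X (\<lambda>x. of_real (h x))"
        have mn0: "0 \<le> m" "0 \<le> n" unfolding m_def n_def using gX hX qbfs_norm_nonneg[OF BFS] by auto
        have g0: "0 \<le> g x" and h0: "0 \<le> h x" for x using gN hN by (auto simp: nonneg_meas_def)
        have sum_le: "g x powr S + h x powr S \<le> f x powr S" for x
        proof -
          have pS: "(f x * q powr \<sigma>) powr S = f x powr S * q" if "0 \<le> q" for q
            using f0[of x] that 2(3) by (simp add: 2(4) powr_mult powr_powr)
          have "g x powr S + h x powr S = f x powr S * (a * u x / w x + (1 - a) * v x / w x)"
            unfolding g_def h_def pS[OF frac(1)] pS[OF frac(3)] by (rule distrib_left[symmetric])
          also have "a * u x / w x + (1 - a) * v x / w x = w x / w x"
            by (simp only: w_def add_divide_distrib)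
          also have "f x powr S * (w x / w x) \<le> f x powr S * 1"
            by (intro mult_left_mono) auto
          finally show ?thesis by simp
        qed
        define l where "l x = (g x powr S + h x powr S) powr (1 / S)" for x
        have l_eq: "lsum s (norm (of_real (g x) :: 'k)) (norm (of_real (h x) :: 'k)) = l x" for x
          using 2 g0 h0 by (simp add: lsum_def l_def)
        have lN: "l \<in> nonneg_meas M"
          using nonneg_measD(1)[OF gN] nonneg_measD(1)[OF hN] by (auto simp: nonneg_meas_def l_def[abs_def])
        have lf: "l x \<le> f x" for x
        proof -
          have "l x \<le> (f x powr S) powr (1 / S)"
            unfolding l_def using sum_le 2 by (intro powr_mono2) auto
          then show ?thesis using f0[of x] 2 by (simp add: powr_powr)
        qed
        have "lsum s m n \<le> fs_norm X (\<lambda>x. of_real (l x))"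
          using concave[unfolded q_concave_def, rule_format, OF gX hX] unfolding l_eq m_def n_def .
        also have "\<dots> \<le> fs_norm X (\<lambda>x. of_real (f x))"
          by (rule qbfs_ideal_real(2)[OF BFS fX fN lN]) (simp add: lf)
        also have "\<dots> \<le> 1" by (rule f1)
        finally have "(m powr S + n powr S) powr (1 / S) \<le> 1" using 2 by (simp add: lsum_def)
        then have "((m powr S + n powr S) powr (1 / S)) powr S \<le> 1"
          using 2 by (intro powr_le1) auto
        then have mn1: "m powr S + n powr S \<le> 1" using 2 by (simp add: powr_powr)
        \<comment> \<open>Since \<open>\<tau> + \<rho> = 1\<close>, the shares recombine: each
          summand equals \<open>F\<close> times its part of \<open>w\<close>, divided by
          \<open>w powr \<rho>\<close>.\<close>
        have split: "F x * w x powr \<tau> = a powr \<tau> * (g x powr r * u x powr \<tau>) + (1 - a) powr \<tau> * (h x powr r * v x powr \<tau>)" for x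
        proof (cases "w x = 0")
          case True
          then have "a * u x = 0" "(1 - a) * v x = 0"
            using a u0[of x] v0[of x] by (auto simp: w_def add_nonneg_eq_0_iff)
          then show ?thesis using True by auto
        next
          case False
          then have wpos: "0 < w x" using w0[of x] by simp
          have fr: "f x powr r = F x" using r F0[of x] by (simp add: f_def powr_powr)
          have part: "b powr \<tau> * ((f x * (b * t / w x) powr \<sigma>) powr r * t powr \<tau>) = F x * (b * t) / w x powr \<rho>"
            if "0 \<le> b" "0 \<le> t" for b t
          proof -
            have "b powr \<tau> * ((f x * (b * t / w x) powr \<sigma>) powr r * t powr \<tau>)
                = F x * ((b * t) powr \<rho> / w x powr \<rho>) * (b * t) powr \<tau>"
              using that wpos f0[of x] by (simp add: powr_mult powr_powr powr_divide fr \<rho>_def mult.commute[of r])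
            also have "\<dots> = F x * ((b * t) powr \<tau> * (b * t) powr \<rho>) / w x powr \<rho>" by simp
            also have "(b * t) powr \<tau> * (b * t) powr \<rho> = b * t"
              using that \<rho>(2) by (simp flip: powr_add)
            finally show ?thesis .
          qed
          have "a powr \<tau> * (g x powr r * u x powr \<tau>) + (1 - a) powr \<tau> * (h x powr r * v x powr \<tau>)
              = F x * w x / w x powr \<rho>"
          proof -
            have "0 \<le> 1 - a" using a by simp
            moreover have "F x * (a * u x) + F x * ((1 - a) * v x) = F x * w x"
              by (simp add: w_def algebra_simps)
            ultimately show ?thesis
              unfolding g_def h_def part[OF a(1) u0] part[OF \<open>0 \<le> 1 - a\<close> v0]
              by (simp only: add_divide_distrib[symmetric])
          qed
          also have "\<dots> = F x * w x powr \<tau>"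
          proof -
            have "\<tau> = 1 - \<rho>" using \<rho>(2) by simp
            then show ?thesis using wpos by (simp add: powr_diff)
          qed
          finally show ?thesis by (rule sym)
        qed
        note [measurable] = nonneg_measD(1)[OF gN] nonneg_measD(1)[OF hN]
        have "(\<integral>\<^sup>+x. ennreal (F x * w x powr \<tau>) \<partial>M)
            = (\<integral>\<^sup>+x. ennreal (a powr \<tau>) * ennreal (g x powr r * u x powr \<tau>)
                + ennreal ((1 - a) powr \<tau>) * ennreal (h x powr r * v x powr \<tau>) \<partial>M)"
          unfolding split by (intro nn_integral_cong) (simp add: ennreal_plus ennreal_mult)
        also have "\<dots> = ennreal (a powr \<tau>) * (\<integral>\<^sup>+x. ennreal (g x powr r * u x powr \<tau>) \<partial>M)
            + ennreal ((1 - a) powr \<tau>) * (\<integral>\<^sup>+x. ennreal (h x powr r * v x powr \<tau>) \<partial>M)"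
          by (subst nn_integral_add) (auto simp: nn_integral_cmult)
        also have "\<dots> \<le> ennreal (a powr \<tau>) * ennreal (m powr r) + ennreal ((1 - a) powr \<tau>) * ennreal (n powr r)"
          unfolding m_def n_def using pairing[OF gN gX uz] pairing[OF hN hX vz]
          by (intro add_mono mult_left_mono) auto
        also have "\<dots> = ennreal (a powr \<tau> * m powr r + (1 - a) powr \<tau> * n powr r)"
          by (simp add: ennreal_plus ennreal_mult)
        also have "\<dots> \<le> ennreal 1"
        proof (rule ennreal_leI)
          \<comment> \<open>Young's inequality with weights \<open>\<tau>\<close> and
            \<open>\<rho> = r / S\<close>; summed over the two pieces it leaves
            \<open>\<tau> + \<rho> * (m powr S + n powr S)\<close>, at most 1.\<close>
          have y: "b powr \<tau> * k powr r \<le> \<tau> * b + \<rho> * k powr S" if "0 \<le> b" "0 \<le> k" for b k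
          proof -
            have "(k powr S) powr \<rho> = k powr r" unfolding \<rho>(3) using 2(3) by (simp add: powr_powr)
            then show ?thesis
              using weighted_young[of b "k powr S" \<tau> \<rho>] that \<rho>(1,2) \<tau> by (simp add: pow0_def split: if_splits)
          qed
          have "a powr \<tau> * m powr r + (1 - a) powr \<tau> * n powr r
              \<le> (\<tau> * a + \<rho> * m powr S) + (\<tau> * (1 - a) + \<rho> * n powr S)"
            using a mn0 by (intro add_mono y) auto
          also have "\<dots> = \<tau> + \<rho> * (m powr S + n powr S)" by (simp add: algebra_simps)
          also have "\<dots> \<le> \<tau> + \<rho> * 1" using mn1 \<rho> by (intro add_mono mult_left_mono) auto
          finally show "a powr \<tau> * m powr r + (1 - a) powr \<tau> * n powr r \<le> 1" using \<rho> by simp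
        qed
        finally show ?thesis by simp
      qed
      moreover have "(\<lambda>x. w x powr \<tau>) \<in> nonneg_meas M" by (rule nonneg_meas_powr[OF w])
      ultimately show ?thesis by (simp add: BW'_def polar_def)
    qed
    then show "(\<lambda>x. a * u x + (1 - a) * v x) \<in> BU"
      using w by (simp add: BU_def power_ball_def w_def[abs_def])
  qed
qed

sublocale BU: function_ball M BU by (rule BU_ball)

lemma BU_positive: obtains u where "u \<in> BU" "AE x in M. 0 < u x"
proof -
  obtain z where z: "z \<in> BW'" "AE x in M. 0 < z x" by (rule BW'_positive)
  have "(\<lambda>x. z x powr (1 / \<tau>)) \<in> BU"
    using z(1) \<tau> BW'.nonneg[OF z(1)] BW'.measurable[OF z(1)] by (simp add: BU_def power_ball_def nonneg_meas_def powr_powr)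
  moreover have "AE x in M. 0 < z x powr (1 / \<tau>)" using z(2) by eventually_elim simp
  ultimately show ?thesis by (rule that)
qed

lemma BY_ball: "function_ball M BY"
proof -
  obtain F where F: "F \<in> BU" "AE x in M. 0 < F x" by (rule BU_positive)
  show ?thesis unfolding BY_def by (rule function_ball_polar[OF BU.nonneg_meas F])
qed

sublocale BY: function_ball M BY by (rule BY_ball)

lemma BY_positive: obtains y where "y \<in> BY" "AE x in M. 0 < y x"
proof -
  obtain F where F: "F \<in> BU" "AE x in M. 0 < F x" by (rule BU_positive)
  show ?thesis
    by (rule BU.polar_strictly_positive[OF sigma_finite_measure_axioms F]) (rule that, simp_all add: BY_def)
qed

lemma BY'_ball: "function_ball M BY'"
proof -
  obtain F where F: "F \<in> BY" "AE x in M. 0 < F x" by (rule BY_positive)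
  show ?thesis unfolding BY'_def by (rule function_ball_polar[OF BY.nonneg_meas F])
qed

sublocale BY': function_ball M BY' by (rule BY'_ball)

lemma BY'_positive: obtains y where "y \<in> BY'" "AE x in M. 0 < y x"
proof -
  obtain F where F: "F \<in> BY" "AE x in M. 0 < F x" by (rule BY_positive)
  show ?thesis
    by (rule BY.polar_strictly_positive[OF sigma_finite_measure_axioms F]) (rule that, simp_all add: BY'_def)
qed

text \<open>Reflexivity of \<open>Y\<close>. The factorization theorem returns elements of the polar
  of \<open>BY'\<close>, and this puts them into \<open>BY\<close>.\<close>

lemma BY'_polar: "polar M BY' = BY"
proof (intro set_eqI iffI)
  fix y assume y: "y \<in> polar M BY'"
  show "y \<in> BY"
  proof (rule BY.bipolar[OF sigma_finite_measure_axioms polarD(1)[OF y]])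
    fix z assume "z \<in> polar M BY"
    then show "(\<integral>\<^sup>+x. ennreal (y x * z x) \<partial>M) \<le> 1"
      using polarD(2)[OF y, of z] by (simp add: BY'_def mult.commute)
  qed
next
  fix y assume y: "y \<in> BY"
  then have "(\<integral>\<^sup>+x. ennreal (z x * y x) \<partial>M) \<le> 1" if "z \<in> BY'" for z
    using polarD(2)[of z M BY y] that by (simp add: BY'_def mult.commute)
  then show "y \<in> polar M BY'" using y BY.nonneg_meas by (auto simp: polar_def)
qed

lemma fs_ball_rs: "fs_ball M (fs_rs M X r s) BY"
proof -
  have "fs_ball M X BX" unfolding BX_def by (rule fs_ball_unit_ball[OF BFS])
  then have "fs_ball M (fs_power M X r) BW" unfolding BW_def using r by (rule fs_ball_power)
  moreover obtain F where "F \<in> BW" "AE x in M. 0 < F x" by (rule BW_positive)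
  ultimately have "fs_ball M (kothe_dual M (fs_power M X r)) BW'"
    unfolding BW'_def by (intro BW.fs_ball_kothe_dual not_AE_zero)
  then have "fs_ball M (fs_power M (kothe_dual M (fs_power M X r)) (1 / \<tau>)) BU"
    unfolding BU_def by (rule fs_ball_power) (simp add: \<tau>)
  moreover obtain u where "u \<in> BU" "AE x in M. 0 < u x" by (rule BU_positive)
  ultimately show ?thesis
    unfolding BY_def fs_rs_def \<tau>_def[symmetric] by (intro BU.fs_ball_kothe_dual not_AE_zero)
qed

lemma fs_ball_rs_dual: "fs_ball M (kothe_dual M (fs_rs M X r s)) BY'"
proof -
  obtain y where "y \<in> BY" "AE x in M. 0 < y x" by (rule BY_positive)
  then show ?thesis
    unfolding BY'_def by (intro BY.fs_ball_kothe_dual fs_ball_rs not_AE_zero)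
qed

end

section \<open>The factorization of a convex and concave space through its rescaled space and a
  Lebesgue space\<close>

lemma pow0_measurable [measurable]: "f \<in> borel_measurable M \<Longrightarrow> (\<lambda>x. pow0 (f x) b) \<in> borel_measurable M"
  by (cases "b = 0") (simp_all add: pow0_def)

lemma pow0_pos: "0 < x \<Longrightarrow> pow0 x b = x powr b"
  by (simp add: pow0_def)

lemma pow0_powr: "pow0 x b powr c = pow0 x (b * c)" if "c \<noteq> 0"
  using that by (simp add: pow0_def powr_powr)

context convex_concave_space
begin

lemma \<sigma>_eq: "1 - \<tau> = \<sigma> * r" by (simp add: \<tau>_def)

lemma \<alpha>_pos: "0 < 1 / r - \<sigma>"
  using \<tau>(1) r unfolding \<tau>_eq by (simp add: zero_less_mult_iff)

text \<open>The factorization theorem for two factors: \<open>F\<close> pairs to at most 1 with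
  \<open>u powr \<tau>\<close> for \<open>u\<close> in \<open>BU\<close>, which is a geometric mean
  of \<open>u\<close> and the constant 1. The polars of the two sets are \<open>BY\<close> and the
  positive unit ball of $L^1$.\<close>

lemma BW_factorization:
  assumes F: "F \<in> BW" and e: "1 < e"
  obtains k a where "k \<in> BY" "a \<in> nonneg_meas M" "(\<integral>\<^sup>+x. ennreal (a x) \<partial>M) \<le> 1"
    "AE x in M. F x \<le> e * (k x powr \<tau> * pow0 (a x) (1 - \<tau>))"
proof (cases rule: s_cases)
  case 1
  \<comment> \<open>For infinite \<open>s\<close> the second exponent is 0 and the theorem does not
    apply. Here \<open>BU\<close> reduces to \<open>BW'\<close>, so \<open>F\<close> itself lies in
    \<open>BY\<close>, and \<open>a = 0\<close> will do since \<open>pow0 0 0\<close> is 1.\<close>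
  have "(\<integral>\<^sup>+x. ennreal (u x * F x) \<partial>M) \<le> 1" if u: "u \<in> BU" for u
  proof -
    have "(\<lambda>x. u x powr 1) \<in> BW'" using u 1(3) by (simp add: BU_def power_ball_def)
    then have "u \<in> BW'" using BU.nonneg[OF u] by simp
    then show ?thesis using polarD(2)[of u M BW F] F by (simp add: BW'_def mult.commute)
  qed
  then have FY: "F \<in> BY" using F BW.nonneg_meas by (auto simp: BY_def polar_def)
  show ?thesis
  proof (rule that[OF FY])
    show "AE x in M. F x \<le> e * (F x powr \<tau> * pow0 0 (1 - \<tau>))"
    proof (rule AE_I2)
      fix x
      have "1 * F x \<le> e * F x" using e BW.nonneg[OF F] by (intro mult_right_mono) auto
      then show "F x \<le> e * (F x powr \<tau> * pow0 0 (1 - \<tau>))"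
        using BW.nonneg[OF F, of x] by (simp add: 1(3) pow0_def)
    qed
  qed (auto simp: nonneg_meas_def)
next
  case (2 S)
  define \<theta> where "\<theta> i = (if i then \<tau> else 1 - \<tau>)" for i
  define V where "V i = (if i then {u \<in> BU. AE x in M. 0 < u x} else {\<lambda>x. 1})" for i
  obtain u\<^sub>0 where u0: "u\<^sub>0 \<in> BU" "AE x in M. 0 < u\<^sub>0 x" by (rule BU_positive)
  interpret G: geometric_mean_problem M UNIV \<theta> V F
  proof
    show "0 < \<theta> i" for i using 2(6,7) by (simp add: \<theta>_def)
    show "V i \<subseteq> nonneg_meas M" for i using BU.nonneg_meas by (auto simp: V_def nonneg_meas_def)
    show "V i \<noteq> {}" for i using u0 by (auto simp: V_def)
    show "AE x in M. 0 < v x" if "v \<in> V i" for i v using that by (auto simp: V_def split: if_splits)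
    show "(\<lambda>x. a * v x + (1 - a) * w x) \<in> V i" if "v \<in> V i" "w \<in> V i" "0 \<le> a" "a \<le> 1" for i v w a
    proof (cases i)
      case True
      then show ?thesis using BU.positive_part_convex[of v w a] that by (simp add: V_def)
    qed (use that in \<open>auto simp: V_def\<close>)
    show "F \<in> nonneg_meas M" using F BW.nonneg_meas by auto
    show "(\<integral>\<^sup>+x. ennreal (F x * (\<Prod>i\<in>UNIV. v i x powr \<theta> i)) \<partial>M) \<le> 1" if v: "\<And>i. i \<in> UNIV \<Longrightarrow> v i \<in> V i" for v
    proof -
      have "v True \<in> BU" "v False = (\<lambda>x. 1)" using v[of True] v[of False] by (auto simp: V_def)
      then have "(\<lambda>x. v True x powr \<tau>) \<in> BW'" using 2(6) by (simp add: BU_def power_ball_def)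
      then have "(\<integral>\<^sup>+x. ennreal (F x * v True x powr \<tau>) \<partial>M) \<le> 1"
        using polarD(2)[of "\<lambda>x. v True x powr \<tau>" M BW F] F by (simp add: BW'_def)
      then show ?thesis using \<open>v False = (\<lambda>x. 1)\<close> by (simp add: UNIV_bool \<theta>_def)
    qed
  qed (auto simp: UNIV_bool \<theta>_def)
  obtain y where y: "\<And>i. i \<in> UNIV \<Longrightarrow> y i \<in> polar M (V i)" "AE x in M. F x \<le> e * (\<Prod>i\<in>UNIV. y i x powr \<theta> i)"
    using G.factorization[OF e] by blast
  show ?thesis
  proof (rule that)
    show "y True \<in> BY"
      using y(1)[of True] BU.polar_positive_part[OF u0] by (simp add: V_def BY_def)
    show "y False \<in> nonneg_meas M" using y(1)[of False] by (simp add: polar_def)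
    show "(\<integral>\<^sup>+x. ennreal (y False x) \<partial>M) \<le> 1" using y(1)[of False] by (simp add: V_def polar_def)
    show "AE x in M. F x \<le> e * (y True x powr \<tau> * pow0 (y False x) (1 - \<tau>))"
      using y(2) 2(7) by (simp add: UNIV_bool \<theta>_def pow0_def mult.commute)
  qed
qed

text \<open>Beyond the factorization of the \<open>r\<close>-th power, \<open>k\<close> has to be
  positive so that it can be majorized by a weight; this is achieved by factoring a function
  perturbed by a positive one.\<close>

lemma BX_factorization:
  assumes f: "f \<in> fs_carrier X" and c: "fs_norm X f < c"
  obtains k a where "k \<in> BY" "AE x in M. 0 < k x" "a \<in> nonneg_meas M" "(\<integral>\<^sup>+x. ennreal (a x) \<partial>M) \<le> 1"
    "AE x in M. norm (f x) \<le> c * (k x powr (1 / r - \<sigma>) * pow0 (a x) \<sigma>)"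
proof -
  have n0: "0 \<le> fs_norm X f" by (rule qbfs_norm_nonneg[OF BFS f])
  define d where "d = (fs_norm X f + c) / 2"
  have d: "fs_norm X f \<le> d" "0 < d" "d < c" "0 < c" using n0 c by (auto simp: d_def)
  \<comment> \<open>Half of the gap between \<open>d\<close> and \<open>c\<close>, on the scale of
    \<open>r\<close>-th powers: \<open>e\<close> is lost once in the perturbation and once in the
    factorization.\<close>
  define e where "e = (c / d) powr (r / 2)"
  have e: "1 < e" unfolding e_def using d r by (intro gr_one_powr) auto
  have e2: "(e * e) powr (1 / r) = c / d"
    using d r by (simp add: e_def powr_powr flip: powr_add)
  have fN: "(\<lambda>x. norm (f x)) \<in> nonneg_meas M" by (rule L0_norm[OF qbfs_L0[OF BFS f]])
  define F where "F x = (norm (f x) / d) powr r" for x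
  have "(\<lambda>x. norm (f x) / d) \<in> BX"
    using fs_ball_norm_le[OF fs_ball_unit_ball[OF BFS] f d(2)] d(1) by (simp add: BX_def)
  moreover have "F \<in> nonneg_meas M"
    using nonneg_measD(1)[OF fN] by (auto simp: F_def[abs_def] nonneg_meas_def)
  ultimately have F: "F \<in> BW" using r d by (simp add: BW_def power_ball_def F_def[abs_def] powr_powr)
  obtain F\<^sub>0 where F0: "F\<^sub>0 \<in> BW" "AE x in M. 0 < F\<^sub>0 x" by (rule BW_positive)
  \<comment> \<open>Positive almost everywhere because of \<open>F\<^sub>0\<close>, and at least
    \<open>F / e\<close>. Where \<open>G\<close> is positive, its factor \<open>k\<close> cannot
    vanish.\<close>
  define G where "G x = (1 / e) * F x + (1 - 1 / e) * F\<^sub>0 x" for x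
  have G: "G \<in> BW" unfolding G_def[abs_def] using e by (intro BW.convex F F0) auto
  obtain k a where k: "k \<in> BY" and a: "a \<in> nonneg_meas M" "(\<integral>\<^sup>+x. ennreal (a x) \<partial>M) \<le> 1"
    and Gle: "AE x in M. G x \<le> e * (k x powr \<tau> * pow0 (a x) (1 - \<tau>))"
    using BW_factorization[OF G e] by blast
  show ?thesis
  proof (rule that[OF k _ a])
    show "AE x in M. 0 < k x"
      using F0(2) Gle
    proof eventually_elim
      case (elim x)
      have "0 < G x" unfolding G_def using elim(1) e BW.nonneg[OF F, of x] by (intro add_nonneg_pos) auto
      with elim(2) have "k x \<noteq> 0" by (intro notI) simp
      with BY.nonneg[OF k, of x] show ?case by simp
    qed
    show "AE x in M. norm (f x) \<le> c * (k x powr (1 / r - \<sigma>) * pow0 (a x) \<sigma>)"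
      using Gle
    proof eventually_elim
      case (elim x)
      have "F x / e \<le> G x" unfolding G_def using e BW.nonneg[OF F0(1), of x] by simp
      then have "F x \<le> e * G x" using e by (simp add: pos_divide_le_eq mult.commute)
      also have "\<dots> \<le> e * (e * (k x powr \<tau> * pow0 (a x) (1 - \<tau>)))" using elim e by (intro mult_left_mono) auto
      finally have "F x powr (1 / r) \<le> (e * (e * (k x powr \<tau> * pow0 (a x) (1 - \<tau>)))) powr (1 / r)"
        using r by (intro powr_mono2) (auto simp: F_def)
      also have "\<dots> = (e * e) powr (1 / r) * (k x powr (\<tau> / r) * pow0 (a x) \<sigma>)"
        using e r by (simp add: powr_mult powr_powr pow0_powr pow0_nonneg \<sigma>_eq mult.assoc)
      also have "\<tau> / r = 1 / r - \<sigma>" using r by (simp add: \<tau>_eq)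
      also have "F x powr (1 / r) = norm (f x) / d" using r d by (simp add: F_def powr_powr)
      finally show ?case using d unfolding e2 by (simp add: field_simps)
    qed
  qed
qed

text \<open>The converse of the factorization, with constant 1. By the bipolar theorem it is enough
  to pair with \<open>z = u powr \<tau>\<close> for \<open>u\<close> in \<open>BU\<close>, where
  Young's inequality reduces the claim to the pairing of \<open>u\<close> with \<open>k\<close> and
  to the integral of \<open>a\<close>.\<close>

lemma BX_product:
  assumes k: "k \<in> BY" and a: "a \<in> nonneg_meas M" "(\<integral>\<^sup>+x. ennreal (a x) \<partial>M) \<le> 1"
  shows "(\<lambda>x. k x powr (1 / r - \<sigma>) * pow0 (a x) \<sigma>) \<in> BX"
proof -
  note [measurable] = BY.measurable[OF k] nonneg_measD(1)[OF a(1)]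
  have k0: "0 \<le> k x" and a0: "0 \<le> a x" for x using BY.nonneg[OF k] nonneg_measD(2)[OF a(1)] by auto
  define F where "F x = k x powr \<tau> * pow0 (a x) (1 - \<tau>)" for x
  have FN: "F \<in> nonneg_meas M" unfolding F_def[abs_def] by (simp add: nonneg_meas_def pow0_nonneg)
  have "F \<in> BW"
  proof (rule BW.bipolar[OF sigma_finite_measure_axioms FN])
    fix z assume z: "z \<in> polar M BW"
    have z': "z \<in> BW'" using z by (simp add: BW'_def)
    note [measurable] = BW'.measurable[OF z']
    have z0: "0 \<le> z x" for x by (rule BW'.nonneg[OF z'])
    define u where "u x = z x powr (1 / \<tau>)" for x
    have u: "u \<in> BU"
      using z' z0 \<tau> by (simp add: BU_def power_ball_def nonneg_meas_def u_def[abs_def] powr_powr)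
    note [measurable] = BU.measurable[OF u]
    have u0: "0 \<le> u x" for x by (rule BU.nonneg[OF u])
    have "F x * z x \<le> \<tau> * (u x * k x) + (1 - \<tau>) * a x" for x
    proof -
      have "z x = u x powr \<tau>" using \<tau> z0[of x] by (simp add: u_def powr_powr)
      then have "F x * z x = (u x * k x) powr \<tau> * pow0 (a x) (1 - \<tau>)"
        using u0[of x] k0[of x] by (simp add: F_def powr_mult)
      also have "\<dots> \<le> \<tau> * (u x * k x) + (1 - \<tau>) * a x"
        using weighted_young[of "u x * k x" "a x" \<tau> "1 - \<tau>"] u0 k0 a0 \<tau>(1,2) by (simp add: pow0_def)
      finally show ?thesis .
    qed
    then have "(\<integral>\<^sup>+x. ennreal (F x * z x) \<partial>M) \<le> (\<integral>\<^sup>+x. ennreal \<tau> * ennreal (u x * k x) + ennreal (1 - \<tau>) * ennreal (a x) \<partial>M)"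
      using u0 k0 a0 \<tau> by (intro nn_integral_mono) (subst ennreal_convex_comb[symmetric], auto intro: ennreal_leI simp del: ennreal_plus)
    also have "\<dots> = ennreal \<tau> * (\<integral>\<^sup>+x. ennreal (u x * k x) \<partial>M) + ennreal (1 - \<tau>) * (\<integral>\<^sup>+x. ennreal (a x) \<partial>M)"
      by (simp add: nn_integral_add nn_integral_cmult)
    also have "\<dots> \<le> ennreal \<tau> * 1 + ennreal (1 - \<tau>) * 1"
      using polarD(2)[of k M BU u] k u a(2) by (intro add_mono mult_left_mono) (auto simp: BY_def)
    also have "\<dots> = 1" using \<tau> by (simp flip: ennreal_plus)
    finally show "(\<integral>\<^sup>+x. ennreal (F x * z x) \<partial>M) \<le> 1" .
  qed
  then have "(\<lambda>x. F x powr (1 / r)) \<in> BX" by (simp add: BW_def power_ball_def)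
  moreover have "F x powr (1 / r) = k x powr (1 / r - \<sigma>) * pow0 (a x) \<sigma>" for x
  proof -
    have "\<tau> / r = 1 / r - \<sigma>" using r by (simp add: \<tau>_eq)
    then show ?thesis
      using r by (simp add: F_def powr_mult powr_powr pow0_powr pow0_nonneg \<sigma>_eq)
  qed
  ultimately show ?thesis by simp
qed

end

section \<open>The maximal operator and Muckenhoupt weights\<close>

lemma sigma_finite_lebesgue: "sigma_finite_measure (lebesgue :: 'a::euclidean_space measure)"
proof
  obtain A :: "'a set set" where A: "countable A" "A \<subseteq> sets lborel" "\<Union>A = space lborel" "\<forall>a\<in>A. emeasure lborel a \<noteq> \<infinity>"
    using lborel.sigma_finite_countable by blast
  then show "\<exists>A::'a set set. countable A \<and> A \<subseteq> sets lebesgue \<and> \<Union>A = space lebesgue \<and> (\<forall>a\<in>A. emeasure lebesgue a \<noteq> \<infinity>)"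
    by (intro exI[of _ A]) (auto simp: subset_eq)
qed

lemma emeasure_lebesgue_UNIV: "emeasure lebesgue (UNIV :: 'a::euclidean_space set) \<noteq> 0"
  by simp

lemma cubesE:
  assumes "Q \<in> cubes"
  obtains q where "0 < q" "emeasure lebesgue Q = ennreal q" "measure lebesgue Q = q" "Q \<in> sets lebesgue"
proof -
  obtain a and l :: real where Q: "Q = cbox a (a + (\<chi> i. l))" "0 < l" using assms by (auto simp: cubes_def)
  have "0 < measure lebesgue Q"
    unfolding Q by (simp, rule content_pos_lt) (use Q(2) in \<open>auto simp: Basis_vec_def inner_axis inner_add_left\<close>)
  moreover have "emeasure lebesgue Q = ennreal (measure lebesgue Q)"
    unfolding Q by (intro emeasure_eq_measure2) auto
  ultimately show ?thesis using that[of "measure lebesgue Q"] Q by auto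
qed

lemma cube_at: obtains Q where "Q \<in> cubes" "x \<in> Q"
proof
  show "cbox x (x + (\<chi> i. 1)) \<in> cubes" unfolding cubes_def by (intro CollectI exI[of _ x] exI[of _ 1]) simp
  show "x \<in> cbox x (x + (\<chi> i. 1))" by (simp add: mem_box_cart)
qed

lemma maximal_of_real:
  "maximal (\<lambda>x. of_real (f x) :: 'k::{real_normed_field, euclidean_space}) = maximal (f :: real ^ 'd \<Rightarrow> real)"
  unfolding maximal_def by (simp add: fun_eq_iff)

lemma cube_integral_le_maximal:
  fixes f :: "real ^ 'd \<Rightarrow> real"
  assumes "Q \<in> cubes" "x \<in> Q"
  shows "(\<integral>\<^sup>+y\<in>Q. ennreal (norm (f y)) \<partial>lebesgue) \<le> maximal f x * emeasure lebesgue Q"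
proof -
  obtain q where q: "0 < q" "emeasure lebesgue Q = ennreal q" by (rule cubesE[OF assms(1)])
  let ?I = "\<integral>\<^sup>+y\<in>Q. ennreal (norm (f y)) \<partial>lebesgue"
  have "?I / ennreal q \<le> maximal f x"
    unfolding maximal_def using assms q(2) by (intro SUP_upper2[of Q]) auto
  then have "?I / ennreal q * ennreal q \<le> maximal f x * ennreal q" by (rule mult_right_mono) simp
  moreover have "?I / ennreal q * ennreal q = ?I"
    using q(1) by (simp add: divide_ennreal_def mult.assoc inverse_ennreal flip: ennreal_mult)
  ultimately show ?thesis using q(2) by simp
qed

lemma cube_integral_pos:
  fixes f :: "real ^ 'd \<Rightarrow> real"
  assumes Q: "Q \<in> cubes" and [measurable]: "f \<in> borel_measurable lebesgue" and f: "AE x in lebesgue. 0 < f x"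
  shows "0 < (\<integral>\<^sup>+y\<in>Q. ennreal (f y) \<partial>lebesgue)"
proof -
  obtain q where q: "0 < q" "emeasure lebesgue Q = ennreal q" and [measurable]: "Q \<in> sets lebesgue" by (rule cubesE[OF Q])
  have "(\<integral>\<^sup>+y\<in>Q. ennreal (f y) \<partial>lebesgue) \<noteq> 0"
  proof
    assume "(\<integral>\<^sup>+y\<in>Q. ennreal (f y) \<partial>lebesgue) = 0"
    then have "AE x in lebesgue. ennreal (f x) * indicator Q x = 0"
      by (subst (asm) nn_integral_0_iff_AE) auto
    with f have "AE x in lebesgue. x \<notin> Q"
      by eventually_elim (auto simp: indicator_def split: if_splits)
    then have "emeasure lebesgue Q = 0" by (subst (asm) AE_iff_measurable[where N=Q]) auto
    with q show False by simp
  qed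
  then show ?thesis by (simp add: zero_less_iff_neq_zero)
qed

text \<open>The $A_1$ condition cube by cube, without mention of the maximal function: the
  exceptional null set may depend on the cube, which is harmless because \<open>A_const\<close> is
  estimated on one cube at a time.\<close>

definition A1 :: "(real ^ 'd \<Rightarrow> real) \<Rightarrow> real \<Rightarrow> bool" where
  "A1 w c \<longleftrightarrow> (\<forall>Q\<in>cubes. AE x in lebesgue. x \<in> Q \<longrightarrow>
     (\<integral>\<^sup>+y\<in>Q. ennreal (w y) \<partial>lebesgue) \<le> ennreal (c * w x) * emeasure lebesgue Q)"

text \<open>The infimum of the admissible constants is admissible: for positive norm one divides by
  it, for norm 0 any one admissible constant gives the bound.\<close>

lemma maximal_norm_bound:
  fixes Y :: "(real ^ 'd, 'k::{real_normed_field, euclidean_space}) fspace"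
  assumes rel: "fs_ball lebesgue Y B" and bdd: "maximal_bounded Y"
  shows "maximal_bounded_by Y (maximal_norm Y)"
proof -
  let ?S = "{C. maximal_bounded_by Y C}"
  have ne: "?S \<noteq> {}" using bdd by (auto simp: maximal_bounded_def)
  have nn: "0 \<le> C" if "C \<in> ?S" for C using that by (simp add: maximal_bounded_by_def)
  obtain C\<^sub>0 where C0: "maximal_bounded_by Y C\<^sub>0" using ne by auto
  let ?m = "\<lambda>f x. of_real (enn2real (maximal f x)) :: 'k"
  have "fs_norm Y (?m f) \<le> maximal_norm Y * fs_norm Y f" if f: "f \<in> fs_carrier Y" for f
  proof -
    have n0: "0 \<le> fs_norm Y f" by (rule fs_ball_norm_nonneg[OF rel f])
    have le: "fs_norm Y (?m f) \<le> C * fs_norm Y f" if "C \<in> ?S" for C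
      using that f by (simp add: maximal_bounded_by_def)
    show ?thesis
    proof (cases "fs_norm Y f = 0")
      case True
      then show ?thesis using le[of C\<^sub>0] C0 by simp
    next
      case False
      then have pos: "0 < fs_norm Y f" using n0 by simp
      have "fs_norm Y (?m f) / fs_norm Y f \<le> Inf ?S"
        using le pos by (intro cInf_greatest[OF ne]) (simp add: pos_divide_le_eq)
      then show ?thesis using pos by (simp add: maximal_norm_def pos_divide_le_eq)
    qed
  qed
  moreover have "0 \<le> maximal_norm Y" unfolding maximal_norm_def by (rule cInf_greatest[OF ne nn])
  ultimately show ?thesis using C0 by (simp add: maximal_bounded_by_def)
qed

lemma maximal_in_ball:
  fixes Y :: "(real ^ 'd, 'k::{real_normed_field, euclidean_space}) fspace"
  assumes rel: "fs_ball lebesgue Y B" and "function_ball lebesgue B" and bdd: "maximal_bounded Y"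
    and f: "f \<in> B"
  shows "AE x in lebesgue. maximal f x < \<infinity>"
    and "maximal_norm Y \<le> c \<Longrightarrow> 0 < c \<Longrightarrow> (\<lambda>x. enn2real (maximal f x) / c) \<in> B"
proof -
  interpret function_ball lebesgue B by fact
  let ?m = "\<lambda>x. of_real (enn2real (maximal f x)) :: 'k"
  have fN: "f \<in> nonneg_meas lebesgue" using f nonneg_meas by auto
  have fY: "(\<lambda>x. of_real (f x)) \<in> fs_carrier Y" and f1: "fs_norm Y (\<lambda>x. of_real (f x)) \<le> 1"
    using fs_ball_member[OF rel fN f] by auto
  have M: "AE x in lebesgue. maximal f x < \<infinity>" "?m \<in> fs_carrier Y"
    "fs_norm Y ?m \<le> maximal_norm Y * fs_norm Y (\<lambda>x. of_real (f x))" "0 \<le> maximal_norm Y"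
    using maximal_norm_bound[OF rel bdd] fY unfolding maximal_bounded_by_def
    by (force simp: maximal_of_real)+
  show "AE x in lebesgue. maximal f x < \<infinity>" by (rule M)
  show "(\<lambda>x. enn2real (maximal f x) / c) \<in> B" if c: "maximal_norm Y \<le> c" "0 < c"
  proof -
    have "fs_norm Y ?m \<le> maximal_norm Y * 1"
      by (rule order_trans[OF M(3)]) (intro mult_left_mono f1 M(4))
    then show ?thesis
      using c(1) fs_ball_norm_le[OF rel M(2) c(2)] by simp
  qed
qed

text \<open>The iteration divides by this norm. Were it 0, the maximal function of the positive
  \<open>f\<close> would vanish almost everywhere, whereas the integral of \<open>f\<close> over
  every cube is positive.\<close>

lemma maximal_norm_pos:
  fixes Y :: "(real ^ 'd, 'k::{real_normed_field, euclidean_space}) fspace"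
  assumes rel: "fs_ball lebesgue Y B" and B: "function_ball lebesgue B" and bdd: "maximal_bounded Y"
    and f: "f \<in> B" "AE x in lebesgue. 0 < f x"
  shows "0 < maximal_norm Y"
proof (rule ccontr)
  interpret function_ball lebesgue B by fact
  assume "\<not> 0 < maximal_norm Y"
  then have "(\<lambda>x. enn2real (maximal f x) / c) \<in> B" if "0 < c" for c
    using that by (intro maximal_in_ball(2)[OF rel B bdd f(1)]) auto
  moreover from this[of 1] have "(\<lambda>x. enn2real (maximal f x)) \<in> nonneg_meas lebesgue" using nonneg_meas by auto
  ultimately have "AE x in lebesgue. enn2real (maximal f x) = 0" by (intro AE_zero)
  with maximal_in_ball(1)[OF rel B bdd f(1)] have "AE x in lebesgue. maximal f x = 0"
    by eventually_elim (auto simp: enn2real_eq_0_iff)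
  then have "\<exists>x. maximal f x = 0"
    using emeasure_lebesgue_UNIV by (auto simp: eventually_False ae_filter_eq_bot_iff dest!: eventually_happens)
  then obtain x where x: "maximal f x = 0" by blast
  obtain Q where Q: "Q \<in> cubes" "x \<in> Q" by (rule cube_at)
  have "0 < (\<integral>\<^sup>+y\<in>Q. ennreal (f y) \<partial>lebesgue)" by (rule cube_integral_pos[OF Q(1) measurable[OF f(1)] f(2)])
  also have "\<dots> = (\<integral>\<^sup>+y\<in>Q. ennreal (norm (f y)) \<partial>lebesgue)" using nonneg[OF f(1)] by simp
  also have "\<dots> \<le> maximal f x * emeasure lebesgue Q" by (rule cube_integral_le_maximal[OF Q])
  finally show False using x by simp
qed

text \<open>The Rubio de Francia iteration $K = \sum_n M^n k / (2 \|M\|)^n$.\<close>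

lemma A1_majorant:
  fixes Y :: "(real ^ 'd, 'k::{real_normed_field, euclidean_space}) fspace"
  assumes rel: "fs_ball lebesgue Y B" and B: "function_ball lebesgue B" and bdd: "maximal_bounded Y"
    and k: "k \<in> B" "AE x in lebesgue. 0 < k x"
  obtains K where "(\<lambda>x. K x / 2) \<in> B" "AE x in lebesgue. k x \<le> K x" "A1 K (2 * maximal_norm Y)"
proof -
  interpret function_ball lebesgue B by fact
  define N where "N = maximal_norm Y"
  have N: "0 < N" unfolding N_def by (rule maximal_norm_pos[OF rel B bdd k])
  define m where "m = rec_nat k (\<lambda>_ f x. enn2real (maximal f x) / N)"
  have m0: "m 0 = k" and mS: "m (Suc n) = (\<lambda>x. enn2real (maximal (m n) x) / N)" for n
    by (simp_all add: m_def)
  have mB: "m n \<in> B" for n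
  proof (induction n)
    case (Suc n)
    then show ?case unfolding mS using N by (intro maximal_in_ball(2)[OF rel B bdd]) (auto simp: N_def)
  qed (simp add: m0 k)
  have fin: "AE x in lebesgue. \<forall>n. maximal (m n) x < \<infinity>"
    unfolding AE_all_countable using maximal_in_ball(1)[OF rel B bdd mB] by blast
  define S where "S x = (\<Sum>n. ennreal (m n x / 2 ^ Suc n))" for x
  have S_fin: "AE x in lebesgue. S x < \<infinity>" and SB: "(\<lambda>x. enn2real (S x)) \<in> B"
    using series[of m, OF mB] by (auto simp: S_def)
  \<comment> \<open>\<open>S\<close> has weights of total mass 1 and so stays in the ball; doubling
    it makes \<open>k\<close> itself the zeroth term.\<close>
  define K where "K x = 2 * enn2real (S x)" for x
  note [measurable] = measurable[OF mB]
  have m_nn: "0 \<le> m n x" for n x by (rule nonneg[OF mB])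
  show ?thesis
  proof (rule that)
    show "(\<lambda>x. K x / 2) \<in> B" using SB by (simp add: K_def)
    show "AE x in lebesgue. k x \<le> K x"
      using S_fin
    proof eventually_elim
      case (elim x)
      have "ennreal (m 0 x / 2 ^ Suc 0) \<le> S x"
        unfolding S_def using sum_le_suminf[of "\<lambda>n. ennreal (m n x / 2 ^ Suc n)" "{0}"] by simp
      then have "enn2real (ennreal (m 0 x / 2 ^ Suc 0)) \<le> enn2real (S x)"
        using elim by (intro enn2real_mono) auto
      then show ?case using m_nn[of 0 x] by (simp add: K_def m0)
    qed
    show "A1 K (2 * maximal_norm Y)"
      unfolding A1_def
    proof
      fix Q :: "(real ^ 'd) set" assume Q: "Q \<in> cubes"
      have [measurable]: "Q \<in> sets lebesgue" by (rule cubesE[OF Q])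
      have "(\<integral>\<^sup>+y\<in>Q. ennreal (K y) \<partial>lebesgue) = (\<integral>\<^sup>+y. (\<Sum>n. ennreal (m n y / 2 ^ n) * indicator Q y) \<partial>lebesgue)"
      proof (rule nn_integral_cong_AE, use S_fin in eventually_elim)
        case (elim y)
        have "ennreal (K y) = ennreal 2 * S y"
          using elim by (simp add: K_def ennreal_mult)
        also have "\<dots> = (\<Sum>n. ennreal 2 * ennreal (m n y / 2 ^ Suc n))" by (simp add: S_def)
        also have "\<dots> = (\<Sum>n. ennreal (m n y / 2 ^ n))"
        proof (intro suminf_cong)
          show "ennreal 2 * ennreal (m n y / 2 ^ Suc n) = ennreal (m n y / 2 ^ n)" for n
            using m_nn[of n y] by (subst ennreal_mult[symmetric]) auto
        qed
        finally show ?case by simp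
      qed
      also have "\<dots> = (\<Sum>n. \<integral>\<^sup>+y. ennreal (m n y / 2 ^ n) * indicator Q y \<partial>lebesgue)"
        by (rule nn_integral_suminf) measurable
      finally have eq: "(\<integral>\<^sup>+y\<in>Q. ennreal (K y) \<partial>lebesgue) = (\<Sum>n. \<integral>\<^sup>+y. ennreal (m n y / 2 ^ n) * indicator Q y \<partial>lebesgue)" .
      show "AE x in lebesgue. x \<in> Q \<longrightarrow>
          (\<integral>\<^sup>+y\<in>Q. ennreal (K y) \<partial>lebesgue) \<le> ennreal (2 * maximal_norm Y * K x) * emeasure lebesgue Q"
        using fin S_fin
      proof eventually_elim
        case (elim x)
        show ?case
        proof
          assume x: "x \<in> Q"
          \<comment> \<open>The average of one term of \<open>K\<close> over \<open>Q\<close> is at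
            most \<open>2 * N\<close> times the next term at \<open>x\<close>. The form with
            \<open>4 * N\<close> displays that next term as a term of \<open>S\<close>, which is
            half of \<open>K\<close>.\<close>
          have term_le: "(\<integral>\<^sup>+y. ennreal (m n y / 2 ^ n) * indicator Q y \<partial>lebesgue)
              \<le> ennreal (4 * N) * ennreal (m (Suc n) x / 2 ^ Suc (Suc n)) * emeasure lebesgue Q" for n
          proof -
            have "(\<integral>\<^sup>+y. ennreal (m n y / 2 ^ n) * indicator Q y \<partial>lebesgue)
                = (\<integral>\<^sup>+y. ennreal (1 / 2 ^ n) * (ennreal (norm (m n y)) * indicator Q y) \<partial>lebesgue)"
              using m_nn by (intro nn_integral_cong) (simp add: mult.assoc[symmetric] flip: ennreal_mult)
            also have "\<dots> = ennreal (1 / 2 ^ n) * (\<integral>\<^sup>+y\<in>Q. ennreal (norm (m n y)) \<partial>lebesgue)"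
              by (rule nn_integral_cmult) measurable
            also have "\<dots> \<le> ennreal (1 / 2 ^ n) * (maximal (m n) x * emeasure lebesgue Q)"
              by (intro mult_left_mono cube_integral_le_maximal Q x) auto
            also have "maximal (m n) x = ennreal (N * m (Suc n) x)"
              using elim(1) N by (simp add: mS)
            also have "ennreal (1 / 2 ^ n) * (ennreal (N * m (Suc n) x) * emeasure lebesgue Q)
                = ennreal (4 * N) * ennreal (m (Suc n) x / 2 ^ Suc (Suc n)) * emeasure lebesgue Q"
              using m_nn[of "Suc n" x] N by (simp add: mult.assoc[symmetric] flip: ennreal_mult)
            finally show ?thesis .
          qed
          have "(\<integral>\<^sup>+y\<in>Q. ennreal (K y) \<partial>lebesgue)
              \<le> (\<Sum>n. ennreal (4 * N) * ennreal (m (Suc n) x / 2 ^ Suc (Suc n)) * emeasure lebesgue Q)"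
            unfolding eq by (intro suminf_le term_le) auto
          also have "\<dots> = ennreal (4 * N) * (\<Sum>n. ennreal (m (Suc n) x / 2 ^ Suc (Suc n))) * emeasure lebesgue Q"
            by (simp only: ennreal_suminf_cmult ennreal_suminf_multc)
          also have "\<dots> \<le> ennreal (4 * N) * S x * emeasure lebesgue Q"
          proof (intro mult_right_mono mult_left_mono)
            show "(\<Sum>n. ennreal (m (Suc n) x / 2 ^ Suc (Suc n))) \<le> S x"
            proof (rule suminf_le_const)
              fix n
              have "(\<Sum>i<n. ennreal (m (Suc i) x / 2 ^ Suc (Suc i)))
                  = (\<Sum>i\<in>Suc ` {..<n}. ennreal (m i x / 2 ^ Suc i))"
                by (subst sum.reindex) (auto simp: comp_def)
              also have "\<dots> \<le> S x" unfolding S_def by (rule sum_le_suminf) auto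
              finally show "(\<Sum>i<n. ennreal (m (Suc i) x / 2 ^ Suc (Suc i))) \<le> S x" .
            qed simp
          qed auto
          also have "ennreal (4 * N) * S x = ennreal (2 * maximal_norm Y * K x)"
          proof -
            have "S x = ennreal (enn2real (S x))" using elim(2) by simp
            then have "ennreal (4 * N) * S x = ennreal (4 * N * enn2real (S x))"
              using N by (metis ennreal_mult enn2real_nonneg less_imp_le mult_pos_pos zero_less_numeral)
            then show ?thesis by (simp add: K_def N_def mult.assoc)
          qed
          finally show "(\<integral>\<^sup>+y\<in>Q. ennreal (K y) \<partial>lebesgue) \<le> ennreal (2 * maximal_norm Y * K x) * emeasure lebesgue Q" .
        qed
      qed
    qed
  qed
qed

section \<open>Membership of the weights in the Muckenhoupt class\<close>

lemma Lp_norm_le_top: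
  assumes [measurable]: "f \<in> borel_measurable M" and "AE x in M. norm (f x) \<le> c"
  shows "Lp_norm M top f \<le> ennreal c"
proof -
  have "esssup M (\<lambda>x. ennreal (norm (f x))) \<le> ennreal c"
    using assms(2) by (intro esssup_I) (auto elim!: eventually_mono intro: ennreal_leI)
  then show ?thesis by (simp add: Lp_norm_def)
qed

lemma Lp_norm_le:
  assumes "0 < q" "0 \<le> J" and le: "(\<integral>\<^sup>+x. ennreal (norm (f x) powr q) \<partial>M) \<le> ennreal J"
  shows "Lp_norm M (ennreal q) f \<le> ennreal (J powr (1 / q))"
proof -
  have fin: "(\<integral>\<^sup>+x. ennreal (norm (f x) powr q) \<partial>M) < top"
    by (rule order_le_less_trans[OF le]) simp
  have "enn2real (\<integral>\<^sup>+x. ennreal (norm (f x) powr q) \<partial>M) \<le> enn2real (ennreal J)"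
    by (rule enn2real_mono[OF le]) simp
  then have "enn2real (\<integral>\<^sup>+x. ennreal (norm (f x) powr q) \<partial>M) powr (1 / q) \<le> J powr (1 / q)"
    using assms by (intro powr_mono2) auto
  moreover have "(\<integral>\<^sup>+x. ennreal (norm (f x) powr q) \<partial>M) \<noteq> top" using fin by auto
  ultimately show ?thesis using assms(1) by (simp add: Lp_norm_def Let_def ennreal_leI)
qed

text \<open>The exponent \<open>1 / b\<close> turns the bound by \<open>V powr b\<close> into the
  integral of \<open>V\<close> over the cube; \<open>b = 0\<close> is the essential
  supremum.\<close>

lemma Lp_norm_cube_le:
  fixes u V :: "real ^ 'd \<Rightarrow> real"
  assumes Q: "Q \<in> cubes" and b: "0 \<le> b" and D: "0 \<le> D" and [measurable]: "u \<in> borel_measurable lebesgue"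
    and V: "V \<in> nonneg_meas lebesgue" "AE x in lebesgue. 0 < V x"
    and u: "AE x in lebesgue. x \<in> Q \<longrightarrow> 0 \<le> u x \<and> u x \<le> D * V x powr b"
    and J: "0 \<le> J" "b \<noteq> 0 \<Longrightarrow> (\<integral>\<^sup>+y\<in>Q. ennreal (V y) \<partial>lebesgue) = ennreal J"
  shows "Lp_norm lebesgue (1 / ennreal b) (\<lambda>x. u x * indicator Q x) \<le> ennreal (D * pow0 J b)"
proof (cases "b = 0")
  case True
  have [measurable]: "Q \<in> sets lebesgue" by (rule cubesE[OF Q])
  have "AE x in lebesgue. norm (u x * indicator Q x) \<le> D"
    using u V(2) by eventually_elim (use D True in \<open>auto simp: indicator_def\<close>)
  then have "Lp_norm lebesgue top (\<lambda>x. u x * indicator Q x) \<le> ennreal D"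
    by (intro Lp_norm_le_top) auto
  moreover have "1 / ennreal b = top" using True by (simp add: ennreal_divide_zero)
  ultimately show ?thesis using True by (simp add: pow0_def)
next
  case False
  then have b: "0 < b" using b by simp
  have [measurable]: "Q \<in> sets lebesgue" by (rule cubesE[OF Q])
  note [measurable] = nonneg_measD(1)[OF V(1)]
  have V0: "0 \<le> V x" for x by (rule nonneg_measD(2)[OF V(1)])
  have "(\<integral>\<^sup>+x. ennreal (norm (u x * indicator Q x) powr (1 / b)) \<partial>lebesgue)
      \<le> (\<integral>\<^sup>+x. ennreal (D powr (1 / b)) * (ennreal (V x) * indicator Q x) \<partial>lebesgue)"
  proof (rule nn_integral_mono_AE, use u in eventually_elim)
    case (elim x)
    show ?case
    proof (cases "x \<in> Q")
      case True
      then have "u x powr (1 / b) \<le> (D * V x powr b) powr (1 / b)"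
        using elim b by (intro powr_mono2) auto
      also have "\<dots> = D powr (1 / b) * V x"
        using D b V0[of x] by (simp add: powr_mult powr_powr)
      finally show ?thesis using True elim V0[of x] by (simp add: ennreal_leI flip: ennreal_mult)
    qed simp
  qed
  also have "\<dots> = ennreal (D powr (1 / b)) * ennreal J"
    by (subst nn_integral_cmult) (auto simp: J(2)[OF False])
  also have "\<dots> = ennreal (D powr (1 / b) * J)" using J by (simp add: ennreal_mult)
  finally have "Lp_norm lebesgue (ennreal (1 / b)) (\<lambda>x. u x * indicator Q x) \<le> ennreal ((D powr (1 / b) * J) powr (1 / (1 / b)))"
    using b J(1) by (intro Lp_norm_le) auto
  also have "(D powr (1 / b) * J) powr (1 / (1 / b)) = D * pow0 J b"
    using D J(1) b by (simp add: powr_mult powr_powr pow0_def)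
  also have "ennreal (1 / b) = 1 / ennreal b"
    using b by (simp add: divide_ennreal flip: ennreal_1)
  finally show ?thesis .
qed

lemma one_div_ennreal: "p \<noteq> 0 \<Longrightarrow> 1 / p = ennreal (rcp p)"
  by (simp add: rcp_def ennreal_enn2real_if ennreal_divide_eq_top_iff)

text \<open>The easy direction of the Jones factorization: on a cube the negative power of an $A_1$
  weight is bounded by that power of its average, up to the $A_1$ constant, while its positive power
  is integrated in the other norm. The averages cancel.\<close>

lemma A_const_le:
  fixes K V :: "real ^ 'd \<Rightarrow> real" and r :: real and p s :: ennreal
  assumes r: "0 < r" "ennreal r \<le> p" "p \<le> s"
    and K: "K \<in> nonneg_meas lebesgue" "AE x in lebesgue. 0 < K x"
    and V: "V \<in> nonneg_meas lebesgue" "AE x in lebesgue. 0 < V x"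
    and g: "g = 1 / r - rcp p" "0 \<le> g" and b: "b = rcp p - rcp s" "0 \<le> b"
    and c1: "0 < c1" "g \<noteq> 0 \<Longrightarrow> A1 K c1" and c2: "0 < c2" "b \<noteq> 0 \<Longrightarrow> A1 V c2"
  shows "A_const p r s (\<lambda>x. K x powr (- g) * V x powr b) \<le> ennreal (pow0 c1 g * pow0 c2 b)"
  unfolding A_const_def
proof (rule SUP_least)
  fix Q :: "(real ^ 'd) set" assume Q: "Q \<in> cubes"
  obtain q where q: "0 < q" "emeasure lebesgue Q = ennreal q" "measure lebesgue Q = q" and [measurable]: "Q \<in> sets lebesgue"
    by (rule cubesE[OF Q])
  note [measurable] = nonneg_measD(1)[OF K(1)] nonneg_measD(1)[OF V(1)]
  have p0: "p \<noteq> 0" "s \<noteq> 0" using r by auto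
  have "1 / p - 1 / s = ennreal b"
    unfolding one_div_ennreal[OF p0(1)] one_div_ennreal[OF p0(2)] b(1) by (simp add: ennreal_minus rcp_nonneg)
  moreover have "1 / ennreal r - 1 / p = ennreal g"
    using r(1) unfolding one_div_ennreal[OF p0(1)] g(1) by (simp add: ennreal_minus rcp_nonneg divide_ennreal flip: ennreal_1)
  ultimately have ex: "1 / (1 / p - 1 / s) = 1 / ennreal b" "1 / (1 / ennreal r - 1 / p) = 1 / ennreal g" by simp_all
  \<comment> \<open>Treats \<open>K\<close> and \<open>V\<close> alike: \<open>J\<close> is the
    integral over \<open>Q\<close>, and \<open>D\<close> bounds the negative power, since
    \<open>W\<close> is at least \<open>J / (c * q)\<close> on \<open>Q\<close>. For
    \<open>h = 0\<close> both may be 1.\<close>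
  have main: "\<exists>J D. 0 < J \<and> 0 \<le> D \<and> (h \<noteq> 0 \<longrightarrow> (\<integral>\<^sup>+y\<in>Q. ennreal (W y) \<partial>lebesgue) = ennreal J) \<and>
      (AE x in lebesgue. x \<in> Q \<longrightarrow> W x powr (- h) \<le> D) \<and> D * pow0 J h = pow0 c h * q powr h"
    if W: "W \<in> nonneg_meas lebesgue" "AE x in lebesgue. 0 < W x" and h: "0 \<le> h" and c: "0 < c" "h \<noteq> 0 \<Longrightarrow> A1 W c"
    for W :: "real ^ 'd \<Rightarrow> real" and h c
  proof (cases "h = 0")
    case True
    have "AE x in lebesgue. x \<in> Q \<longrightarrow> W x powr (- h) \<le> 1" using W(2) by eventually_elim (simp add: True)
    then show ?thesis using True q by (intro exI[of _ 1]) (simp add: pow0_def)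
  next
    case False
    then have h: "0 < h" using h by simp
    have pos: "0 < (\<integral>\<^sup>+y\<in>Q. ennreal (W y) \<partial>lebesgue)"
      by (rule cube_integral_pos[OF Q nonneg_measD(1)[OF W(1)] W(2)])
    have AEle: "AE x in lebesgue. x \<in> Q \<longrightarrow> (\<integral>\<^sup>+y\<in>Q. ennreal (W y) \<partial>lebesgue) \<le> ennreal (c * W x) * ennreal q"
      using c(2)[OF False] Q unfolding A1_def q(2)[symmetric] by blast
    \<comment> \<open>One point of \<open>Q\<close> where the $A_1$ inequality holds is enough,
      \<open>W\<close> being real valued; such a point exists because \<open>Q\<close> has positive
      measure.\<close>
    have fin: "(\<integral>\<^sup>+y\<in>Q. ennreal (W y) \<partial>lebesgue) < top"
    proof (rule ccontr)
      assume inf: "\<not> ?thesis"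
      from AEle have "AE x in lebesgue. x \<notin> Q"
      proof eventually_elim
        case (elim x)
        show ?case
        proof
          assume "x \<in> Q"
          with elim have "(\<integral>\<^sup>+y\<in>Q. ennreal (W y) \<partial>lebesgue) \<le> ennreal (c * W x) * ennreal q" by blast
          also have "\<dots> < top" by (simp add: ennreal_mult_less_top)
          finally show False using inf by blast
        qed
      qed
      then have "emeasure lebesgue Q = 0" by (subst (asm) AE_iff_measurable[where N=Q]) auto
      with q show False by simp
    qed
    then obtain J where J: "(\<integral>\<^sup>+y\<in>Q. ennreal (W y) \<partial>lebesgue) = ennreal J" "0 < J"
      using pos by (cases "\<integral>\<^sup>+y\<in>Q. ennreal (W y) \<partial>lebesgue") auto
    define D where "D = (J / (c * q)) powr (- h)"
    have "AE x in lebesgue. x \<in> Q \<longrightarrow> W x powr (- h) \<le> D"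
      using AEle W(2)
    proof eventually_elim
      case (elim x)
      show ?case
      proof
        assume "x \<in> Q"
        then have "ennreal J \<le> ennreal (c * W x * q)"
          using elim J c(1) q(1) by (simp add: ennreal_mult)
        then have "J \<le> c * W x * q" using elim c(1) q(1) by (subst (asm) ennreal_le_iff) auto
        then have "J / (c * q) \<le> W x" using c(1) q(1) by (simp add: pos_divide_le_eq ac_simps)
        then show "W x powr (- h) \<le> D"
          unfolding D_def using J c(1) q(1) h by (intro powr_mono2') auto
      qed
    qed
    moreover have "D * pow0 J h = pow0 c h * q powr h"
      using J(2) c(1) q(1) h by (simp add: D_def pow0_def powr_minus powr_divide powr_mult)
    moreover have "0 \<le> D" by (simp add: D_def)
    ultimately show ?thesis using J by (intro exI[of _ J] exI[of _ D]) simp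
  qed
  obtain J1 D1 where 1: "0 < J1" "0 \<le> D1" "g \<noteq> 0 \<Longrightarrow> (\<integral>\<^sup>+y\<in>Q. ennreal (K y) \<partial>lebesgue) = ennreal J1"
      "AE x in lebesgue. x \<in> Q \<longrightarrow> K x powr (- g) \<le> D1" "D1 * pow0 J1 g = pow0 c1 g * q powr g"
    using main[OF K g(2) c1] by auto
  obtain J2 D2 where 2: "0 < J2" "0 \<le> D2" "b \<noteq> 0 \<Longrightarrow> (\<integral>\<^sup>+y\<in>Q. ennreal (V y) \<partial>lebesgue) = ennreal J2"
      "AE x in lebesgue. x \<in> Q \<longrightarrow> V x powr (- b) \<le> D2" "D2 * pow0 J2 b = pow0 c2 b * q powr b"
    using main[OF V b(2) c2] by auto
  let ?w = "\<lambda>x. K x powr (- g) * V x powr b"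
  have n1: "Lp_norm lebesgue (1 / ennreal b) (\<lambda>x. ?w x * indicator Q x) \<le> ennreal (D1 * pow0 J2 b)"
  proof (rule Lp_norm_cube_le[OF Q b(2) 1(2) _ V _ _ 2(3)])
    show "AE x in lebesgue. x \<in> Q \<longrightarrow> 0 \<le> ?w x \<and> ?w x \<le> D1 * V x powr b"
      using 1(4) by eventually_elim (auto intro: mult_right_mono)
  qed (use 2(1) in auto)
  have n2: "Lp_norm lebesgue (1 / ennreal g) (\<lambda>x. inverse (?w x) * indicator Q x) \<le> ennreal (D2 * pow0 J1 g)"
  proof (rule Lp_norm_cube_le[OF Q g(2) 2(2) _ K _ _ 1(3)])
    show "AE x in lebesgue. x \<in> Q \<longrightarrow> 0 \<le> inverse (?w x) \<and> inverse (?w x) \<le> D2 * K x powr g"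
      using 2(4) K(2) V(2)
      by eventually_elim (auto simp: powr_minus inverse_mult_distrib mult.commute[of _ "inverse _"] intro!: mult_right_mono)
  qed (use 1(1) in auto)
  have "ennreal (measure lebesgue Q powr (- (1 / r - rcp s))) *
      Lp_norm lebesgue (1 / (1 / p - 1 / s)) (\<lambda>x. ?w x * indicator Q x) *
      Lp_norm lebesgue (1 / (1 / ennreal r - 1 / p)) (\<lambda>x. inverse (?w x) * indicator Q x)
    \<le> ennreal (q powr (- (g + b))) * ennreal (D1 * pow0 J2 b) * ennreal (D2 * pow0 J1 g)"
    unfolding ex q(3) using n1 n2 by (intro mult_mono) (auto simp: g(1) b(1))
  also have "\<dots> = ennreal (q powr (- (g + b)) * (D1 * pow0 J2 b) * (D2 * pow0 J1 g))"
    using 1(2) 2(2) by (simp add: pow0_nonneg ennreal_mult)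
  also have "q powr (- (g + b)) * (D1 * pow0 J2 b) * (D2 * pow0 J1 g)
      = q powr (- (g + b)) * (D1 * pow0 J1 g) * (D2 * pow0 J2 b)" by simp
  also have "\<dots> = (q powr (- (g + b)) * q powr g * q powr b) * (pow0 c1 g * pow0 c2 b)"
    unfolding 1(5) 2(5) by simp
  also have "q powr (- (g + b)) * q powr g * q powr b = 1"
    using q(1) by (simp flip: powr_add)
  finally show "ennreal (measure lebesgue Q powr (- (1 / r - rcp s))) *
      Lp_norm lebesgue (1 / (1 / p - 1 / s)) (\<lambda>x. ?w x * indicator Q x) *
      Lp_norm lebesgue (1 / (1 / ennreal r - 1 / p)) (\<lambda>x. inverse (?w x) * indicator Q x)
    \<le> ennreal (pow0 c1 g * pow0 c2 b)" by simp
qed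

section \<open>Extrapolation\<close>

lemma pow0_mult: "0 \<le> x \<Longrightarrow> 0 \<le> y \<Longrightarrow> pow0 (x * y) b = pow0 x b * pow0 y b"
  by (simp add: pow0_def powr_mult)

lemma pow0_sum:
  assumes "finite A" "\<And>i. i \<in> A \<Longrightarrow> 0 \<le> b i"
  shows "pow0 x (\<Sum>i\<in>A. b i) = (\<Prod>i\<in>A. pow0 x (b i))"
  using assms
proof (induction A rule: finite_induct)
  case (insert i A)
  have "0 \<le> (\<Sum>i\<in>A. b i)" using insert.prems by (intro sum_nonneg) auto
  moreover have "0 \<le> b i" using insert.prems by auto
  ultimately have "pow0 x (b i + (\<Sum>i\<in>A. b i)) = pow0 x (b i) * pow0 x (\<Sum>i\<in>A. b i)"
    by (auto simp: pow0_def powr_add)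
  with insert show ?case by simp
qed (simp add: pow0_def)

text \<open>The factorization theorem for \<open>(H / D) powr P\<close>, with exponents
  \<open>\<beta> j * P\<close> for the given balls and \<open>\<sigma> * P\<close> for the constant
  1, whose polar supplies \<open>a\<close>.\<close>

lemma product_factorization:
  fixes B :: "'m::finite \<Rightarrow> ('a \<Rightarrow> real) set" and \<beta> :: "'m \<Rightarrow> real" and \<sigma> P D D' :: real
  assumes "sigma_finite_measure M"
    and B: "\<And>j. function_ball M (B j)" and pos: "\<And>j. u j \<in> B j" "\<And>j. AE x in M. 0 < u j x"
    and \<beta>: "\<And>j. 0 \<le> \<beta> j" and \<sigma>: "0 \<le> \<sigma>" and P: "0 < P" "P * ((\<Sum>j\<in>UNIV. \<beta> j) + \<sigma>) = 1"
    and H: "H \<in> nonneg_meas M" and D: "0 < D" "D < D'"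
    and le: "\<And>v. (\<And>j. v j \<in> B j) \<Longrightarrow> (\<And>j. AE x in M. 0 < v j x) \<Longrightarrow>
      (\<integral>\<^sup>+x. ennreal ((H x * (\<Prod>j\<in>UNIV. v j x powr \<beta> j)) powr P) \<partial>M) \<le> ennreal (D powr P)"
  obtains y a where "\<And>j. y j \<in> polar M (B j)" "a \<in> nonneg_meas M" "(\<integral>\<^sup>+x. ennreal (a x) \<partial>M) \<le> 1"
    "AE x in M. H x \<le> D' * ((\<Prod>j\<in>UNIV. pow0 (y j x) (\<beta> j)) * pow0 (a x) \<sigma>)"
proof -
  interpret sigma_finite_measure M by fact
  define J where "J = {j. 0 < \<beta> j}"
  define N where "N = (if 0 < \<sigma> then {None} else ({} :: 'm option set))"
  define I where "I = Some ` J \<union> N"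
  define b where "b i = (case i of Some j \<Rightarrow> \<beta> j | None \<Rightarrow> \<sigma>)" for i
  define \<theta> where "\<theta> i = b i * P" for i
  define V where "V i = (case i of Some j \<Rightarrow> {f \<in> B j. AE x in M. 0 < f x} | None \<Rightarrow> {\<lambda>x. 1})" for i
  define F where "F x = (H x / D) powr P" for x
  have H0: "0 \<le> H x" for x by (rule nonneg_measD(2)[OF H])
  have [measurable]: "H \<in> borel_measurable M" by (rule nonneg_measD(1)[OF H])
  have split_I: "(\<Prod>i\<in>I. f i) = (\<Prod>j\<in>J. f (Some j)) * (\<Prod>i\<in>N. f i)" for f :: "'m option \<Rightarrow> real"
    unfolding I_def by (subst prod.union_disjoint) (auto simp: N_def prod.reindex)
  have sum_J: "(\<Sum>j\<in>J. \<beta> j) = (\<Sum>j\<in>UNIV. \<beta> j)"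
    using \<beta> by (intro sum.mono_neutral_left) (auto simp: J_def order_less_le)
  have sum_I: "(\<Sum>i\<in>I. b i) = (\<Sum>j\<in>UNIV. \<beta> j) + \<sigma>"
    unfolding I_def using \<sigma> by (subst sum.union_disjoint) (auto simp: N_def sum.reindex b_def sum_J)
  have b_pos: "0 < b i" if "i \<in> I" for i
    using that by (auto simp: I_def J_def N_def b_def split: if_splits)
  have F_eq: "(H x * k) powr P = D powr P * (F x * k powr P)" if "0 \<le> k" for x k
    using that H0[of x] D(1) by (simp add: F_def powr_mult powr_divide)
  interpret G: geometric_mean_problem M I \<theta> V F
  proof
    show "finite I" by simp
    show "0 < \<theta> i" if "i \<in> I" for i using b_pos[OF that] P by (simp add: \<theta>_def)
    show "(\<Sum>i\<in>I. \<theta> i) = 1"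
      using P(2) unfolding \<theta>_def sum_distrib_right[symmetric] sum_I by (simp add: mult.commute)
    show "V i \<subseteq> nonneg_meas M" for i
      using solid_ball.nonneg_meas[OF function_ball.axioms(1)[OF B]]
      by (auto simp: V_def nonneg_meas_def split: option.splits)
    show "V i \<noteq> {}" for i using pos by (auto simp: V_def split: option.splits)
    show "AE x in M. 0 < v x" if "v \<in> V i" for i v using that by (auto simp: V_def split: option.splits)
    show "(\<lambda>x. a * v x + (1 - a) * w x) \<in> V i" if "v \<in> V i" "w \<in> V i" "0 \<le> a" "a \<le> 1" for i v w a
    proof (cases i)
      case (Some j)
      then show ?thesis using function_ball.positive_part_convex[OF B, of v j w a] that by (simp add: V_def)
    qed (use that in \<open>auto simp: V_def\<close>)
    show "F \<in> nonneg_meas M" unfolding F_def[abs_def] by (auto simp: nonneg_meas_def)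
    show "(\<integral>\<^sup>+x. ennreal (F x * (\<Prod>i\<in>I. v i x powr \<theta> i)) \<partial>M) \<le> 1" if v: "\<And>i. i \<in> I \<Longrightarrow> v i \<in> V i" for v
    proof -
      \<comment> \<open>The hypothesis wants a function for every \<open>j\<close>; discarded
        indices receive \<open>u j\<close>, whose power with exponent 0 is 1 almost
        everywhere.\<close>
      define v' where "v' j = (if j \<in> J then v (Some j) else u j)" for j
      have v': "v' j \<in> B j \<and> (AE x in M. 0 < v' j x)" for j
        using v[of "Some j"] pos[of j] by (auto simp: v'_def I_def V_def)
      have m [measurable]: "v' j \<in> borel_measurable M" for j
        using solid_ball.measurable[OF function_ball.axioms(1)[OF B]] v' by blast
      have "AE x in M. \<forall>j\<in>UNIV. 0 < v' j x" using v' by (subst AE_finite_all) auto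
      then have eq: "AE x in M. (\<Prod>i\<in>I. v i x powr \<theta> i) = (\<Prod>j\<in>UNIV. v' j x powr \<beta> j) powr P"
      proof eventually_elim
        case (elim x)
        have "(\<Prod>j\<in>UNIV. v' j x powr \<beta> j) powr P = (\<Prod>j\<in>UNIV. v' j x powr (\<beta> j * P))"
          by (simp add: prod_powr_distrib powr_powr)
        also have "\<dots> = (\<Prod>j\<in>J. v' j x powr (\<beta> j * P))"
          using elim \<beta> by (intro prod.mono_neutral_right) (auto simp: J_def order_less_le)
        also have "\<dots> = (\<Prod>j\<in>J. v (Some j) x powr \<theta> (Some j))"
          by (intro prod.cong) (auto simp: v'_def \<theta>_def b_def)
        also have "\<dots> = (\<Prod>i\<in>I. v i x powr \<theta> i)"
          using v[of None] unfolding split_I by (auto simp: N_def V_def I_def)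
        finally show ?case by simp
      qed
      have "ennreal (D powr P) * (\<integral>\<^sup>+x. ennreal (F x * (\<Prod>j\<in>UNIV. v' j x powr \<beta> j) powr P) \<partial>M)
          = (\<integral>\<^sup>+x. ennreal (D powr P) * ennreal (F x * (\<Prod>j\<in>UNIV. v' j x powr \<beta> j) powr P) \<partial>M)"
        unfolding F_def by (rule nn_integral_cmult[symmetric]) measurable
      also have "\<dots> = (\<integral>\<^sup>+x. ennreal ((H x * (\<Prod>j\<in>UNIV. v' j x powr \<beta> j)) powr P) \<partial>M)"
        by (intro nn_integral_cong) (simp add: F_eq prod_nonneg flip: ennreal_mult')
      also have "\<dots> \<le> ennreal (D powr P)" using v' by (intro le) auto
      finally have "ennreal (1 / D powr P) * (ennreal (D powr P) * (\<integral>\<^sup>+x. ennreal (F x * (\<Prod>j\<in>UNIV. v' j x powr \<beta> j) powr P) \<partial>M))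
          \<le> ennreal (1 / D powr P) * ennreal (D powr P)" by (rule mult_left_mono) simp
      then have "(\<integral>\<^sup>+x. ennreal (F x * (\<Prod>j\<in>UNIV. v' j x powr \<beta> j) powr P) \<partial>M) \<le> 1"
        using D(1) by (simp add: mult.assoc[symmetric] flip: ennreal_mult)
      moreover have "(\<integral>\<^sup>+x. ennreal (F x * (\<Prod>i\<in>I. v i x powr \<theta> i)) \<partial>M)
          = (\<integral>\<^sup>+x. ennreal (F x * (\<Prod>j\<in>UNIV. v' j x powr \<beta> j) powr P) \<partial>M)"
        using eq by (intro nn_integral_cong_AE) (auto elim!: eventually_mono)
      ultimately show ?thesis by simp
    qed
  qed
  define e where "e = (D' / D) powr P"
  have e: "1 < e" unfolding e_def using D P by (intro gr_one_powr) auto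
  obtain z where z: "\<And>i. i \<in> I \<Longrightarrow> z i \<in> polar M (V i)" "AE x in M. F x \<le> e * (\<Prod>i\<in>I. z i x powr \<theta> i)"
    using G.factorization[OF e] by blast
  \<comment> \<open>The zero function is a safe filler: at a discarded index \<open>pow0\<close>
    gives 1.\<close>
  define y where "y j = (if j \<in> J then z (Some j) else (\<lambda>x. 0))" for j
  define a where "a = (if 0 < \<sigma> then z None else (\<lambda>x. 0))"
  show ?thesis
  proof (rule that)
    show "y j \<in> polar M (B j)" for j
    proof (cases "j \<in> J")
      case True
      then have "z (Some j) \<in> polar M {f \<in> B j. AE x in M. 0 < f x}"
        using z(1)[of "Some j"] by (simp add: I_def V_def)
      then show ?thesis
        using function_ball.polar_positive_part[OF B pos] True by (simp add: y_def)
    qed (simp add: y_def polar_def nonneg_meas_def)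
    have a: "a \<in> nonneg_meas M \<and> (\<integral>\<^sup>+x. ennreal (a x) \<partial>M) \<le> 1"
    proof (cases "0 < \<sigma>")
      case True
      then have "z None \<in> polar M {\<lambda>x. 1}" using z(1)[of None] by (simp add: I_def N_def V_def)
      then show ?thesis using True by (simp add: a_def polar_def)
    qed (simp add: a_def nonneg_meas_def)
    then show "a \<in> nonneg_meas M" "(\<integral>\<^sup>+x. ennreal (a x) \<partial>M) \<le> 1" by auto
    show "AE x in M. H x \<le> D' * ((\<Prod>j\<in>UNIV. pow0 (y j x) (\<beta> j)) * pow0 (a x) \<sigma>)"
      using z(2)
    proof eventually_elim
      case (elim x)
      have "F x powr (1 / P) \<le> (e * (\<Prod>i\<in>I. z i x powr \<theta> i)) powr (1 / P)"
        using elim P(1) by (intro powr_mono2) (auto simp: F_def)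
      also have "\<dots> = (D' / D) * (\<Prod>i\<in>I. z i x powr b i)"
        using P(1) D by (simp add: powr_mult prod_nonneg e_def powr_powr prod_powr_distrib \<theta>_def)
      also have "(\<Prod>i\<in>I. z i x powr b i) = (\<Prod>j\<in>UNIV. pow0 (y j x) (\<beta> j)) * pow0 (a x) \<sigma>"
      proof -
        have "(\<Prod>j\<in>UNIV. pow0 (y j x) (\<beta> j)) = (\<Prod>j\<in>J. pow0 (y j x) (\<beta> j))"
          using \<beta> by (intro prod.mono_neutral_right) (auto simp: J_def pow0_def order_less_le)
        also have "\<dots> = (\<Prod>j\<in>J. z (Some j) x powr b (Some j))"
          by (intro prod.cong) (auto simp: y_def b_def pow0_def J_def)
        finally show ?thesis
          using \<sigma> unfolding split_I by (auto simp: N_def a_def pow0_def b_def)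
      qed
      also have "F x powr (1 / P) = H x / D" using P(1) D(1) H0[of x] by (simp add: F_def powr_powr)
      finally show ?case using D(1) by (simp add: field_simps)
    qed
  qed
qed

lemma Lp_norm_leD:
  assumes q: "0 < q" and C: "0 \<le> C" and le: "Lp_norm M (ennreal q) f \<le> ennreal C"
  shows "(\<integral>\<^sup>+x. ennreal (norm (f x) powr q) \<partial>M) \<le> ennreal (C powr q)"
proof (cases "(\<integral>\<^sup>+x. ennreal (norm (f x) powr q) \<partial>M) = top")
  case True
  then show ?thesis using le q by (simp add: Lp_norm_def Let_def top_unique)
next
  case False
  then obtain J where J: "0 \<le> J" "(\<integral>\<^sup>+x. ennreal (norm (f x) powr q) \<partial>M) = ennreal J"
    by (cases "\<integral>\<^sup>+x. ennreal (norm (f x) powr q) \<partial>M") auto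
  then have "J powr (1 / q) \<le> C" using le q C by (simp add: Lp_norm_def Let_def)
  then have "(J powr (1 / q)) powr q \<le> C powr q" using q by (intro powr_mono2) auto
  then show ?thesis using J q by (simp add: powr_powr ennreal_leI)
qed

lemma rcp_antimono: "0 < a \<Longrightarrow> a \<le> b \<Longrightarrow> rcp b \<le> rcp a"
proof (cases b)
  case (real y)
  assume ab: "0 < a" "a \<le> b"
  then obtain x where x: "a = ennreal x" "0 \<le> x" using real by (cases a) (auto simp: top_unique)
  then have "0 < x" "x \<le> y" using ab real by auto
  then show ?thesis using x real by (simp add: rcp_ennreal frac_le)
qed (simp add: rcp_nonneg)

section \<open>One space: majorants, weights and recombination\<close>

locale extrapolation_space = convex_concave_space lebesgue X r s
  for X :: "(real ^ 'd, 'k::{real_normed_field, euclidean_space}) fspace" and r s +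
  fixes p :: ennreal
  assumes rp: "ennreal r \<le> p" and ps: "p \<le> s"
    and max_Y: "p \<noteq> ennreal r \<Longrightarrow> maximal_bounded (fs_rs lebesgue X r s)"
    and max_Y': "p \<noteq> s \<Longrightarrow> maximal_bounded (kothe_dual lebesgue (fs_rs lebesgue X r s))"
begin

definition \<gamma> :: real where "\<gamma> = 1 / r - rcp p"
definition \<beta> :: real where "\<beta> = rcp p - \<sigma>"
definition NY :: real where "NY = maximal_norm (fs_rs lebesgue X r s)"
definition NY' :: real where "NY' = maximal_norm (kothe_dual lebesgue (fs_rs lebesgue X r s))"

lemma \<gamma>_nn: "0 \<le> \<gamma>" and \<beta>_nn: "0 \<le> \<beta>"
proof -
  have p: "0 < p" using r rp by (metis ennreal_less_zero_iff order_less_le_trans)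
  have "rcp p \<le> rcp (ennreal r)" using r rp by (intro rcp_antimono) auto
  then show "0 \<le> \<gamma>" using r by (simp add: \<gamma>_def rcp_ennreal)
  show "0 \<le> \<beta>" using rcp_antimono[OF p ps] by (simp add: \<beta>_def)
qed

lemma \<gamma>_\<beta>: "\<gamma> + \<beta> = 1 / r - \<sigma>" by (simp add: \<gamma>_def \<beta>_def)

lemma \<gamma>_ne: "\<gamma> \<noteq> 0 \<Longrightarrow> p \<noteq> ennreal r" using r by (auto simp: \<gamma>_def rcp_ennreal)

lemma \<beta>_ne: "\<beta> \<noteq> 0 \<Longrightarrow> p \<noteq> s" by (auto simp: \<beta>_def)

text \<open>\<open>K / 2\<close> occurs because the iteration doubles the norm. The $A_1$ condition
  is tied to a nonzero exponent because only then is the maximal operator known to be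
  bounded.\<close>

definition good_K :: "(real ^ 'd \<Rightarrow> real) \<Rightarrow> bool" where
  "good_K K \<longleftrightarrow> K \<in> nonneg_meas lebesgue \<and> (AE x in lebesgue. 0 < K x) \<and> (\<lambda>x. K x / 2) \<in> BY \<and>
     (\<gamma> \<noteq> 0 \<longrightarrow> A1 K (2 * NY))"

definition good_V :: "(real ^ 'd \<Rightarrow> real) \<Rightarrow> bool" where
  "good_V V \<longleftrightarrow> V \<in> nonneg_meas lebesgue \<and> (AE x in lebesgue. 0 < V x) \<and> (\<lambda>x. V x / 2) \<in> BY' \<and>
     (\<beta> \<noteq> 0 \<longrightarrow> A1 V (2 * NY'))"

text \<open>The common part of the two majorants below. For exponent \<open>c = 0\<close> no $A_1$
  condition is asked, and \<open>k\<close> is its own majorant.\<close>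

lemma positive_majorant:
  assumes B: "function_ball lebesgue B" and k: "k \<in> B" "AE x in lebesgue. 0 < k x"
    and ex: "c \<noteq> (0::real) \<Longrightarrow> \<exists>K. (\<lambda>x. K x / 2) \<in> B \<and> (AE x in lebesgue. k x \<le> K x) \<and> A1 K N"
  shows "\<exists>K. K \<in> nonneg_meas lebesgue \<and> (AE x in lebesgue. 0 < K x) \<and> (\<lambda>x. K x / 2) \<in> B \<and>
     (c \<noteq> 0 \<longrightarrow> A1 K N) \<and> (AE x in lebesgue. k x \<le> K x)"
proof -
  interpret B: function_ball lebesgue B by fact
  have "\<exists>K. (\<lambda>x. K x / 2) \<in> B \<and> (AE x in lebesgue. k x \<le> K x) \<and> (c \<noteq> 0 \<longrightarrow> A1 K N)"
  proof (cases "c = 0")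
    case True
    then show ?thesis using B.scale[OF k(1), of "1/2"] by (intro exI[of _ k]) simp
  qed (use ex in blast)
  then obtain K where K: "(\<lambda>x. K x / 2) \<in> B" "AE x in lebesgue. k x \<le> K x" "c \<noteq> 0 \<longrightarrow> A1 K N" by blast
  have "(\<lambda>x. 2 * (K x / 2)) \<in> borel_measurable lebesgue"
    by (intro borel_measurable_times borel_measurable_const B.measurable[OF K(1)])
  then have "K \<in> nonneg_meas lebesgue"
    using B.nonneg[OF K(1)] by (simp add: nonneg_meas_def)
  moreover have "AE x in lebesgue. 0 < K x" using k(2) K(2) by eventually_elim simp
  ultimately show ?thesis using K by auto
qed

lemma K_majorant:
  assumes k: "k \<in> BY" "AE x in lebesgue. 0 < k x"
  shows "\<exists>K. good_K K \<and> (AE x in lebesgue. k x \<le> K x)"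
proof -
  have "\<exists>K. (\<lambda>x. K x / 2) \<in> BY \<and> (AE x in lebesgue. k x \<le> K x) \<and> A1 K (2 * NY)" if "\<gamma> \<noteq> 0"
    using A1_majorant[OF fs_ball_rs BY_ball max_Y[OF \<gamma>_ne[OF that]] k] unfolding NY_def by blast
  from positive_majorant[OF BY_ball k this] show ?thesis unfolding good_K_def by blast
qed

lemma V_majorant:
  assumes v: "v \<in> BY'" "AE x in lebesgue. 0 < v x"
  shows "\<exists>V. good_V V \<and> (AE x in lebesgue. v x \<le> V x)"
proof -
  have "\<exists>K. (\<lambda>x. K x / 2) \<in> BY' \<and> (AE x in lebesgue. v x \<le> K x) \<and> A1 K (2 * NY')" if "\<beta> \<noteq> 0"
    using A1_majorant[OF fs_ball_rs_dual BY'_ball max_Y'[OF \<beta>_ne[OF that]] v] unfolding NY'_def by blast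
  from positive_majorant[OF BY'_ball v this] show ?thesis unfolding good_V_def by blast
qed

definition wt :: "(real ^ 'd \<Rightarrow> real) \<Rightarrow> (real ^ 'd \<Rightarrow> real) \<Rightarrow> real ^ 'd \<Rightarrow> real" where
  "wt K V x = K x powr (- \<gamma>) * V x powr \<beta>"

definition CA :: real where
  "CA = 2 powr (1 / r - \<sigma>) * pow0 NY \<gamma> * pow0 NY' \<beta>"

lemma CA_nn: "0 \<le> CA" by (simp add: CA_def pow0_nonneg)

lemma wt_A_class:
  assumes K: "good_K K" and V: "good_V V"
  shows "wt K V \<in> A_class p r s" "A_const p r s (wt K V) \<le> ennreal CA"
proof -
  \<comment> \<open>For \<open>\<gamma> = 0\<close> the value \<open>NY\<close> is possibly
    unspecified; any positive constant may replace it, as \<open>pow0\<close> makes the factor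
    1.\<close>
  define c1 where "c1 = (if \<gamma> = 0 then 1 else 2 * NY)"
  define c2 where "c2 = (if \<beta> = 0 then 1 else 2 * NY')"
  obtain y where y: "y \<in> BY" "AE x in lebesgue. 0 < y x" by (rule BY_positive)
  obtain z where z: "z \<in> BY'" "AE x in lebesgue. 0 < z x" by (rule BY'_positive)
  have NY: "0 < NY" if "\<gamma> \<noteq> 0"
    unfolding NY_def by (rule maximal_norm_pos[OF fs_ball_rs BY_ball max_Y[OF \<gamma>_ne[OF that]] y])
  have NY': "0 < NY'" if "\<beta> \<noteq> 0"
    unfolding NY'_def by (rule maximal_norm_pos[OF fs_ball_rs_dual BY'_ball max_Y'[OF \<beta>_ne[OF that]] z])
  have "A_const p r s (\<lambda>x. K x powr (- \<gamma>) * V x powr \<beta>) \<le> ennreal (pow0 c1 \<gamma> * pow0 c2 \<beta>)"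
    using K V NY NY' \<gamma>_nn \<beta>_nn unfolding good_K_def good_V_def
    by (intro A_const_le[OF r rp ps]) (auto simp: c1_def c2_def \<gamma>_def[symmetric] \<beta>_def[symmetric])
  moreover have "pow0 c1 \<gamma> * pow0 c2 \<beta> = CA"
  proof -
    have 1: "pow0 c1 \<gamma> = 2 powr \<gamma> * pow0 NY \<gamma>"
      using NY by (cases "\<gamma> = 0") (auto simp: c1_def pow0_def powr_mult)
    have 2: "pow0 c2 \<beta> = 2 powr \<beta> * pow0 NY' \<beta>"
      using NY' by (cases "\<beta> = 0") (auto simp: c2_def pow0_def powr_mult)
    show ?thesis unfolding 1 2 CA_def \<gamma>_\<beta>[symmetric] by (simp add: powr_add)
  qed
  ultimately show *: "A_const p r s (wt K V) \<le> ennreal CA" by (simp add: wt_def[abs_def])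
  have "AE x in lebesgue. 0 < K x" "AE x in lebesgue. 0 < V x" using K V by (auto simp: good_K_def good_V_def)
  then have "AE x in lebesgue. 0 < wt K V x" by eventually_elim (simp add: wt_def)
  moreover have "wt K V \<in> borel_measurable lebesgue"
    using K V unfolding good_K_def good_V_def nonneg_meas_def wt_def[abs_def] by auto
  ultimately have "weight (wt K V)" by (simp add: weight_def)
  then show "wt K V \<in> A_class p r s"
    using order_le_less_trans[OF * ennreal_less_top] by (simp add: A_class_def)
qed

text \<open>The decisive order of choices: \<open>K\<close> depends on \<open>f\<close> alone, and
  the bound holds for all \<open>V\<close> at once. The factor \<open>2 powr \<beta>\<close> comes
  from \<open>V / 2\<close> being the element of the dual ball.\<close>

lemma Lpw_bound:
  assumes f: "f \<in> fs_carrier X" and c: "fs_norm X f < c"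
  obtains K where "good_K K" "\<And>V. good_V V \<Longrightarrow> Lpw_norm p (wt K V) f \<le> ennreal (c * 2 powr \<beta>)"
proof -
  obtain k a where k: "k \<in> BY" "AE x in lebesgue. 0 < k x" and a: "a \<in> nonneg_meas lebesgue" "(\<integral>\<^sup>+x. ennreal (a x) \<partial>lebesgue) \<le> 1"
    and fle: "AE x in lebesgue. norm (f x) \<le> c * (k x powr (1 / r - \<sigma>) * pow0 (a x) \<sigma>)"
    by (rule BX_factorization[OF f c])
  obtain K where K: "good_K K" "AE x in lebesgue. k x \<le> K x" using K_majorant[OF k] by blast
  have c0: "0 < c" using qbfs_norm_nonneg[OF BFS f] c by simp
  have [measurable]: "f \<in> borel_measurable lebesgue" using qbfs_L0[OF BFS f] by (simp add: L0_def)
  note [measurable] = BY.measurable[OF k(1)] nonneg_measD(1)[OF a(1)]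
  have a0: "0 \<le> a x" for x by (rule nonneg_measD(2)[OF a(1)])
  have k0: "0 \<le> k x" for x by (rule BY.nonneg[OF k(1)])
  show ?thesis
  proof (rule that[OF K(1)])
    fix V assume V: "good_V V"
    have V0: "0 \<le> V x" for x using V by (simp add: good_V_def nonneg_meas_def)
    have [measurable]: "V \<in> borel_measurable lebesgue" "K \<in> borel_measurable lebesgue"
      using V K by (auto simp: good_V_def good_K_def nonneg_meas_def)
    have Vpos: "AE x in lebesgue. 0 < V x" and VB: "(\<lambda>x. V x / 2) \<in> BY'" using V by (auto simp: good_V_def)
    have m[measurable]: "wt K V \<in> borel_measurable lebesgue" unfolding wt_def[abs_def] by measurable
    have pt: "AE x in lebesgue. norm (f x * of_real (wt K V x)) \<le> c * (pow0 (k x * V x) \<beta> * pow0 (a x) \<sigma>)"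
      using fle k(2) K(2) Vpos
    proof eventually_elim
      case (elim x)
      have wt0: "0 \<le> wt K V x" by (simp add: wt_def)
      have "norm (f x * of_real (wt K V x)) = norm (f x) * wt K V x"
        using wt0 by (simp add: norm_mult)
      also have "\<dots> \<le> c * (k x powr (1 / r - \<sigma>) * pow0 (a x) \<sigma>) * (K x powr (- \<gamma>) * V x powr \<beta>)"
        unfolding wt_def using elim by (intro mult_right_mono) auto
      \<comment> \<open>The exponent of \<open>K\<close> is nonpositive, so \<open>K\<close> may be
        replaced by the smaller \<open>k\<close>; what remains of its power is
        \<open>\<beta>\<close>, matching that of \<open>V\<close>.\<close>
      also have "\<dots> \<le> c * (k x powr (1 / r - \<sigma>) * pow0 (a x) \<sigma>) * (k x powr (- \<gamma>) * V x powr \<beta>)"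
        using elim c0 \<gamma>_nn by (intro mult_left_mono mult_right_mono powr_mono2') (auto simp: pow0_nonneg)
      also have "\<dots> = c * ((k x powr (1 / r - \<sigma>) * k x powr (- \<gamma>) * V x powr \<beta>) * pow0 (a x) \<sigma>)"
        by simp
      also have "k x powr (1 / r - \<sigma>) * k x powr (- \<gamma>) * V x powr \<beta> = pow0 (k x * V x) \<beta>"
        using elim unfolding \<gamma>_\<beta>[symmetric] by (simp add: powr_mult pow0_pos flip: powr_add)
      finally show ?case .
    qed
    have int_kV: "(\<integral>\<^sup>+x. ennreal (k x * V x / 2) \<partial>lebesgue) \<le> 1"
      using polarD(2)[of "\<lambda>x. V x / 2" lebesgue BY k] VB k(1) by (simp add: BY'_def)
    show "Lpw_norm p (wt K V) f \<le> ennreal (c * 2 powr \<beta>)"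
    proof (cases "rcp p = 0")
      case True
      then have z: "\<sigma> = 0" "\<beta> = 0" using \<beta>_nn rcp_nonneg[of s] by (auto simp: \<beta>_def)
      have "p \<noteq> 0" using r rp by auto
      then have "1 / p = 0" using one_div_ennreal[of p] True by simp
      then have "p = top" by (simp add: ennreal_divide_eq_0_iff)
      have "AE x in lebesgue. norm (f x * of_real (wt K V x)) \<le> c"
        using pt by eventually_elim (simp add: z pow0_def)
      then have "Lp_norm lebesgue q (\<lambda>x. f x * of_real (wt K V x)) \<le> ennreal c" if "q = top" for q
        unfolding that by (intro Lp_norm_le_top) measurable
      from this[OF \<open>p = top\<close>] show ?thesis using c0 by (simp add: Lpw_norm_def z)
    next
      case False
      define P where "P = 1 / rcp p"
      have P: "0 < P" using False rcp_nonneg[of p] by (simp add: P_def)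
      have "p \<noteq> 0" "p \<noteq> top" using r rp False by auto
      then obtain p' where p': "0 < p'" "p = ennreal p'" by (cases p) auto
      then have pP: "p = ennreal P" by (simp add: P_def rcp_ennreal)
      have sum1: "\<beta> * P + \<sigma> * P = 1" using False by (simp add: \<beta>_def P_def field_simps)
      have "0 \<le> \<sigma> * P" using P rcp_nonneg[of s] by simp
      then have \<beta>P: "0 \<le> \<beta> * P" "\<beta> * P \<le> 1" using sum1 P \<beta>_nn by auto
      \<comment> \<open>Young's inequality with weights \<open>\<beta> * P\<close> and
        \<open>\<sigma> * P\<close> of sum 1 leads to \<open>k x * V x / 2\<close> and
        \<open>a x\<close>, both of integral at most 1.\<close>
      have "(\<integral>\<^sup>+x. ennreal (norm (f x * of_real (wt K V x)) powr P) \<partial>lebesgue)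
          \<le> (\<integral>\<^sup>+x. ennreal ((c * 2 powr \<beta>) powr P) * (ennreal (\<beta> * P) * ennreal (k x * V x / 2) + ennreal (1 - \<beta> * P) * ennreal (a x)) \<partial>lebesgue)"
      proof (rule nn_integral_mono_AE, use pt in eventually_elim)
        case (elim x)
        have "norm (f x * of_real (wt K V x)) powr P \<le> (c * (pow0 (k x * V x) \<beta> * pow0 (a x) \<sigma>)) powr P"
          using elim P by (intro powr_mono2) auto
        also have "k x * V x = 2 * (k x * V x / 2)" by simp
        also have "pow0 (2 * (k x * V x / 2)) \<beta> = 2 powr \<beta> * pow0 (k x * V x / 2) \<beta>"
          using k0[of x] V0[of x] by (subst pow0_mult) (auto simp: pow0_pos)
        also have "(c * (2 powr \<beta> * pow0 (k x * V x / 2) \<beta> * pow0 (a x) \<sigma>)) powr P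
            = (c * 2 powr \<beta>) powr P * (pow0 (k x * V x / 2) (\<beta> * P) * pow0 (a x) (\<sigma> * P))"
          using P c0 by (simp add: powr_mult pow0_nonneg pow0_powr)
        also have "\<dots> \<le> (c * 2 powr \<beta>) powr P * ((\<beta> * P) * (k x * V x / 2) + (\<sigma> * P) * a x)"
          using sum1 P k0[of x] V0[of x] a0[of x] \<beta>_nn rcp_nonneg[of s] by (intro mult_left_mono weighted_young) auto
        also have "\<sigma> * P = 1 - \<beta> * P" using sum1 by simp
        finally have "ennreal (norm (f x * of_real (wt K V x)) powr P)
            \<le> ennreal ((c * 2 powr \<beta>) powr P * ((\<beta> * P) * (k x * V x / 2) + (1 - \<beta> * P) * a x))"
          by (rule ennreal_leI)
        also have "\<dots> = ennreal ((c * 2 powr \<beta>) powr P) * (ennreal (\<beta> * P) * ennreal (k x * V x / 2) + ennreal (1 - \<beta> * P) * ennreal (a x))"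
        proof -
          have *: "0 \<le> \<beta> * P" "\<beta> * P \<le> 1" "0 \<le> k x * V x / 2"
            using \<beta>P k0[of x] V0[of x] by auto
          show ?thesis
            by (subst ennreal_convex_comb[OF *(1,2,3) a0, symmetric], rule ennreal_mult) (use * a0[of x] in auto)
        qed
        finally show ?case .
      qed
      also have "\<dots> = ennreal ((c * 2 powr \<beta>) powr P) * (ennreal (\<beta> * P) * (\<integral>\<^sup>+x. ennreal (k x * V x / 2) \<partial>lebesgue)
          + ennreal (1 - \<beta> * P) * (\<integral>\<^sup>+x. ennreal (a x) \<partial>lebesgue))"
        by (subst nn_integral_cmult, measurable, subst nn_integral_add, measurable, subst nn_integral_cmult, measurable, subst nn_integral_cmult, auto)
      also have "\<dots> \<le> ennreal ((c * 2 powr \<beta>) powr P) * (ennreal (\<beta> * P) * 1 + ennreal (1 - \<beta> * P) * 1)"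
        using int_kV a(2) by (intro mult_left_mono add_mono) auto
      also have "ennreal (\<beta> * P) * 1 + ennreal (1 - \<beta> * P) * 1 = 1"
        using \<beta>P by (simp flip: ennreal_plus)
      finally have "(\<integral>\<^sup>+x. ennreal (norm (f x * of_real (wt K V x)) powr P) \<partial>lebesgue) \<le> ennreal ((c * 2 powr \<beta>) powr P)" by simp
      then have "Lp_norm lebesgue q (\<lambda>x. f x * of_real (wt K V x)) \<le> ennreal (((c * 2 powr \<beta>) powr P) powr (1 / P))"
        if "q = ennreal P" for q
        unfolding that by (intro Lp_norm_le[OF P]) auto
      from this[OF pP] show ?thesis using P c0 by (simp add: Lpw_norm_def powr_powr)
    qed
  qed
qed

text \<open>With \<open>\<alpha> = 1 / r - \<sigma>\<close>, the geometric mean of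
  \<open>K / 2\<close> and \<open>y\<close> with weights \<open>\<gamma> / \<alpha>\<close> and
  \<open>\<beta> / \<alpha>\<close> lies below their arithmetic mean, hence in \<open>BY\<close>;
  its \<open>\<alpha>\<close>-th power and \<open>a\<close> are then combined by
  \<open>BX_product\<close>.\<close>

lemma synthesis:
  assumes K: "good_K K" and y: "y \<in> BY" and a: "a \<in> nonneg_meas lebesgue" "(\<integral>\<^sup>+x. ennreal (a x) \<partial>lebesgue) \<le> 1"
  shows "(\<lambda>x. (K x / 2) powr \<gamma> * pow0 (y x) \<beta> * pow0 (a x) \<sigma>) \<in> unit_ball lebesgue X"
proof -
  define \<alpha> where "\<alpha> = 1 / r - \<sigma>"
  have \<alpha>: "0 < \<alpha>" "\<gamma> / \<alpha> + \<beta> / \<alpha> = 1" using \<alpha>_pos \<gamma>_\<beta> by (auto simp: \<alpha>_def simp flip: add_divide_distrib)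
  have KB: "(\<lambda>x. K x / 2) \<in> BY" and K0: "0 \<le> K x" for x using K by (auto simp: good_K_def nonneg_meas_def)
  have y0: "0 \<le> y x" for x by (rule BY.nonneg[OF y])
  note [measurable] = BY.measurable[OF y] BY.measurable[OF KB] nonneg_measD(1)[OF a(1)]
  define k where "k x = pow0 (K x / 2) (\<gamma> / \<alpha>) * pow0 (y x) (\<beta> / \<alpha>)" for x
  have kB: "k \<in> BY"
  proof (rule BY.solid)
    show "(\<lambda>x. \<gamma> / \<alpha> * (K x / 2) + (1 - \<gamma> / \<alpha>) * y x) \<in> BY"
    proof (intro BY.convex KB y)
      show "0 \<le> \<gamma> / \<alpha>" using \<alpha>(1) \<gamma>_nn by simp
      have "0 \<le> \<beta> / \<alpha>" using \<alpha>(1) \<beta>_nn by simp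
      then show "\<gamma> / \<alpha> \<le> 1" using \<alpha>(2) by linarith
    qed
    have "1 - \<gamma> / \<alpha> = \<beta> / \<alpha>" using \<alpha> by simp
    then show "AE x in lebesgue. k x \<le> \<gamma> / \<alpha> * (K x / 2) + (1 - \<gamma> / \<alpha>) * y x"
      unfolding k_def using \<alpha> K0 y0 \<gamma>_nn \<beta>_nn by (intro AE_I2) (simp only:, intro weighted_young, auto)
    show "k \<in> nonneg_meas lebesgue" unfolding k_def[abs_def] by (auto simp: nonneg_meas_def pow0_nonneg)
  qed
  have "(\<lambda>x. k x powr \<alpha> * pow0 (a x) \<sigma>) \<in> BX" unfolding \<alpha>_def by (rule BX_product[OF kB a])
  then have "(\<lambda>x. (K x / 2) powr \<gamma> * pow0 (y x) \<beta> * pow0 (a x) \<sigma>) \<in> BX"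
  proof (rule BX.solid)
    show "(\<lambda>x. (K x / 2) powr \<gamma> * pow0 (y x) \<beta> * pow0 (a x) \<sigma>) \<in> nonneg_meas lebesgue"
      by (auto simp: nonneg_meas_def pow0_nonneg)
    have "(K x / 2) powr \<gamma> \<le> pow0 (K x / 2) \<gamma>" for x using K0[of x] by (auto simp: pow0_def)
    moreover have "k x powr \<alpha> = pow0 (K x / 2) \<gamma> * pow0 (y x) \<beta>" for x
      using \<alpha>(1) by (simp add: k_def powr_mult pow0_nonneg pow0_powr)
    ultimately show "AE x in lebesgue. (K x / 2) powr \<gamma> * pow0 (y x) \<beta> * pow0 (a x) \<sigma> \<le> k x powr \<alpha> * pow0 (a x) \<sigma>"
      by (intro AE_I2) (auto intro!: mult_right_mono simp: pow0_nonneg)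
  qed
  then show ?thesis by (simp add: BX_def)
qed

end

section \<open>The product of the spaces\<close>

lemma increasing_fun_mono:
  fixes \<phi> :: "('m::finite \<Rightarrow> real) \<Rightarrow> real"
  assumes \<phi>: "increasing_fun \<phi>" and t: "\<And>i. 0 \<le> t i" "\<And>i. t i \<le> u i"
  shows "\<phi> t \<le> \<phi> u"
proof -
  \<comment> \<open>\<open>increasing_fun\<close> permits raising one coordinate at a time.\<close>
  have "\<phi> t \<le> \<phi> (\<lambda>i. if i \<in> A then u i else t i)" for A
  proof (induction A rule: infinite_finite_induct)
    case (insert j A)
    let ?v = "\<lambda>i. if i \<in> A then u i else t i"
    have v: "\<forall>i. 0 \<le> ?v i" using t(1) order_trans[OF t] by simp
    have eq: "?v(j := u j) = (\<lambda>i. if i \<in> insert j A then u i else t i)" by auto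
    have "?v j \<le> u j" using insert.hyps t(2) by simp
    then have "\<phi> ?v \<le> \<phi> (?v(j := u j))"
      using \<phi>[unfolded increasing_fun_def, THEN conjunct2, THEN spec, of ?v, THEN spec, of j, THEN spec, of "u j"] v
      by (elim mp) (intro conjI)
    then show ?case using insert.IH unfolding eq by linarith
  qed auto
  from this[of UNIV] show ?thesis by simp
qed

lemma fs_prod_le:
  fixes X :: "'m::finite \<Rightarrow> ('a, 'k::{real_normed_field, euclidean_space}) fspace"
  assumes BFS: "\<And>j. quasi_BFS M (X j)" and g: "\<And>j. g j \<in> unit_ball M (X j)" and h: "h \<in> L0 M"
    and c: "0 \<le> c" and le: "AE x in M. norm (h x) \<le> c * (\<Prod>j\<in>UNIV. g j x)"
  shows "h \<in> fs_carrier (fs_prod M X)" "fs_norm (fs_prod M X) h \<le> c"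
proof -
  define W where "W = {g :: 'm \<Rightarrow> 'a \<Rightarrow> real.
      (\<forall>j. (AE x in M. 0 \<le> g j x) \<and> (\<lambda>x. of_real (g j x)) \<in> fs_carrier (X j)) \<and>
      (AE x in M. norm (h x) \<le> (\<Prod>j\<in>UNIV. g j x))}"
  \<comment> \<open>The constant goes entirely into one factor, so no root of \<open>c\<close> is
    taken and \<open>c = 0\<close> is allowed.\<close>
  obtain j0 :: 'm where True by blast
  define b where "b j = (if j = j0 then c else 1)" for j
  have b: "0 \<le> b j" for j using c by (simp add: b_def)
  have prod_b: "(\<Prod>j\<in>UNIV. b j) = c" unfolding b_def by (simp add: prod.delta)
  define k where "k j x = b j * g j x" for j x
  have gX: "(\<lambda>x. of_real (g j x)) \<in> fs_carrier (X j)" "fs_norm (X j) (\<lambda>x. of_real (g j x)) \<le> 1" "g j \<in> nonneg_meas M" for j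
    using g[of j] by (auto simp: unit_ball_def)
  have kX: "(\<lambda>x. of_real (k j x)) \<in> fs_carrier (X j)"
    "fs_norm (X j) (\<lambda>x. of_real (k j x)) = b j * fs_norm (X j) (\<lambda>x. of_real (g j x))" for j
    unfolding k_def using qbfs_scale_real[OF BFS gX(1) b] by auto
  have "(\<Prod>j\<in>UNIV. k j x) = c * (\<Prod>j\<in>UNIV. g j x)" for x
    by (simp add: k_def prod.distrib prod_b)
  then have kW: "k \<in> W"
    using le kX b gX(3) by (auto simp: W_def k_def nonneg_meas_def)
  then show "h \<in> fs_carrier (fs_prod M X)" using h by (auto simp: fs_prod_def W_def)
  have "fs_norm (fs_prod M X) h = (INF g\<in>W. \<Prod>j\<in>UNIV. fs_norm (X j) (\<lambda>x. of_real (g j x)))"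
    by (simp add: fs_prod_def W_def)
  also have "\<dots> \<le> (\<Prod>j\<in>UNIV. fs_norm (X j) (\<lambda>x. of_real (k j x)))"
  proof (rule cINF_lower[OF _ kW])
    show "bdd_below ((\<lambda>g. \<Prod>j\<in>UNIV. fs_norm (X j) (\<lambda>x. of_real (g j x))) ` W)"
      by (rule bdd_belowI2[where m=0]) (auto simp: W_def intro!: prod_nonneg qbfs_norm_nonneg[OF BFS])
  qed
  also have "\<dots> \<le> (\<Prod>j\<in>UNIV. b j)"
  proof (intro prod_mono conjI)
    fix j
    show "0 \<le> fs_norm (X j) (\<lambda>x. of_real (k j x))" by (rule qbfs_norm_nonneg[OF BFS kX(1)])
    show "fs_norm (X j) (\<lambda>x. of_real (k j x)) \<le> b j"
      unfolding kX(2) using gX(2)[of j] b[of j] by (intro mult_left_le) auto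
  qed
  finally show "fs_norm (fs_prod M X) h \<le> c" by (simp add: prod_b)
qed

text \<open>This is the well-definedness of \<open>T\<close> on the spaces: any single good
  \<open>V\<close>, together with the \<open>K\<close> of \<open>f\<close>, gives a weight of the
  class for which \<open>f\<close> has finite norm.\<close>

lemma (in extrapolation_space) carrier_subset: "fs_carrier X \<subseteq> (\<Union>w\<in>A_class p r s. Lpw p w)"
proof
  fix f assume f: "f \<in> fs_carrier X"
  obtain K where K: "good_K K" "\<And>V. good_V V \<Longrightarrow> Lpw_norm p (wt K V) f \<le> ennreal ((fs_norm X f + 1) * 2 powr \<beta>)"
    using Lpw_bound[OF f, of "fs_norm X f + 1"] by auto
  obtain v where "v \<in> BY'" "AE x in lebesgue. 0 < v x" by (rule BY'_positive)
  then obtain V where V: "good_V V" using V_majorant by blast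
  have "Lpw_norm p (wt K V) f < \<infinity>" using order_le_less_trans[OF K(2)[OF V] ennreal_less_top] by simp
  then have "f \<in> Lpw p (wt K V)" using qbfs_L0[OF BFS f] by (simp add: Lpw_def)
  then show "f \<in> (\<Union>w\<in>A_class p r s. Lpw p w)" using wt_A_class(1)[OF K(1) V] by blast
qed

lemma prod_le_ennreal:
  assumes "finite A" "\<And>i. i \<in> A \<Longrightarrow> f i \<le> ennreal (g i)" "\<And>i. i \<in> A \<Longrightarrow> 0 \<le> g i"
  shows "(\<Prod>i\<in>A. f i) \<le> ennreal (\<Prod>i\<in>A. g i)"
  using assms
proof (induction A rule: finite_induct)
  case (insert i A)
  have "f i * (\<Prod>i\<in>A. f i) \<le> ennreal (g i) * ennreal (\<Prod>i\<in>A. g i)"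
    using insert by (intro mult_mono) auto
  also have "\<dots> = ennreal (g i * (\<Prod>i\<in>A. g i))"
    using insert.prems by (intro ennreal_mult[symmetric] prod_nonneg) auto
  finally show ?case using insert.hyps by simp
qed simp

lemma Lp_norm_top_leD:
  assumes "0 \<le> C" "Lp_norm M top f \<le> ennreal C"
  shows "AE x in M. norm (f x) \<le> C"
proof -
  have "AE x in M. ennreal (norm (f x)) \<le> esssup M (\<lambda>x. ennreal (norm (f x)))" by (rule esssup_AE)
  then show ?thesis
  proof eventually_elim
    case (elim x)
    then have "ennreal (norm (f x)) \<le> ennreal C" using assms(2) by (simp add: Lp_norm_def)
    then show ?case using assms(1) by simp
  qed
qed

theorem theoremB:
  fixes r :: "'m::finite \<Rightarrow> real"
    and s p :: "'m \<Rightarrow> ennreal"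
    and r0 :: real and s0 p0 :: ennreal
    and T :: "('m \<Rightarrow> real ^ 'd \<Rightarrow> 'k::{real_normed_field, euclidean_space}) \<Rightarrow> real ^ 'd \<Rightarrow> 'k"
    and \<phi> :: "('m \<Rightarrow> real) \<Rightarrow> real"
    and X :: "'m \<Rightarrow> (real ^ 'd, 'k) fspace"
    and C :: "'m \<Rightarrow> real"
  assumes "\<And>j. 0 < r j"
    and "\<And>j. ennreal (r j) < s j"
    and "\<And>j. ennreal (r j) \<le> p j \<and> p j \<le> s j"
    and "1 / r0 = (\<Sum>j\<in>UNIV. 1 / r j)"
    and "1 / s0 = (\<Sum>j\<in>UNIV. 1 / s j)"
    and "1 / p0 = (\<Sum>j\<in>UNIV. 1 / p j)"
    and "L0_map lebesgue (\<lambda>j. \<Union>w\<in>A_class (p j) (r j) (s j). Lpw (p j) w) T"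
    and "increasing_fun \<phi>"
    and "\<And>w f. (\<And>j. w j \<in> A_class (p j) (r j) (s j)) \<Longrightarrow> (\<And>j. f j \<in> Lpw (p j) (w j)) \<Longrightarrow>
           Lpw_norm p0 (\<lambda>x. \<Prod>j\<in>UNIV. w j x) (T f)
             \<le> ennreal (\<phi> (\<lambda>j. enn2real (A_const (p j) (r j) (s j) (w j)))) *
               (\<Prod>j\<in>UNIV. Lpw_norm (p j) (w j) (f j))"
    and "\<And>j. quasi_BFS lebesgue (X j)"
    and "\<And>j. p_convex (ennreal (r j)) (X j)"
    and "\<And>j. q_concave (s j) (X j)"
    and "\<And>j. p j \<noteq> ennreal (r j) \<Longrightarrow> maximal_bounded (fs_rs lebesgue (X j) (r j) (s j))"
    and "\<And>j. p j \<noteq> s j \<Longrightarrow> maximal_bounded (kothe_dual lebesgue (fs_rs lebesgue (X j) (r j) (s j)))"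
    and "\<And>j. C j = 2 powr (1 / r j - rcp (s j)) *
           pow0 (maximal_norm (fs_rs lebesgue (X j) (r j) (s j))) (1 / r j - rcp (p j)) *
           pow0 (maximal_norm (kothe_dual lebesgue (fs_rs lebesgue (X j) (r j) (s j)))) (rcp (p j) - rcp (s j))"
  shows "(\<forall>j. fs_carrier (X j) \<subseteq> (\<Union>w\<in>A_class (p j) (r j) (s j). Lpw (p j) w)) \<and>
         op_bounded X (fs_prod lebesgue X) T \<and>
         op_norm X (fs_prod lebesgue X) T \<le> 2 powr (1 / r0 - rcp s0) * \<phi> C"
proof -
  have sp: "extrapolation_space (X j) (r j) (s j) (p j)" for j
  proof (intro extrapolation_space.intro convex_concave_space.intro convex_concave_space_axioms.intro
      extrapolation_space_axioms.intro sigma_finite_lebesgue)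
    show "emeasure lebesgue (space (lebesgue :: (real ^ 'd) measure)) \<noteq> 0" by simp
  qed (use assms in auto)
  have cc: "convex_concave_space lebesgue (X j) (r j) (s j)" for j
    by (rule extrapolation_space.axioms(1)[OF sp])
  define \<gamma> where "\<gamma> j = extrapolation_space.\<gamma> (r j) (p j)" for j
  define \<beta> where "\<beta> j = extrapolation_space.\<beta> (s j) (p j)" for j
  define \<sigma> where "\<sigma> j = rcp (s j)" for j
  define gK where "gK j = extrapolation_space.good_K (X j) (r j) (s j) (p j)" for j
  define gV where "gV j = extrapolation_space.good_V (X j) (r j) (s j) (p j)" for j
  define wt where "wt j = (extrapolation_space.wt (r j) (s j) (p j) :: (real ^ 'd \<Rightarrow> real) \<Rightarrow> _)" for j
  define BY where "BY j = convex_concave_space.BY lebesgue (X j) (r j) (s j)" for j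
  define BY' where "BY' j = convex_concave_space.BY' lebesgue (X j) (r j) (s j)" for j
  have \<gamma>0: "0 \<le> \<gamma> j" and \<beta>0: "0 \<le> \<beta> j" and \<sigma>0: "0 \<le> \<sigma> j" for j
    unfolding \<gamma>_def \<beta>_def \<sigma>_def
    using extrapolation_space.\<gamma>_nn[OF sp] extrapolation_space.\<beta>_nn[OF sp] rcp_nonneg by blast+
  have \<gamma>_eq: "\<gamma> j = 1 / r j - rcp (p j)" and \<beta>_eq: "\<beta> j = rcp (p j) - \<sigma> j" for j
    unfolding \<gamma>_def \<beta>_def \<sigma>_def
    using extrapolation_space.\<gamma>_def[OF sp] extrapolation_space.\<beta>_def[OF sp] by blast+
  have C_eq: "C j = extrapolation_space.CA (X j) (r j) (s j) (p j)" for j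
    unfolding assms(15) extrapolation_space.CA_def[OF sp] extrapolation_space.NY_def[OF sp]
      extrapolation_space.NY'_def[OF sp] extrapolation_space.\<gamma>_def[OF sp] extrapolation_space.\<beta>_def[OF sp] ..
  have C0: "0 \<le> C j" for j unfolding C_eq by (rule extrapolation_space.CA_nn[OF sp])
  have wt_eq: "wt j K V x = K x powr (- \<gamma> j) * V x powr \<beta> j" for j K V x
    unfolding wt_def \<gamma>_def \<beta>_def by (rule extrapolation_space.wt_def[OF sp])
  have gK: "K \<in> nonneg_meas lebesgue" "AE x in lebesgue. 0 < K x" if "gK j K" for j K
    using that unfolding gK_def extrapolation_space.good_K_def[OF sp] by blast+
  have gV: "V \<in> nonneg_meas lebesgue" "AE x in lebesgue. 0 < V x" if "gV j V" for j V
    using that unfolding gV_def extrapolation_space.good_V_def[OF sp] by blast+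
  have dom: "fs_carrier (X j) \<subseteq> (\<Union>w\<in>A_class (p j) (r j) (s j). Lpw (p j) w)" for j
    by (rule extrapolation_space.carrier_subset[OF sp])
  have V_ex: "\<exists>V. gV j V \<and> (AE x in lebesgue. v x \<le> V x)" if "v \<in> BY' j" "AE x in lebesgue. 0 < v x" for j v
    using that unfolding gV_def BY'_def by (rule extrapolation_space.V_majorant[OF sp])
  have BY'_pos: "\<exists>v. v \<in> BY' j \<and> (AE x in lebesgue. 0 < v x)" for j
    using convex_concave_space.BY'_positive[OF cc, of j] unfolding BY'_def by blast
  define \<phi>C where "\<phi>C = \<phi> C"
  have \<phi>C0: "0 \<le> \<phi>C" using assms(8) C0 unfolding \<phi>C_def increasing_fun_def by blast
  define \<pi> where "\<pi> = (\<Sum>j\<in>UNIV. rcp (p j))"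
  define \<sigma>\<^sub>0 where "\<sigma>\<^sub>0 = (\<Sum>j\<in>UNIV. \<sigma> j)"
  have ps0: "p j \<noteq> 0" "s j \<noteq> 0" for j
    using assms(1)[of j] assms(3)[of j] by auto
  have "1 / p0 = ennreal \<pi>"
    unfolding assms(6) one_div_ennreal[OF ps0(1)] \<pi>_def by (rule sum_ennreal) (rule rcp_nonneg)
  note p0_\<pi> = this
  have "1 / s0 = ennreal \<sigma>\<^sub>0"
    unfolding assms(5) one_div_ennreal[OF ps0(2)] \<sigma>\<^sub>0_def \<sigma>_def by (rule sum_ennreal) (rule rcp_nonneg)
  then have rcp_s0: "rcp s0 = \<sigma>\<^sub>0" using \<sigma>0 by (simp add: rcp_def \<sigma>\<^sub>0_def sum_nonneg)
  have \<sigma>00: "0 \<le> \<sigma>\<^sub>0" unfolding \<sigma>\<^sub>0_def using \<sigma>0 by (intro sum_nonneg) auto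
  have sum_\<beta>: "(\<Sum>j\<in>UNIV. \<beta> j) + \<sigma>\<^sub>0 = \<pi>"
    by (simp add: \<beta>_eq \<sigma>\<^sub>0_def \<pi>_def sum_subtractf)
  \<comment> \<open>The \<open>\<beta>\<close> part comes from measuring the \<open>f j\<close>, the
    \<open>\<gamma>\<close> part from putting back the \<open>K j\<close>.\<close>
  have const: "(\<Prod>j\<in>UNIV. 2 powr \<beta> j) * (\<Prod>j\<in>UNIV. 2 powr \<gamma> j) = 2 powr (1 / r0 - rcp s0)"
  proof -
    have "(\<Prod>j\<in>UNIV. 2 powr \<beta> j) * (\<Prod>j\<in>UNIV. 2 powr \<gamma> j) = 2 powr ((\<Sum>j\<in>UNIV. \<beta> j) + (\<Sum>j\<in>UNIV. \<gamma> j))"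
      by (simp add: powr_add powr_sum)
    also have "(\<Sum>j\<in>UNIV. \<beta> j) + (\<Sum>j\<in>UNIV. \<gamma> j) = 1 / r0 - rcp s0"
      unfolding assms(4) rcp_s0 by (simp add: \<beta>_eq \<gamma>_eq \<sigma>\<^sub>0_def sum_subtractf)
    finally show ?thesis .
  qed
  \<comment> \<open>\<open>\<epsilon>\<close> pays for the strict inequality in the factorization of
    each \<open>f j\<close> and for the two strict inequalities \<open>0 < D < D'\<close> in
    \<open>product_factorization\<close>.\<close>
  have main: "T f \<in> fs_carrier (fs_prod lebesgue X) \<and> fs_norm (fs_prod lebesgue X) (T f)
      \<le> (\<phi>C * (\<Prod>j\<in>UNIV. (fs_norm (X j) (f j) + \<epsilon>) * 2 powr \<beta> j) + 2 * \<epsilon>) * (\<Prod>j\<in>UNIV. 2 powr \<gamma> j)"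
    if f: "\<And>j. f j \<in> fs_carrier (X j)" and \<epsilon>: "0 < \<epsilon>" for f and \<epsilon> :: real
  proof -
    define n where "n j = fs_norm (X j) (f j)" for j
    have n0: "0 \<le> n j" for j unfolding n_def by (rule qbfs_norm_nonneg[OF assms(10) f])
    have "\<exists>K. gK j K \<and> (\<forall>V. gV j V \<longrightarrow> Lpw_norm (p j) (wt j K V) (f j) \<le> ennreal ((n j + \<epsilon>) * 2 powr \<beta> j))" for j
    proof (rule extrapolation_space.Lpw_bound[OF sp f])
      show "fs_norm (X j) (f j) < n j + \<epsilon>" using \<epsilon> by (simp add: n_def)
    qed (auto simp: gK_def gV_def wt_def \<beta>_def)
    then have "\<forall>j. \<exists>K. gK j K \<and> (\<forall>V. gV j V \<longrightarrow> Lpw_norm (p j) (wt j K V) (f j) \<le> ennreal ((n j + \<epsilon>) * 2 powr \<beta> j))" ..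
    from choice[OF this] obtain K where
      "\<forall>j. gK j (K j) \<and> (\<forall>V. gV j V \<longrightarrow> Lpw_norm (p j) (wt j (K j) V) (f j) \<le> ennreal ((n j + \<epsilon>) * 2 powr \<beta> j))" ..
    then have K: "\<And>j. gK j (K j)"
      and K_le: "\<And>j V. gV j V \<Longrightarrow> Lpw_norm (p j) (wt j (K j) V) (f j) \<le> ennreal ((n j + \<epsilon>) * 2 powr \<beta> j)"
      by blast+
    define D\<^sub>0 where "D\<^sub>0 = \<phi>C * (\<Prod>j\<in>UNIV. (n j + \<epsilon>) * 2 powr \<beta> j)"
    have D00: "0 \<le> D\<^sub>0"
      unfolding D\<^sub>0_def using \<phi>C0 n0 \<epsilon> by (intro mult_nonneg_nonneg prod_nonneg) (auto intro: add_nonneg_nonneg less_imp_le)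
    have TL: "T f \<in> L0 lebesgue" using assms(7) f dom unfolding L0_map_def by blast
    then have [measurable]: "T f \<in> borel_measurable lebesgue" by (simp add: L0_def)
    have Km[measurable]: "K j \<in> borel_measurable lebesgue" and K0: "0 \<le> K j x" for j x
      using gK(1)[OF K, of j] by (auto simp: nonneg_meas_def)
    \<comment> \<open>The \<open>K j\<close> are fixed while the \<open>V j\<close> vary, so one
      function \<open>T f\<close> is tested against a whole family of weights with the same
      bound.\<close>
    have key: "Lp_norm lebesgue p0 (\<lambda>x. T f x * of_real (\<Prod>j\<in>UNIV. wt j (K j) (V j) x)) \<le> ennreal D\<^sub>0"
      if V: "\<And>j. gV j (V j)" for V
    proof -
      have A: "wt j (K j) (V j) \<in> A_class (p j) (r j) (s j)"
        "A_const (p j) (r j) (s j) (wt j (K j) (V j)) \<le> ennreal (C j)" for j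
        unfolding wt_def C_eq
        using K[of j] V[of j] extrapolation_space.wt_A_class[OF sp] unfolding gK_def gV_def by blast+
      have fL: "f j \<in> Lpw (p j) (wt j (K j) (V j))" for j
        using order_le_less_trans[OF K_le[OF V] ennreal_less_top] qbfs_L0[OF assms(10) f]
        by (simp add: Lpw_def)
      have "Lpw_norm p0 (\<lambda>x. \<Prod>j\<in>UNIV. wt j (K j) (V j) x) (T f)
          \<le> ennreal (\<phi> (\<lambda>j. enn2real (A_const (p j) (r j) (s j) (wt j (K j) (V j))))) *
            (\<Prod>j\<in>UNIV. Lpw_norm (p j) (wt j (K j) (V j)) (f j))"
        by (rule assms(9)[OF A(1) fL])
      also have "\<dots> \<le> ennreal \<phi>C * ennreal (\<Prod>j\<in>UNIV. (n j + \<epsilon>) * 2 powr \<beta> j)"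
      proof (rule mult_mono)
        have "enn2real (A_const (p j) (r j) (s j) (wt j (K j) (V j))) \<le> C j" for j
          using enn2real_mono[OF A(2)[of j]] C0[of j] by simp
        then show "ennreal (\<phi> (\<lambda>j. enn2real (A_const (p j) (r j) (s j) (wt j (K j) (V j))))) \<le> ennreal \<phi>C"
          unfolding \<phi>C_def by (intro ennreal_leI increasing_fun_mono[OF assms(8)]) auto
        show "(\<Prod>j\<in>UNIV. Lpw_norm (p j) (wt j (K j) (V j)) (f j)) \<le> ennreal (\<Prod>j\<in>UNIV. (n j + \<epsilon>) * 2 powr \<beta> j)"
          using n0 \<epsilon> by (intro prod_le_ennreal K_le V) (auto intro: add_nonneg_nonneg less_imp_le)
      qed auto
      also have "\<dots> = ennreal D\<^sub>0"
        unfolding D\<^sub>0_def using \<phi>C0 n0 \<epsilon> by (intro ennreal_mult[symmetric] prod_nonneg) (auto intro: add_nonneg_nonneg less_imp_le)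
      finally show ?thesis by (simp only: Lpw_norm_def)
    qed
    define H where "H x = norm (T f x) * (\<Prod>j\<in>UNIV. K j x powr (- \<gamma> j))" for x
    have HN: "H \<in> nonneg_meas lebesgue"
      unfolding H_def[abs_def] by (auto simp: nonneg_meas_def intro!: mult_nonneg_nonneg prod_nonneg)
    have norm_eq: "norm (T f x * of_real (\<Prod>j\<in>UNIV. wt j (K j) (V j) x)) = H x * (\<Prod>j\<in>UNIV. V j x powr \<beta> j)" for V x
      by (simp add: norm_mult H_def wt_eq prod.distrib abs_mult abs_prod flip: of_real_prod)
    have "\<exists>y a. (\<forall>j. y j \<in> BY j) \<and> a \<in> nonneg_meas lebesgue \<and> (\<integral>\<^sup>+x. ennreal (a x) \<partial>lebesgue) \<le> 1 \<and>
        (AE x in lebesgue. H x \<le> (D\<^sub>0 + 2 * \<epsilon>) * ((\<Prod>j\<in>UNIV. pow0 (y j x) (\<beta> j)) * pow0 (a x) \<sigma>\<^sub>0))"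
    proof (cases "\<pi> = 0")
      case True
      then have "p0 = top" using p0_\<pi> by (simp add: ennreal_divide_eq_0_iff)
      \<comment> \<open>For infinite \<open>p0\<close> all these exponents vanish. One choice of the
        \<open>V j\<close> already bounds \<open>H\<close> by \<open>D\<^sub>0\<close>, and the
        factors are trivial.\<close>
      have "(\<Sum>j\<in>UNIV. \<beta> j) = 0" "\<sigma>\<^sub>0 = 0"
        using sum_\<beta> \<sigma>00 True sum_nonneg[of UNIV \<beta>] \<beta>0 by (smt (verit))+
      then have \<beta>z: "\<beta> j = 0" for j using \<beta>0 by (simp add: sum_nonneg_eq_0_iff)
      have "\<forall>j. \<exists>V. gV j V" using BY'_pos V_ex by blast
      from choice[OF this] obtain V where V: "\<forall>j. gV j (V j)" ..
      then have "Lp_norm lebesgue top (\<lambda>x. T f x * of_real (\<Prod>j\<in>UNIV. wt j (K j) (V j) x)) \<le> ennreal D\<^sub>0"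
        using key[of V] unfolding \<open>p0 = top\<close> by blast
      from Lp_norm_top_leD[OF D00 this] have "AE x in lebesgue. H x * (\<Prod>j\<in>UNIV. V j x powr \<beta> j) \<le> D\<^sub>0"
        unfolding norm_eq .
      moreover have "AE x in lebesgue. \<forall>j\<in>UNIV. 0 < V j x" using gV(2) V by (subst AE_finite_all) auto
      ultimately have "AE x in lebesgue. H x \<le> (D\<^sub>0 + 2 * \<epsilon>) * ((\<Prod>j\<in>UNIV. pow0 0 (\<beta> j)) * pow0 0 \<sigma>\<^sub>0)"
      proof eventually_elim
        case (elim x)
        have "(\<Prod>j\<in>UNIV. V j x powr \<beta> j) = 1"
          using elim(2) by (intro prod.neutral) (auto simp: \<beta>z order_less_imp_not_eq2)
        then show ?case using elim(1) \<epsilon> by (simp add: pow0_def \<beta>z \<open>\<sigma>\<^sub>0 = 0\<close>)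
      qed
      moreover have "(\<lambda>x. 0) \<in> BY j" for j
        unfolding BY_def by (rule solid_ball.zero[OF function_ball.axioms(1)[OF convex_concave_space.BY_ball[OF cc]]])
      ultimately show ?thesis
        by (intro exI[of _ "\<lambda>j x. 0"] exI[of _ "\<lambda>x. 0"]) (auto simp: nonneg_meas_def)
    next
      case False
      have "0 \<le> \<pi>" unfolding \<pi>_def by (intro sum_nonneg) (simp add: rcp_nonneg)
      then have \<pi>: "0 < \<pi>" using False by simp
      define P where "P = 1 / \<pi>"
      have P: "0 < P" "P * ((\<Sum>j\<in>UNIV. \<beta> j) + \<sigma>\<^sub>0) = 1" using \<pi> by (auto simp: P_def sum_\<beta>)
      have "p0 \<noteq> top" "p0 \<noteq> 0" using p0_\<pi> \<pi> by auto
      then obtain q where q: "0 < q" "p0 = ennreal q" by (cases p0) auto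
      then have "1 / q = \<pi>" using p0_\<pi> \<pi> by (simp add: divide_ennreal flip: ennreal_1)
      then have p0P: "p0 = ennreal P" using q by (auto simp: P_def)
      have "\<forall>j. \<exists>u. u \<in> BY' j \<and> (AE x in lebesgue. 0 < u x)" using BY'_pos by blast
      from choice[OF this] obtain u where u: "\<forall>j. u j \<in> BY' j \<and> (AE x in lebesgue. 0 < u j x)" ..
      have polar_BY': "polar lebesgue (BY' j) = BY j" for j
        unfolding BY'_def BY_def by (rule convex_concave_space.BY'_polar[OF cc])
      show ?thesis
      proof (rule product_factorization[OF sigma_finite_lebesgue _ _ _ \<beta>0 \<sigma>00 P HN])
        show "function_ball lebesgue (BY' j)" for j
          unfolding BY'_def by (rule convex_concave_space.BY'_ball[OF cc])
        show "u j \<in> BY' j" "AE x in lebesgue. 0 < u j x" for j using u by auto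
        \<comment> \<open>\<open>D\<^sub>0\<close> may be 0, so it cannot serve as the constant
          itself.\<close>
        show "0 < D\<^sub>0 + \<epsilon>" "D\<^sub>0 + \<epsilon> < D\<^sub>0 + 2 * \<epsilon>" using D00 \<epsilon> by auto
        fix v assume v: "\<And>j. v j \<in> BY' j" "\<And>j. AE x in lebesgue. 0 < v j x"
        \<comment> \<open>The arbitrary \<open>v j\<close> need not produce admissible weights;
          passing to majorants only enlarges the integrand, as \<open>\<beta> j\<close> is
          nonnegative.\<close>
        have "\<forall>j. \<exists>V. gV j V \<and> (AE x in lebesgue. v j x \<le> V x)" using V_ex v by blast
        from choice[OF this] obtain V where V: "\<forall>j. gV j (V j) \<and> (AE x in lebesgue. v j x \<le> V j x)" ..
        then have gVV: "\<And>j. gV j (V j)" by blast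
        have "AE x in lebesgue. \<forall>j\<in>UNIV. v j x \<le> V j x" using V by (subst AE_finite_all) auto
        moreover have "AE x in lebesgue. \<forall>j\<in>UNIV. 0 < v j x" using v(2) by (subst AE_finite_all) auto
        ultimately have "AE x in lebesgue. ennreal ((H x * (\<Prod>j\<in>UNIV. v j x powr \<beta> j)) powr P)
            \<le> ennreal (norm (T f x * of_real (\<Prod>j\<in>UNIV. wt j (K j) (V j) x)) powr P)"
        proof eventually_elim
          case (elim x)
          have "(\<Prod>j\<in>UNIV. v j x powr \<beta> j) \<le> (\<Prod>j\<in>UNIV. V j x powr \<beta> j)"
            using elim \<beta>0 by (intro prod_mono conjI powr_mono2) (auto intro: less_imp_le)
          then show ?case
            unfolding norm_eq using P(1) nonneg_measD(2)[OF HN, of x]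
            by (intro ennreal_leI powr_mono2 mult_left_mono mult_nonneg_nonneg prod_nonneg) auto
        qed
        then have "(\<integral>\<^sup>+x. ennreal ((H x * (\<Prod>j\<in>UNIV. v j x powr \<beta> j)) powr P) \<partial>lebesgue)
            \<le> (\<integral>\<^sup>+x. ennreal (norm (T f x * of_real (\<Prod>j\<in>UNIV. wt j (K j) (V j) x)) powr P) \<partial>lebesgue)"
          by (rule nn_integral_mono_AE)
        also have "\<dots> \<le> ennreal (D\<^sub>0 powr P)"
          by (rule Lp_norm_leD[OF P(1) D00 key[OF gVV, unfolded p0P]])
        also have "\<dots> \<le> ennreal ((D\<^sub>0 + \<epsilon>) powr P)"
          using D00 \<epsilon> P(1) by (intro ennreal_leI powr_mono2) auto
        finally show "(\<integral>\<^sup>+x. ennreal ((H x * (\<Prod>j\<in>UNIV. v j x powr \<beta> j)) powr P) \<partial>lebesgue) \<le> ennreal ((D\<^sub>0 + \<epsilon>) powr P)" .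
      next
        fix y a assume "\<And>j. y j \<in> polar lebesgue (BY' j)" "a \<in> nonneg_meas lebesgue" "(\<integral>\<^sup>+x. ennreal (a x) \<partial>lebesgue) \<le> 1"
          "AE x in lebesgue. H x \<le> (D\<^sub>0 + 2 * \<epsilon>) * ((\<Prod>j\<in>UNIV. pow0 (y j x) (\<beta> j)) * pow0 (a x) \<sigma>\<^sub>0)"
        then show ?thesis unfolding polar_BY' by blast
      qed
    qed
    then obtain y a where y: "\<And>j. y j \<in> BY j" and a: "a \<in> nonneg_meas lebesgue" "(\<integral>\<^sup>+x. ennreal (a x) \<partial>lebesgue) \<le> 1"
      and H_le: "AE x in lebesgue. H x \<le> (D\<^sub>0 + 2 * \<epsilon>) * ((\<Prod>j\<in>UNIV. pow0 (y j x) (\<beta> j)) * pow0 (a x) \<sigma>\<^sub>0)"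
      by blast
    \<comment> \<open>The common \<open>a\<close> is distributed over the factors in proportion to
      the \<open>\<sigma> j\<close>, whose sum is \<open>\<sigma>\<^sub>0\<close>.\<close>
    define g where "g j x = (K j x / 2) powr \<gamma> j * pow0 (y j x) (\<beta> j) * pow0 (a x) (\<sigma> j)" for j x
    have g: "g j \<in> unit_ball lebesgue (X j)" for j
      using extrapolation_space.synthesis[OF sp K[of j, unfolded gK_def] y[of j, unfolded BY_def] a]
      unfolding g_def[abs_def] \<gamma>_def \<beta>_def \<sigma>_def .
    define c where "c = (D\<^sub>0 + 2 * \<epsilon>) * (\<Prod>j\<in>UNIV. 2 powr \<gamma> j)"
    have c: "0 \<le> c" unfolding c_def using D00 \<epsilon> by (intro mult_nonneg_nonneg prod_nonneg) auto
    have "AE x in lebesgue. \<forall>j\<in>UNIV. 0 < K j x" using gK(2)[OF K] by (subst AE_finite_all) auto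
    with H_le have "AE x in lebesgue. norm (T f x) \<le> c * (\<Prod>j\<in>UNIV. g j x)"
    proof eventually_elim
      case (elim x)
      have "norm (T f x) = H x * (\<Prod>j\<in>UNIV. K j x powr \<gamma> j)"
      proof -
        have "(\<Prod>j\<in>UNIV. K j x powr (- \<gamma> j)) * (\<Prod>j\<in>UNIV. K j x powr \<gamma> j) = 1"
          unfolding prod.distrib[symmetric] using elim(2)
          by (intro prod.neutral) (auto simp: order_less_imp_not_eq2 simp flip: powr_add)
        then show ?thesis by (simp add: H_def mult.assoc)
      qed
      also have "\<dots> \<le> (D\<^sub>0 + 2 * \<epsilon>) * ((\<Prod>j\<in>UNIV. pow0 (y j x) (\<beta> j)) * pow0 (a x) \<sigma>\<^sub>0) * (\<Prod>j\<in>UNIV. K j x powr \<gamma> j)"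
        using elim(1) by (intro mult_right_mono prod_nonneg) auto
      also have "(\<Prod>j\<in>UNIV. K j x powr \<gamma> j) = (\<Prod>j\<in>UNIV. 2 powr \<gamma> j) * (\<Prod>j\<in>UNIV. (K j x / 2) powr \<gamma> j)"
        unfolding prod.distrib[symmetric] using K0 by (intro prod.cong) (auto simp: powr_divide)
      also have "pow0 (a x) \<sigma>\<^sub>0 = (\<Prod>j\<in>UNIV. pow0 (a x) (\<sigma> j))"
        unfolding \<sigma>\<^sub>0_def using \<sigma>0 by (intro pow0_sum) auto
      finally show ?case by (simp add: c_def g_def prod.distrib ac_simps)
    qed
    from fs_prod_le[OF assms(10) g TL c this] show ?thesis
      by (simp add: c_def D\<^sub>0_def n_def)
  qed
  have "bounded_by X (fs_prod lebesgue X) T (2 powr (1 / r0 - rcp s0) * \<phi> C)"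
    unfolding bounded_by_def
  proof (intro conjI allI impI)
    show "0 \<le> 2 powr (1 / r0 - rcp s0) * \<phi> C" using \<phi>C0 by (simp add: \<phi>C_def)
    fix f assume f: "\<forall>j. f j \<in> fs_carrier (X j)"
    then show "T f \<in> fs_carrier (fs_prod lebesgue X)" using main[of f 1] by simp
    let ?b = "\<lambda>\<epsilon>. (\<phi>C * (\<Prod>j\<in>UNIV. (fs_norm (X j) (f j) + \<epsilon>) * 2 powr \<beta> j) + 2 * \<epsilon>) * (\<Prod>j\<in>UNIV. 2 powr \<gamma> j)"
    \<comment> \<open>The bound depends continuously on the slack, while the norm of
      \<open>T f\<close> does not depend on it at all.\<close>
    have "(\<lambda>n. ?b (1 / real (Suc n))) \<longlonglongrightarrow> ?b 0"
      by (intro tendsto_intros LIMSEQ_Suc[OF lim_1_over_n])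
    moreover have "fs_norm (fs_prod lebesgue X) (T f) \<le> ?b (1 / real (Suc n))" for n
      by (rule conjunct2[OF main]) (use f in auto)
    ultimately have "fs_norm (fs_prod lebesgue X) (T f) \<le> ?b 0"
      by (intro LIMSEQ_le_const) blast+
    also have "?b 0 = \<phi>C * (\<Prod>j\<in>UNIV. fs_norm (X j) (f j)) * ((\<Prod>j\<in>UNIV. 2 powr \<beta> j) * (\<Prod>j\<in>UNIV. 2 powr \<gamma> j))"
      by (simp add: prod.distrib)
    finally show "fs_norm (fs_prod lebesgue X) (T f) \<le> 2 powr (1 / r0 - rcp s0) * \<phi> C * (\<Prod>j\<in>UNIV. fs_norm (X j) (f j))"
      unfolding const by (simp add: \<phi>C_def ac_simps)
  qed
  moreover from this have "op_norm X (fs_prod lebesgue X) T \<le> 2 powr (1 / r0 - rcp s0) * \<phi> C"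
    unfolding op_norm_def by (intro cInf_lower bdd_belowI[where m=0]) (auto simp: bounded_by_def)
  ultimately show ?thesis
    using dom unfolding op_bounded_def by blast
qed

end
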